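(* Let $\mu\in(-\frac14,0)$, $r_0=1/e$, $V(r)=\frac1{r^2(\ln\frac1r)^2}$ and $m_\mu=4\pi\sqrt{1+4\mu}$. Then $$\sup_{u\in\mathcal H^1_{V,\mu,0}(B_{r_0}),\ \|u\|_{V,\mu}\leq1}\int_{B_{r_0}}e^{m_\mu|u|^2}dx<\infty,$$ and the exponent $m_\mu$ is optimal, i.e. the supremum is infinite if $m_\mu$ is replaced by any $\alpha>m_\mu$.
   Context: $B_{r_0}$ is the open ball of radius $r_0$ centered at the origin in $\mathbb R^2$. $\mathcal H^1_{V,\mu,0}(B_{r_0})$ is the completion of $C_c^\infty(B_{r_0}\setminus\{0\})$ under the norm $$\|u\|_{V,\mu}=\Big(\int_{B_{r_0}}\big(|\nabla u|^2+\mu V(|x|)u^2\big)dx\Big)^{1/2}.$$ *)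

theory Defs
  imports "HOL-Analysis.Analysis"
begin

definition grad :: "('a::euclidean_space \<Rightarrow> real) \<Rightarrow> 'a \<Rightarrow> 'a" where
  "grad f x = (THE D. GDERIV f x :> D)"

primrec class_C :: "nat \<Rightarrow> ('a::euclidean_space \<Rightarrow> real) \<Rightarrow> bool" where
  "class_C 0 f \<longleftrightarrow> continuous_on UNIV f"
| "class_C (Suc k) f \<longleftrightarrow>
     f differentiable_on UNIV \<and> (\<forall>b\<in>Basis. class_C k (\<lambda>x. frechet_derivative f (at x) b))"

text \<open>Elements of \<open>C\<^sub>c\<^sup>\<infinity>(\<Omega>)\<close> are taken as functions on the whole space, extended by zero.\<close>

definition test_functions :: "'a::euclidean_space set \<Rightarrow> ('a \<Rightarrow> real) set" where
  "test_functions \<Omega> =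
     {f. (\<forall>k. class_C k f) \<and> compact (closure {x. f x \<noteq> 0}) \<and> closure {x. f x \<noteq> 0} \<subseteq> \<Omega>}"

definition pre_norm ::
    "(real \<Rightarrow> real) \<Rightarrow> real \<Rightarrow> real \<Rightarrow> (real^2 \<Rightarrow> real) \<Rightarrow> real" where
  "pre_norm V \<mu> r0 f =
     sqrt (LINT x|lebesgue_on (ball 0 r0). (norm (grad f x))\<^sup>2 + \<mu> * V (norm x) * (f x)\<^sup>2)"

text \<open>
  The completion is realised as a space of functions on the ball: its elements are represented by
  \<open>pre_norm\<close>-Cauchy sequences of test functions, and such a sequence is identified with its limit
  in \<open>L\<^sup>2\<close> of the ball, whenever \<open>pre_norm\<close> dominates the \<open>L\<^sup>2\<close> norm. In the intended range of \<open>V\<close>,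
  \<open>\<mu>\<close> and \<open>r0\<close> this follows from the logarithmic Hardy inequality
  \<open>\<integral> |\<nabla>u|\<^sup>2 \<ge> 1/4 \<integral> u\<^sup>2 / (|x|\<^sup>2 (ln (1/|x|))\<^sup>2)\<close>; moreover two Cauchy sequences with the same
  \<open>L\<^sup>2\<close> limit are then at \<open>pre_norm\<close>-distance tending to zero, so that the identification is
  injective and the norm below is well defined. Functions are not quotiented by a.e. equality, and
  their values outside the ball are irrelevant.
\<close>

definition represents ::
    "(real \<Rightarrow> real) \<Rightarrow> real \<Rightarrow> real \<Rightarrow> (nat \<Rightarrow> real^2 \<Rightarrow> real) \<Rightarrow> (real^2 \<Rightarrow> real) \<Rightarrow> bool" where
  "represents V \<mu> r0 \<phi> u \<longleftrightarrow>
     (\<forall>n. \<phi> n \<in> test_functions (ball 0 r0 - {0})) \<and>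
     (\<forall>\<epsilon>>0. \<exists>N. \<forall>m\<ge>N. \<forall>n\<ge>N. pre_norm V \<mu> r0 (\<lambda>x. \<phi> m x - \<phi> n x) < \<epsilon>) \<and>
     u \<in> borel_measurable (lebesgue_on (ball 0 r0)) \<and>
     (\<lambda>n. \<integral>\<^sup>+x. ennreal ((\<phi> n x - u x)\<^sup>2) \<partial>lebesgue_on (ball 0 r0)) \<longlonglongrightarrow> 0"

definition H1_space :: "(real \<Rightarrow> real) \<Rightarrow> real \<Rightarrow> real \<Rightarrow> (real^2 \<Rightarrow> real) set" where
  "H1_space V \<mu> r0 = {u. \<exists>\<phi>. represents V \<mu> r0 \<phi> u}"

definition H1_norm ::
    "(real \<Rightarrow> real) \<Rightarrow> real \<Rightarrow> real \<Rightarrow> (real^2 \<Rightarrow> real) \<Rightarrow> real" where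
  "H1_norm V \<mu> r0 u =
     (THE N. \<exists>\<phi>. represents V \<mu> r0 \<phi> u \<and> (\<lambda>n. pre_norm V \<mu> r0 (\<phi> n)) \<longlonglongrightarrow> N)"

end

theory Submission
  imports Defs
begin

text \<open>
  In the coordinates $t = \ln (1/|x|)$, $\theta = \arg x$ the punctured ball becomes the half
  cylinder $t > 1$ and the energy of $u$ becomes
  $\int\int u_t^2 + u_\theta^2 + \mu u^2 / t^2$. No rearrangement is needed: $u$ is split into its
  circular mean $U(t)$ and the remainder $g$, and both the energy and the exponent split along.

  Write $s = \sqrt{1 + 4\mu}$ and $c = (1-s)/2$, so that $t^c$ solves $w'' = \mu w / t^2$. The energy of
  $U$ is $2\pi\int (U' - cU/t)^2$, and Cauchy-Schwarz for $t^{-c}U$ gives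
  $4\pi s U^2 \le 2t$ when this energy is at most 1. As in Moser's argument, almost equality
  within $X$ can occur only on $[1,X]$ and on one further interval of length $O(X)$.

  For $g$ Wirtinger's inequality on circles absorbs the potential: the energy of $g$ is at least
  $(1+2\mu)\int\int|\nabla g|^2$, and $1 + 2\mu > s$. Hence $g$ only has to be controlled with an exponent
  strictly below the critical one $4\pi$, which Hedberg's splitting of the potential
  $\int|\nabla g(y)|/|x-y|\,dy$ yields on every window $p \le t \le q$.

  For the optimality, $\sqrt t\, h(\ln (t/l))$ has an energy independent of $l$, where $h$ is a
  smooth compactly supported approximation of the extremal $e^{-s|z|/2}$; the exponential
  integral grows linearly in $l$.
\<close>

section \<open>The circular mean\<close>

text \<open>At the critical exponent there is no room for a fixed loss in the cross term 2 U g. Let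
  E_U and E_g be the energies of the two parts, with E_U + E_g < 1. Young's inequality is used with
  weights adapted to them, (U + g)^2 \<le> U^2 / (1 - d) + g^2 / d for some d between E_g and 1 -
  E_U. Each part is thus divided by its own share of the energy and thereby normalised, however the
  energy is distributed. The exponential factors accordingly into \<open>exp (\<psi> t)\<close>,
  which depends on t alone, and an exponential of g. The two bounds fit together because the
  integral of the second factor over a window grows at most linearly with its length; summing over
  the levels of \<psi> leaves the convergent series of (j + 1) exp (-j).

  All constants depend on \<mu> only and not on the support of the test function, so the bound
  passes to the completion by Fatou's lemma. There the norm is given by a definite description. That
  it is well defined rests on the closability of the form in L^2, which comes from an integration by
  parts: tested against a fixed test function, the form is an L^2 pairing with a bounded
  function.\<close>

text \<open>The integral of (l f - k g)^2 is a nonnegative quadratic form in (l, k); l = C and k = B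
  turn it into C (A C - B^2).\<close>

lemma integral_Cauchy_Schwarz:
  fixes f g :: "real \<Rightarrow> real"
  assumes f: "continuous_on {a..b} f" and g: "continuous_on {a..b} g"
  shows "(integral {a..b} (\<lambda>x. f x * g x))\<^sup>2 \<le> integral {a..b} (\<lambda>x. (f x)\<^sup>2) * integral {a..b} (\<lambda>x. (g x)\<^sup>2)"
proof -
  let ?I = "integral {a..b}"
  define A B C where "A = ?I (\<lambda>x. (f x)\<^sup>2)" "B = ?I (\<lambda>x. f x * g x)" "C = ?I (\<lambda>x. (g x)\<^sup>2)"
  have *: "0 \<le> l\<^sup>2 * A - 2 * l * k * B + k\<^sup>2 * C" for k l
  proof -
    have "0 \<le> ?I (\<lambda>x. (l * f x - k * g x)\<^sup>2)"
      by (intro integral_nonneg integrable_continuous_real continuous_intros f g) auto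
    also have "\<dots> = ?I (\<lambda>x. l\<^sup>2 * (f x)\<^sup>2 - 2 * l * k * (f x * g x) + k\<^sup>2 * (g x)\<^sup>2)"
      by (intro integral_cong) (simp add: power2_eq_square algebra_simps)
    also have "\<dots> = ?I (\<lambda>x. l\<^sup>2 * (f x)\<^sup>2) - ?I (\<lambda>x. 2 * l * k * (f x * g x)) + ?I (\<lambda>x. k\<^sup>2 * (g x)\<^sup>2)"
      by (subst integral_add integral_diff; (intro integrable_continuous_real continuous_intros f g)?)+ simp
    also have "\<dots> = l\<^sup>2 * A - 2 * l * k * B + k\<^sup>2 * C"
      unfolding A_B_C_def by simp
    finally show ?thesis .
  qed
  have AC: "0 \<le> A" "0 \<le> C"
    unfolding A_B_C_def by (intro integral_nonneg integrable_continuous_real continuous_intros f g; simp)+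
  show ?thesis
  proof (cases "C = 0")
    case True
    have "B = 0"
    proof (rule ccontr)
      assume "B \<noteq> 0"
      \<comment> \<open>For C = 0 and l = 1 the form is affine in k, and this k gives it the value
        -1.\<close>
      then show False using *[of 1 "(A + 1) / (2 * B)"] True AC by (simp add: field_simps)
    qed
    then show ?thesis using True unfolding A_B_C_def by simp
  next
    case False
    have "0 \<le> C * (A * C - B\<^sup>2)" using *[of C B] by (simp add: power2_eq_square algebra_simps)
    then have "0 \<le> A * C - B\<^sup>2" using False AC(2) by (simp add: zero_le_mult_iff)
    then show ?thesis unfolding A_B_C_def by simp
  qed
qed

text \<open>By concavity of x^s the chord is at least as steep as the tangent at its right end. This
  carries length estimates in the variable t^s back to t.\<close>

lemma powr_diff_ge:
  fixes s x y :: real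
  assumes "0 < s" "s < 1" "0 < x" "x \<le> y"
  shows "s * y powr (s - 1) * (y - x) \<le> y powr s - x powr s"
proof (cases "x = y")
  case False
  then have "x < y" using assms by simp
  have "\<exists>z>x. z < y \<and> y powr s - x powr s = (y - x) * (s * z powr (s - 1))"
    using \<open>x < y\<close> assms by (intro MVT2) (auto intro!: derivative_eq_intros)
  then obtain z where z: "x < z" "z < y" "y powr s - x powr s = (y - x) * (s * z powr (s - 1))" by blast
  have "y powr (s - 1) \<le> z powr (s - 1)" using z assms by (intro powr_mono2') auto
  then show ?thesis using z(3) assms \<open>x < y\<close> by (simp add: mult.commute mult.left_commute)
qed simp

text \<open>A small deficit Y1 of y1^2 below \<tau>1 forces e1 \<ge> 1 - Y1 / \<tau>1, so at most Y1
  / \<tau>1 of the energy is left for the increment of y after \<tau>1. Expanding y2^2 around y1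
  then gives d - Y2 \<le> 3/4 d + 4 Y1 for d = \<tau>2 - \<tau>1, and Y2 \<le> Y1 yields the factor
  20. The bound Y1 \<le> \<tau>1 / 2 keeps the quadratic term below d / 2.\<close>

lemma moser_algebra:
  fixes \<tau>1 \<tau>2 y1 y2 Y1 Y2 e1 e2 :: real
  assumes "0 < \<tau>1" "\<tau>1 \<le> \<tau>2" "0 \<le> Y2" "Y2 \<le> Y1" "Y1 \<le> \<tau>1 / 2"
    and "y1\<^sup>2 \<ge> \<tau>1 - Y1" "y2\<^sup>2 \<ge> \<tau>2 - Y2" "y1\<^sup>2 \<le> e1 * \<tau>1" "0 \<le> e1" "e2 \<le> 1" "e1 \<le> e2"
    and "(y2 - y1)\<^sup>2 \<le> (e2 - e1) * (\<tau>2 - \<tau>1)"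
  shows "\<tau>2 - \<tau>1 \<le> 20 * Y1"
proof -
  define d where "d = \<tau>2 - \<tau>1"
  have d: "0 \<le> d" using assms d_def by simp
  have "1 - Y1 / \<tau>1 \<le> e1" using assms by (simp add: field_simps)
  then have e: "e2 - e1 \<le> Y1 / \<tau>1" using assms by simp
  have a: "(y2 - y1)\<^sup>2 \<le> Y1 / \<tau>1 * d"
    using assms(12) mult_right_mono[OF e d] by (simp add: d_def)
  have "Y1 / \<tau>1 \<le> 1 / 2" using assms by (simp add: field_simps)
  then have "Y1 / \<tau>1 * d \<le> 1 / 2 * d" using d by (rule mult_right_mono)
  from order_trans[OF a this] have s1: "(y2 - y1)\<^sup>2 \<le> d / 2" by simp
  have y1: "y1\<^sup>2 \<le> \<tau>1" using assms mult_right_mono[of e1 1 \<tau>1] by linarith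
  have "(y1 * (y2 - y1))\<^sup>2 \<le> \<tau>1 * (Y1 / \<tau>1 * d)"
    unfolding power_mult_distrib using y1 \<open>(y2 - y1)\<^sup>2 \<le> Y1 / \<tau>1 * d\<close> assms by (intro mult_mono) auto
  also have "\<dots> = Y1 * d" using assms by simp
  \<comment> \<open>Arithmetic-geometric mean, weighted so that twice the first term is only d / 4
    and can be absorbed.\<close>
  also have "\<dots> \<le> (d / 8 + 2 * Y1)\<^sup>2" 
    using zero_le_power2[of "d / 8 - 2 * Y1"] by (simp add: power2_eq_square algebra_simps)
  finally have "y1 * (y2 - y1) \<le> d / 8 + 2 * Y1"
    using assms d by (intro power2_le_imp_le[of "y1 * (y2 - y1)" "d / 8 + 2 * Y1"]) auto
  then have "2 * (y1 * (y2 - y1)) \<le> 2 * (d / 8 + 2 * Y1)" by simp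
  from add_mono[OF add_mono[OF y1 this] s1]
  have "y1\<^sup>2 + 2 * (y1 * (y2 - y1)) + (y2 - y1)\<^sup>2 \<le> \<tau>1 + 2 * (d / 8 + 2 * Y1) + d / 2" .
  moreover have "y2\<^sup>2 = y1\<^sup>2 + 2 * (y1 * (y2 - y1)) + (y2 - y1)\<^sup>2" by (simp add: power2_eq_square algebra_simps)
  ultimately have "\<tau>2 - Y2 \<le> \<tau>1 + 2 * (d / 8 + 2 * Y1) + d / 2" using assms(7) by (metis order_trans)
  then have "d - Y2 \<le> 3 / 4 * d + 4 * Y1" by (simp add: d_def field_simps)
  then have "d \<le> 20 * Y1" using assms(4) by simp
  then show ?thesis by (simp add: d_def)
qed

text \<open>
  Here \<open>y = sqrt (2 pi s) t\<^sup>-\<^sup>c U\<close> is a function of \<open>\<tau> = t\<^sup>s\<close> with Dirichlet integral \<open>e \<le> 1\<close>, so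
  \<open>y\<^sup>2 \<le> \<tau>\<close> is the one-dimensional Moser situation.
\<close>

locale radial_profile =
  fixes U U' :: "real \<Rightarrow> real" and s c :: real
  assumes s: "0 < s" "s < 1" and c: "c = (1 - s) / 2"
    and U_deriv: "\<And>t. (U has_real_derivative U' t) (at t)"
    and U'_cont: "continuous_on UNIV U'"
    and U_zero: "\<And>t. t \<le> 1 \<Longrightarrow> U t = 0"
    and energy: "\<And>B. 2 * pi * integral {1..B} (\<lambda>t. (U' t - c * U t / t)\<^sup>2) \<le> 1"
begin

definition F :: "real \<Rightarrow> real" where "F t = U' t - c * U t / t"

definition v :: "real \<Rightarrow> real" where "v t = t powr (- c) * U t"

definition e :: "real \<Rightarrow> real" where "e t = 2 * pi * integral {1..t} (\<lambda>t. (F t)\<^sup>2)"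

definition y :: "real \<Rightarrow> real" where "y t = sqrt (2 * pi * s) * v t"

lemma U_cont: "continuous_on S U"
  using U_deriv by (meson DERIV_continuous continuous_at_imp_continuous_on)

lemma F_cont: "S \<subseteq> {0<..} \<Longrightarrow> continuous_on S F"
  unfolding F_def by (intro continuous_intros U_cont continuous_on_subset[OF U'_cont]) auto

text \<open>Dividing by the solution t^c turns the energy density into a derivative: v' = t^(-c) F.
  The Cauchy-Schwarz weight t^(-2c) equals t^(s-1), and its primitive t^s / s is the origin of the
  variable t^s.\<close>

lemma v_diff:
  assumes "1 \<le> t1" "t1 \<le> t2"
  shows "(v t2 - v t1)\<^sup>2 \<le> integral {t1..t2} (\<lambda>t. (F t)\<^sup>2) * ((t2 powr s - t1 powr s) / s)"
proof -
  have pos: "t \<in> {t1..t2} \<Longrightarrow> 0 < t" for t using assms by auto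
  have "((\<lambda>t. F t * t powr (- c)) has_integral v t2 - v t1) {t1..t2}"
  proof (rule fundamental_theorem_of_calculus[OF assms(2)])
    fix t assume "t \<in> {t1..t2}"
    then have "0 < t" by (rule pos)
    then show "(v has_vector_derivative F t * t powr (- c)) (at t within {t1..t2})"
      unfolding v_def F_def has_real_derivative_iff_has_vector_derivative[symmetric]
      by (auto intro!: derivative_eq_intros DERIV_subset[OF U_deriv] simp: powr_diff field_simps)
  qed
  then have "v t2 - v t1 = integral {t1..t2} (\<lambda>t. F t * t powr (- c))" by (simp add: integral_unique)
  then have "(v t2 - v t1)\<^sup>2 \<le> integral {t1..t2} (\<lambda>t. (F t)\<^sup>2) * integral {t1..t2} (\<lambda>t. (t powr (- c))\<^sup>2)"
    using pos by (simp only:, intro integral_Cauchy_Schwarz F_cont) (auto intro!: continuous_intros dest: pos)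
  also have "integral {t1..t2} (\<lambda>t. (t powr (- c))\<^sup>2) = integral {t1..t2} (\<lambda>t. t powr (s - 1))"
    using pos by (intro integral_cong) (auto simp: power2_eq_square c simp flip: powr_add)
  also have "((\<lambda>t. t powr (s - 1)) has_integral t2 powr s / s - t1 powr s / s) {t1..t2}"
  proof (rule fundamental_theorem_of_calculus[OF assms(2)])
    fix t assume "t \<in> {t1..t2}"
    then have "0 < t" by (rule pos)
    then show "((\<lambda>t. t powr s / s) has_vector_derivative t powr (s - 1)) (at t within {t1..t2})"
      unfolding has_real_derivative_iff_has_vector_derivative[symmetric]
      using s by (auto intro!: derivative_eq_intros)
  qed
  then have "integral {t1..t2} (\<lambda>t. t powr (s - 1)) = (t2 powr s - t1 powr s) / s" 
    by (simp add: integral_unique diff_divide_distrib)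
  finally show ?thesis .
qed

lemma e_diff:
  assumes "1 \<le> t1" "t1 \<le> t2"
  shows "e t2 - e t1 = 2 * pi * integral {t1..t2} (\<lambda>t. (F t)\<^sup>2)"
proof -
  have "(\<lambda>t. (F t)\<^sup>2) integrable_on {1..t2}"
    by (intro integrable_continuous_real continuous_intros F_cont) auto
  from Henstock_Kurzweil_Integration.integral_combine[OF assms this, symmetric] show ?thesis
    unfolding e_def by (simp only: distrib_left add_diff_cancel_left')
qed

lemma e_mono: "1 \<le> t1 \<Longrightarrow> t1 \<le> t2 \<Longrightarrow> e t1 \<le> e t2"
  using e_diff[of t1 t2] integral_nonneg[of "\<lambda>t. (F t)\<^sup>2" "{t1..t2}"]
    integrable_continuous_real[OF continuous_on_power[OF F_cont[of "{t1..t2}"]], of 2]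
  by (smt (verit) atLeastAtMost_iff greaterThan_iff pi_gt_zero subsetI zero_le_power2 mult_nonneg_nonneg)

lemma e_bounds: "1 \<le> t \<Longrightarrow> 0 \<le> e t" "e t \<le> 1"
  using e_mono[of 1 t] energy[of t] by (auto simp: e_def F_def)

lemma y_diff:
  assumes "1 \<le> t1" "t1 \<le> t2"
  shows "(y t2 - y t1)\<^sup>2 \<le> (e t2 - e t1) * (t2 powr s - t1 powr s)"
proof -
  have "(y t2 - y t1)\<^sup>2 = 2 * pi * s * (v t2 - v t1)\<^sup>2"
    using s by (simp add: y_def power_mult_distrib flip: right_diff_distrib)
  also have "\<dots> \<le> 2 * pi * s * (integral {t1..t2} (\<lambda>t. (F t)\<^sup>2) * ((t2 powr s - t1 powr s) / s))"
    using s v_diff[OF assms] by (intro mult_left_mono) auto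
  also have "\<dots> = (e t2 - e t1) * (t2 powr s - t1 powr s)"
    using s e_diff[OF assms] by simp
  finally show ?thesis .
qed

text \<open>y vanishes at t = 1 because U does, so this is the increment estimate started at
  1.\<close>

lemma y_bound:
  assumes "1 \<le> t"
  shows "(y t)\<^sup>2 \<le> e t * t powr s"
proof -
  have "(y t)\<^sup>2 \<le> e t * (t powr s - 1)"
    using y_diff[OF order.refl assms] by (simp add: y_def v_def U_zero e_def)
  also have "\<dots> \<le> e t * t powr s" using e_bounds(1)[OF assms] by (intro mult_left_mono) auto
  finally show ?thesis .
qed

text \<open>The term -2t is the logarithm of the Jacobian exp (-2t) of the logarithmic polar
  coordinates, so \<open>exp (\<psi> t)\<close> is the full critical integrand of the mean.\<close>

definition \<psi> :: "real \<Rightarrow> real" where "\<psi> t = 4 * pi * s * (U t)\<^sup>2 - 2 * t"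

lemma psi_eq:
  assumes "1 \<le> t"
  shows "\<psi> t = 2 * t powr (1 - s) * ((y t)\<^sup>2 - t powr s)"
proof -
  have "(y t)\<^sup>2 = 2 * pi * s * (t powr (- c) * t powr (- c)) * (U t)\<^sup>2"
    using s by (simp add: y_def v_def power_mult_distrib power2_eq_square)
  also have "t powr (- c) * t powr (- c) = t powr (s - 1)"
    by (simp add: c flip: powr_add)
  finally have "2 * t powr (1 - s) * ((y t)\<^sup>2 - t powr s) = 4 * pi * s * (t powr (1 - s) * t powr (s - 1)) * (U t)\<^sup>2 - 2 * (t powr (1 - s) * t powr s)"
    by (simp add: algebra_simps)
  then show ?thesis using assms by (simp add: \<psi>_def flip: powr_add)
qed

lemma psi_nonpos:
  assumes "1 \<le> t"
  shows "\<psi> t \<le> 0"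
proof -
  have "(y t)\<^sup>2 \<le> 1 * t powr s" 
    using y_bound[OF assms] e_bounds[of t] by (meson order_trans mult_right_mono powr_ge_zero)
  then show ?thesis unfolding psi_eq[OF assms] by (simp add: mult_le_0_iff)
qed

text \<open>The factor 2 t^(1-s) in \<open>psi_eq\<close> converts a deficit X of \<psi> into a
  deficit X t^(s-1) / 2 of y^2 below t^s.\<close>

lemma y_square_ge:
  assumes "1 \<le> t" "\<psi> t \<ge> - X"
  shows "(y t)\<^sup>2 \<ge> t powr s - X * t powr (s - 1) / 2"
proof -
  have "- X * t powr (s - 1) \<le> \<psi> t * t powr (s - 1)"
    using assms by (intro mult_right_mono) auto
  also have "\<dots> = 2 * (t powr (1 - s) * t powr (s - 1)) * ((y t)\<^sup>2 - t powr s)"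
    unfolding psi_eq[OF assms(1)] by simp
  also have "\<dots> = 2 * ((y t)\<^sup>2 - t powr s)"
    using assms by (simp flip: powr_add)
  finally show ?thesis by simp
qed

text \<open>
  If \<open>\<psi>\<close> is close to 0 at \<open>t1\<close>, then almost all the energy is spent before \<open>t1\<close> and \<open>y\<close> can
  hardly grow any further.
\<close>

lemma near_critical_diameter:
  assumes "1 \<le> X" "X \<le> t1" "t1 \<le> t2" "\<psi> t1 \<ge> - X" "\<psi> t2 \<ge> - X"
  shows "t2 - t1 \<le> 10 / s * 11 powr ((1 - s) / s) * X"
proof -
  have t: "1 \<le> t1" "1 \<le> t2" "0 < t1" "0 < t2" using assms by auto
  define Y where "Y t = X * t powr (s - 1) / 2" for t
  have Y: "0 \<le> Y t2" "Y t2 \<le> Y t1"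
    using assms s t by (auto simp: Y_def intro!: mult_left_mono powr_mono2')
  \<comment> \<open>Here X \<le> t1 enters: it keeps the deficit below half of t1^s, as
    \<open>moser_algebra\<close> demands.\<close>
  have "Y t1 \<le> t1 * t1 powr (s - 1) / 2" unfolding Y_def
    using assms by (intro divide_right_mono mult_right_mono) auto
  also have "t1 * t1 powr (s - 1) = t1 powr s" using t by (simp add: powr_mult_base)
  finally have Y1: "Y t1 \<le> t1 powr s / 2" .
  have \<tau>: "t2 powr s - t1 powr s \<le> 20 * Y t1"
  proof (rule moser_algebra[of _ _ "Y t2" _ "y t1" "y t2" "e t1" "e t2"])
    show "(y t1)\<^sup>2 \<ge> t1 powr s - Y t1" "(y t2)\<^sup>2 \<ge> t2 powr s - Y t2"
      using y_square_ge t assms by (auto simp: Y_def)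
  qed (use t assms s Y Y1 in \<open>auto intro!: powr_mono2 y_bound e_bounds e_mono y_diff\<close>)
  \<comment> \<open>20 Y is at most 10 t1^s. The points t1 and t2 have to be comparable because the
    factor t^(1-s) leading back from t^s to t is taken at t2, whereas the deficit is measured at
    t1.\<close>
  then have "t2 powr s \<le> 11 * t1 powr s" using Y1 by simp
  then have "(t2 powr s) powr (1 / s) \<le> (11 * t1 powr s) powr (1 / s)"
    using s by (intro powr_mono2) auto
  then have "t2 \<le> 11 powr (1 / s) * t1" using t s by (simp add: powr_powr powr_mult)
  then have "t2 powr (1 - s) \<le> (11 powr (1 / s) * t1) powr (1 - s)" using s t by (intro powr_mono2) auto
  also have "\<dots> = 11 powr ((1 - s) / s) * t1 powr (1 - s)" using t by (simp add: powr_mult powr_powr)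
  finally have t21: "t2 powr (1 - s) \<le> 11 powr ((1 - s) / s) * t1 powr (1 - s)" .
  have "s * t2 powr (s - 1) * (t2 - t1) \<le> 20 * Y t1"
    using powr_diff_ge[of s t1 t2] s t assms \<tau> by linarith
  then have "t2 powr (1 - s) * (s * t2 powr (s - 1) * (t2 - t1)) \<le> t2 powr (1 - s) * (20 * Y t1)"
    by (intro mult_left_mono) auto
  moreover have "t2 powr (1 - s) * (s * t2 powr (s - 1) * (t2 - t1)) = s * (t2 powr (1 - s) * t2 powr (s - 1)) * (t2 - t1)"
    by simp
  ultimately have "s * (t2 - t1) \<le> t2 powr (1 - s) * (20 * Y t1)"
    using t by (simp flip: powr_add)
  also have "\<dots> \<le> 11 powr ((1 - s) / s) * t1 powr (1 - s) * (20 * Y t1)"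
    using t21 Y by (intro mult_right_mono) auto
  also have "\<dots> = 10 * 11 powr ((1 - s) / s) * X * (t1 powr (1 - s) * t1 powr (s - 1))"
    by (simp add: Y_def)
  also have "\<dots> = 10 * 11 powr ((1 - s) / s) * X" using t by (simp flip: powr_add)
  finally show ?thesis using s by (simp add: field_simps)
qed

lemma psi_cont: "continuous_on UNIV \<psi>"
  unfolding \<psi>_def by (intro continuous_intros U_cont)

text \<open>Any member t0 of the set beyond X lies within K X of every other such member, so one
  window centred at t0 contains them all. It is truncated at 1 to stay where the hypothesis on
  \<Phi> applies.\<close>

lemma near_critical_integral:
  assumes [measurable]: "\<Phi> \<in> borel_measurable borel"
    and A: "\<And>p q. 1 \<le> p \<Longrightarrow> p \<le> q \<Longrightarrow> (\<integral>\<^sup>+t\<in>{p..q}. \<Phi> t \<partial>lborel) \<le> ennreal (A * (q - p + 1))" "0 \<le> A"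
    and X: "1 \<le> X"
  shows "(\<integral>\<^sup>+t\<in>{t. 1 \<le> t \<and> \<psi> t \<ge> - X}. \<Phi> t \<partial>lborel)
    \<le> ennreal (A * (2 + 2 * (10 / s * 11 powr ((1 - s) / s))) * X)"
proof -
  define K where "K = 10 / s * 11 powr ((1 - s) / s)"
  have K: "0 \<le> K" using s by (simp add: K_def)
  obtain p q where pq: "1 \<le> p" "p \<le> q" "q - p \<le> 2 * K * X"
    and cover: "{t. X \<le> t \<and> \<psi> t \<ge> - X} \<subseteq> {p..q}"
  proof (cases "{t. X \<le> t \<and> \<psi> t \<ge> - X} = {}")
    case True
    then show ?thesis using that[of 1 1] K X by auto
  next
    case False
    then obtain t0 where t0: "X \<le> t0" "\<psi> t0 \<ge> - X" by blast
    have KX: "0 \<le> K * X" using K X by simp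
    show ?thesis
    proof (rule that)
      show "1 \<le> max 1 (t0 - K * X)" "max 1 (t0 - K * X) \<le> t0 + K * X" using t0 X KX by auto
      show "t0 + K * X - max 1 (t0 - K * X) \<le> 2 * K * X" by auto
      show "{t. X \<le> t \<and> \<psi> t \<ge> - X} \<subseteq> {max 1 (t0 - K * X)..t0 + K * X}"
      proof
        fix t assume "t \<in> {t. X \<le> t \<and> \<psi> t \<ge> - X}"
        then show "t \<in> {max 1 (t0 - K * X)..t0 + K * X}"
          using near_critical_diameter[of X t t0] near_critical_diameter[of X t0 t] t0 X K
          by (cases "t \<le> t0") (auto simp: K_def algebra_simps)
      qed
    qed
  qed
  have "(\<integral>\<^sup>+t\<in>{t. 1 \<le> t \<and> \<psi> t \<ge> - X}. \<Phi> t \<partial>lborel)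
    \<le> (\<integral>\<^sup>+t. \<Phi> t * indicator {1..X} t + \<Phi> t * indicator {p..q} t \<partial>lborel)"
  proof (intro nn_integral_mono)
    fix t
    show "\<Phi> t * indicator {t. 1 \<le> t \<and> \<psi> t \<ge> - X} t \<le> \<Phi> t * indicator {1..X} t + \<Phi> t * indicator {p..q} t"
      using subsetD[OF cover, of t] by (cases "t \<le> X") (auto simp: indicator_def)
  qed
  also have "\<dots> = (\<integral>\<^sup>+t\<in>{1..X}. \<Phi> t \<partial>lborel) + (\<integral>\<^sup>+t\<in>{p..q}. \<Phi> t \<partial>lborel)"
    by (intro nn_integral_add) auto
  also have "\<dots> \<le> ennreal (A * (X - 1 + 1)) + ennreal (A * (q - p + 1))"
    using pq X by (intro add_mono A) auto
  also have "\<dots> = ennreal (A * (X + (q - p + 1)))"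
  proof -
    have "A * (X + (q - p + 1)) = A * (X - 1 + 1) + A * (q - p + 1)" by (simp add: algebra_simps)
    moreover have "0 \<le> A * (X - 1 + 1)" "0 \<le> A * (q - p + 1)"
      using pq X A(2) by (intro mult_nonneg_nonneg; simp)+
    ultimately show ?thesis by (simp only: ennreal_plus)
  qed
  \<comment> \<open>The additive 1 of the window bound is absorbed into a second X, since 1 \<le>
    X.\<close>
  also have "\<dots> \<le> ennreal (A * ((2 + 2 * K) * X))"
    using pq X A(2) by (intro ennreal_leI mult_left_mono) (auto simp: algebra_simps)
  finally show ?thesis by (simp add: K_def mult.assoc)
qed

text \<open>Layer cake over the sets \<open>{\<psi> \<ge> - X}\<close> with \<open>X = 1, 2, \<dots>\<close>\<close>

lemma exp_psi_integral:
  assumes [measurable]: "\<Phi> \<in> borel_measurable borel"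
    and A: "\<And>p q. 1 \<le> p \<Longrightarrow> p \<le> q \<Longrightarrow> (\<integral>\<^sup>+t\<in>{p..q}. \<Phi> t \<partial>lborel) \<le> ennreal (A * (q - p + 1))" "0 \<le> A"
  shows "(\<integral>\<^sup>+t\<in>{1..}. ennreal (exp (\<psi> t)) * \<Phi> t \<partial>lborel)
    \<le> ennreal (A * (2 + 2 * (10 / s * 11 powr ((1 - s) / s))) * (1 / (1 - exp (- 1))\<^sup>2))"
proof -
  define K where "K = 2 + 2 * (10 / s * 11 powr ((1 - s) / s))"
  have K: "0 \<le> K" using s by (simp add: K_def)
  have [measurable]: "\<psi> \<in> borel_measurable borel"
    by (intro borel_measurable_continuous_onI psi_cont)
  let ?S = "\<lambda>j::nat. {t. 1 \<le> t \<and> \<psi> t \<ge> - (real j + 1)}"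
  have "ennreal (exp (\<psi> t)) * \<Phi> t * indicator {1..} t \<le> (\<Sum>j. ennreal (exp (- real j)) * (\<Phi> t * indicator (?S j) t))" for t
  proof (cases "1 \<le> t")
    case True
    \<comment> \<open>The level of t: \<psi> t lies between -(j + 1) and -j, so the single summand
      with this index already dominates.\<close>
    define j where "j = nat \<lfloor>- \<psi> t\<rfloor>"
    have j: "real j \<le> - \<psi> t" "- \<psi> t < real j + 1"
      using psi_nonpos[OF True] unfolding j_def by (simp_all add: of_nat_nat)
    have "ennreal (exp (\<psi> t)) * \<Phi> t * indicator {1..} t \<le> ennreal (exp (- real j)) * (\<Phi> t * indicator (?S j) t)"
      using True j by (auto intro!: mult_right_mono ennreal_leI)
    also have "\<dots> \<le> (\<Sum>j. ennreal (exp (- real j)) * (\<Phi> t * indicator (?S j) t))"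
      using sum_le_suminf[of "\<lambda>j. ennreal (exp (- real j)) * (\<Phi> t * indicator (?S j) t)" "{j}"] by simp
    finally show ?thesis .
  qed simp
  then have "(\<integral>\<^sup>+t\<in>{1..}. ennreal (exp (\<psi> t)) * \<Phi> t \<partial>lborel)
     \<le> (\<integral>\<^sup>+t. (\<Sum>j. ennreal (exp (- real j)) * (\<Phi> t * indicator (?S j) t)) \<partial>lborel)"
    by (intro nn_integral_mono)
  also have "\<dots> = (\<Sum>j. ennreal (exp (- real j)) * (\<integral>\<^sup>+t. \<Phi> t * indicator (?S j) t \<partial>lborel))"
    by (simp add: nn_integral_suminf nn_integral_cmult)
  also have "\<dots> \<le> (\<Sum>j. ennreal (A * K) * ennreal (real (Suc j) * exp (- 1) ^ j))"
  proof (intro suminf_le)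
    fix j
    have "ennreal (exp (- real j)) * (\<integral>\<^sup>+t. \<Phi> t * indicator (?S j) t \<partial>lborel) \<le> ennreal (exp (- real j)) * ennreal (A * K * (real j + 1))"
      unfolding K_def by (intro mult_left_mono near_critical_integral A) auto
    also have "\<dots> = ennreal (A * K) * ennreal (real (Suc j) * exp (- 1) ^ j)"
      using A(2) K by (simp add: mult_ac flip: ennreal_mult exp_of_nat_mult)
    finally show "ennreal (exp (- real j)) * (\<integral>\<^sup>+t. \<Phi> t * indicator (?S j) t \<partial>lborel) \<le> \<dots>" .
  qed auto
  also have "\<dots> = ennreal (A * K) * ennreal (1 / (1 - exp (- 1))\<^sup>2)"
  proof -
    have "(\<lambda>j. real (Suc j) * exp (- 1) ^ j) sums (1 / (1 - exp (- 1))\<^sup>2)"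
      using geometric_deriv_sums[of "exp (- 1) :: real"] by simp
    then have "(\<Sum>j. ennreal (real (Suc j) * exp (- 1) ^ j)) = ennreal (1 / (1 - exp (- 1))\<^sup>2)"
      by (intro suminf_ennreal_eq) auto
    then show ?thesis by simp
  qed
  finally show ?thesis using A(2) K by (simp add: K_def flip: ennreal_mult)
qed

end

section \<open>Logarithmic polar coordinates\<close>

lemma vector2_eq: "(vector [x, y] :: real^2) = x *\<^sub>R axis 1 1 + y *\<^sub>R axis 2 1"
  by (simp add: vec_eq_iff forall_2 axis_def)

lemma vector2_nth: "(vector [p $ 1, p $ 2] :: real^2) = p"
  by (simp add: vec_eq_iff forall_2)

lemma continuous_on_vector2 [continuous_intros]:
  "continuous_on S f \<Longrightarrow> continuous_on S g \<Longrightarrow> continuous_on S (\<lambda>x. vector [f x, g x] :: real^2)"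
  unfolding vector2_eq by (intro continuous_intros)

lemma measurable_vector2 [measurable]:
  assumes [measurable]: "f \<in> borel_measurable M" "g \<in> borel_measurable M"
  shows "(\<lambda>x. vector [f x, g x] :: real^2) \<in> borel_measurable M"
  unfolding vector2_eq by measurable

lemma measurable_vec_nth [measurable]: "(\<lambda>x::real^2. x $ i) \<in> borel_measurable borel"
  by (intro borel_measurable_continuous_onI continuous_intros)

text \<open>Both measures agree on boxes, which characterise Lebesgue measure. This opens
  \<open>real^2\<close> to Tonelli's theorem.\<close>

lemma lborel_vector2:
  "(lborel :: (real^2) measure) = distr (lborel \<Otimes>\<^sub>M lborel) borel (\<lambda>(x, y). vector [x, y])"
proof (rule lborel_eqI)
  fix l u :: "real^2" assume lu: "\<And>b. b \<in> Basis \<Longrightarrow> l \<bullet> b \<le> u \<bullet> b"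
  have "(axis 1 1 :: real^2) \<in> Basis" "(axis 2 1 :: real^2) \<in> Basis" 
    by (auto simp: axis_in_Basis_iff)
  from this[THEN lu] have le: "l $ 1 \<le> u $ 1" "l $ 2 \<le> u $ 2" by (auto simp: inner_axis)
  have Bas: "(Basis :: (real^2) set) = {axis 1 1, axis 2 1}" 
    by (auto simp: Basis_vec_def UNIV_2)
  have ne: "(axis 1 1 :: real^2) \<noteq> axis 2 1" by (simp add: axis_eq_axis)
  have "emeasure (distr (lborel \<Otimes>\<^sub>M lborel) borel (\<lambda>(x, y). vector [x, y] :: real^2)) (box l u)
     = emeasure (lborel \<Otimes>\<^sub>M lborel) ({l $ 1<..<u $ 1} \<times> {l $ 2<..<u $ 2})"
    by (subst emeasure_distr) (auto intro!: arg_cong2[where f=emeasure] simp: mem_box_cart forall_2 space_pair_measure)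
  also have "\<dots> = (u $ 1 - l $ 1) * (u $ 2 - l $ 2)"
    using le by (subst lborel.emeasure_pair_measure_Times) (auto simp: ennreal_mult)
  also have "\<dots> = (\<Prod>b\<in>Basis. (u - l) \<bullet> b)"
    using ne unfolding Bas by (simp add: inner_axis)
  finally show "emeasure (distr (lborel \<Otimes>\<^sub>M lborel) borel (\<lambda>(x, y). vector [x, y] :: real^2)) (box l u)
    = (\<Prod>b\<in>Basis. (u - l) \<bullet> b)" .
qed simp

lemma nn_integral_vector2:
  assumes [measurable]: "f \<in> borel_measurable borel"
  shows "(\<integral>\<^sup>+p. f p \<partial>(lborel :: (real^2) measure)) = (\<integral>\<^sup>+x. \<integral>\<^sup>+y. f (vector [x, y]) \<partial>lborel \<partial>lborel)"
  by (subst lborel_vector2, subst nn_integral_distr) (auto simp: lborel.nn_integral_fst[symmetric])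

definition polar :: "real \<Rightarrow> real \<Rightarrow> real^2" where
  "polar t \<theta> = vector [exp (- t) * cos \<theta>, exp (- t) * sin \<theta>]"

lemma norm_vector2: "norm (vector [x, y] :: real^2) = sqrt (x\<^sup>2 + y\<^sup>2)"
  by (simp add: norm_vec_def L2_set_def UNIV_2)

lemma norm_polar [simp]: "norm (polar t \<theta>) = exp (- t)"
proof -
  have "(exp (- t) * cos \<theta>)\<^sup>2 + (exp (- t) * sin \<theta>)\<^sup>2 = (exp (-t))\<^sup>2 * ((cos \<theta>)\<^sup>2 + (sin \<theta>)\<^sup>2)"
    by (simp only: power_mult_distrib distrib_left)
  then show ?thesis by (simp add: polar_def norm_vector2)
qed

lemma polar_inj:
  assumes "polar t \<theta> = polar t' \<theta>'" "0 < \<theta>" "\<theta> < 2 * pi" "0 < \<theta>'" "\<theta>' < 2 * pi"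
  shows "t = t' \<and> \<theta> = \<theta>'"
proof -
  have "norm (polar t \<theta>) = norm (polar t' \<theta>')" using assms by simp
  then have t: "t = t'" by simp
  have "polar t \<theta> $ 1 = polar t \<theta>' $ 1" "polar t \<theta> $ 2 = polar t \<theta>' $ 2" using assms t by auto
  then have "cos \<theta> = cos \<theta>'" "sin \<theta> = sin \<theta>'" by (auto simp: polar_def)
  then obtain n :: int where "\<theta> = \<theta>' + 2 * pi * n" using sin_cos_eq_iff by metis
  then have n: "\<theta> = \<theta>' + 2 * pi * real_of_int n" by simp
  have "2 * pi * real_of_int n < 2 * pi * 1" "2 * pi * (- 1) < 2 * pi * real_of_int n"
    using assms n by linarith+
  then have "real_of_int n < 1" "- 1 < real_of_int n"
    by (simp_all only: mult_less_cancel_left_pos pi_gt_zero zero_less_mult_iff zero_less_numeral simp_thms)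
  then have "n = 0" by linarith
  then show ?thesis using t n by simp
qed

lemma polar_surj:
  assumes "p \<noteq> 0"
  shows "\<exists>\<theta>. 0 \<le> \<theta> \<and> \<theta> < 2 * pi \<and> polar (- ln (norm p)) \<theta> = p"
proof -
  have np: "norm p > 0" using assms by simp
  have "norm p = sqrt ((p $ 1)\<^sup>2 + (p $ 2)\<^sup>2)"
    using norm_vector2[of "p$1" "p$2"] by (simp only: vector2_nth)
  then have "(norm p)\<^sup>2 = (p $ 1)\<^sup>2 + (p $ 2)\<^sup>2" by (simp only: real_sqrt_pow2 sum_power2_ge_zero)
  then have sq: "(p $ 1)\<^sup>2 + (p $ 2)\<^sup>2 = (norm p)\<^sup>2" ..
  have "(p $ 1 / norm p)\<^sup>2 + (p $ 2 / norm p)\<^sup>2 = ((p $ 1)\<^sup>2 + (p $ 2)\<^sup>2) / (norm p)\<^sup>2"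
    by (simp add: power_divide add_divide_distrib)
  also have "\<dots> = 1" unfolding sq using np by simp
  finally have "(p $ 1 / norm p)\<^sup>2 + (p $ 2 / norm p)\<^sup>2 = 1" .
  then obtain \<theta> where th: "0 \<le> \<theta>" "\<theta> < 2 * pi"
    and c: "p $ 1 / norm p = cos \<theta>" and s: "p $ 2 / norm p = sin \<theta>"
    by (rule sincos_total_2pi)
  have "polar (- ln (norm p)) \<theta> = vector [norm p * cos \<theta>, norm p * sin \<theta>]"
    using np by (simp add: polar_def)
  also have "\<dots> = vector [p $ 1, p $ 2]"
    using np unfolding c[symmetric] s[symmetric] by simp
  finally show ?thesis using th by (auto simp: vector2_nth)
qed

lemma has_derivative_vec_nth [derivative_intros]:
  "((\<lambda>x::real^'n. x $ i) has_derivative (\<lambda>h. h $ i)) F"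
  by (rule bounded_linear_imp_has_derivative) (rule bounded_linear_vec_nth)

lemma polar_has_derivative:
  fixes p :: "real^2"
  shows "((\<lambda>p. polar (p $ 1) (p $ 2)) has_derivative
    (\<lambda>h. vector [- (exp (- (p $ 1)) * cos (p $ 2)) * h $ 1 - exp (- (p $ 1)) * sin (p $ 2) * h $ 2,
      - (exp (- (p $ 1)) * sin (p $ 2)) * h $ 1 + exp (- (p $ 1)) * cos (p $ 2) * h $ 2])) (at p within S)"
  unfolding polar_def vector2_eq
  by (auto intro!: derivative_eq_intros simp: algebra_simps)

lemma measurable_polar [measurable]:
  assumes [measurable]: "f \<in> borel_measurable M" "g \<in> borel_measurable M"
  shows "(\<lambda>x. polar (f x) (g x)) \<in> borel_measurable M"
  unfolding polar_def by measurable

definition polar_strip :: "real \<Rightarrow> (real^2) set" where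
  "polar_strip a = {p. a < p $ 1 \<and> 0 < p $ 2 \<and> p $ 2 < 2 * pi}"

lemma polar_strip_borel [measurable]: "polar_strip a \<in> sets borel"
  unfolding polar_strip_def by measurable

text \<open>Angles strictly between 0 and 2 pi miss only a half axis. The exceptional set is taken
  to be the whole line on which the second coordinate vanishes, which is still null.\<close>

lemma polar_image_AE:
  "AE p in lborel. p \<in> ball 0 (exp (- a)) \<longleftrightarrow> p \<in> (\<lambda>p. polar (p $ 1) (p $ 2)) ` polar_strip a"
proof (rule AE_I')
  let ?N = "{x::real^2. axis 2 1 \<bullet> x = 0}"
  have "negligible ?N" by (rule negligible_hyperplane) simp
  then show "?N \<in> null_sets lborel" 
    by (metis closed_hyperplane negligible_iff_null_sets null_sets_completion_iff borel_closed sets_lborel)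
  show "{p \<in> space lborel. (p \<in> ball 0 (exp (- a))) \<noteq> (p \<in> (\<lambda>p. polar (p $ 1) (p $ 2)) ` polar_strip a)} \<subseteq> ?N"
  proof (rule subsetI, rule ccontr)
    fix p :: "real^2" assume p: "p \<in> {p \<in> space lborel. (p \<in> ball 0 (exp (- a))) \<noteq> (p \<in> (\<lambda>p. polar (p $ 1) (p $ 2)) ` polar_strip a)}"
      and "p \<notin> ?N"
    then have p2: "p $ 2 \<noteq> 0" by (simp add: inner_axis')
    then have "p \<noteq> 0" by auto
    then obtain \<theta> where th: "0 \<le> \<theta>" "\<theta> < 2 * pi" "polar (- ln (norm p)) \<theta> = p" using polar_surj by blast
    have "\<theta> \<noteq> 0" using p2 arg_cong[OF th(3), of "\<lambda>p. p $ 2"] by (auto simp: polar_def)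
    have "p \<in> ball 0 (exp (- a)) \<longleftrightarrow> a < - ln (norm p)"
      using \<open>p \<noteq> 0\<close> ln_less_cancel_iff[of "norm p" "exp (-a)"] by (simp del: ln_less_cancel_iff) linarith
    moreover have "p \<in> ball 0 (exp (- a))" if "p \<in> (\<lambda>p. polar (p $ 1) (p $ 2)) ` polar_strip a"
      using that by (auto simp: polar_strip_def)
    moreover have "p \<in> (\<lambda>p. polar (p $ 1) (p $ 2)) ` polar_strip a" if "a < - ln (norm p)"
      using that th \<open>\<theta> \<noteq> 0\<close> by (intro image_eqI[of _ _ "vector [- ln (norm p), \<theta>]"]) (auto simp: polar_strip_def)
    ultimately have "p \<in> ball 0 (exp (- a)) \<longleftrightarrow> p \<in> (\<lambda>p. polar (p $ 1) (p $ 2)) ` polar_strip a" by metis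
    then show False using p by (metis (mono_tags, lifting) mem_Collect_eq)
  qed
qed

text \<open>Change of variables for the image of a Borel set under the polar map, which is injective
  on the strip and has Jacobian determinant of modulus exp (-2t). Image and original set differ by a
  null set, and the bounded ball keeps the measures finite.\<close>

lemma emeasure_polar:
  assumes [measurable]: "A \<in> sets (borel :: (real^2) measure)"
  shows "emeasure lborel (A \<inter> ball 0 (exp (- a)))
    = (\<integral>\<^sup>+p. ennreal (exp (- 2 * p $ 1)) * indicator (polar_strip a \<inter> {p. polar (p $ 1) (p $ 2) \<in> A}) p \<partial>lborel)"
proof -
  define G where "G = (\<lambda>p::real^2. polar (p $ 1) (p $ 2))"
  have [measurable]: "G \<in> borel_measurable borel" unfolding G_def by measurable
  define S where "S = polar_strip a \<inter> G -` A"
  have S[measurable]: "S \<in> sets borel" unfolding S_def using measurable_sets[of G borel borel A] by auto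
  define G' where "G' = (\<lambda>(p :: real^2) (h :: real^2). vector [- (exp (- (p $ 1)) * cos (p $ 2)) * h $ 1 - exp (- (p $ 1)) * sin (p $ 2) * h $ 2,
      - (exp (- (p $ 1)) * sin (p $ 2)) * h $ 1 + exp (- (p $ 1)) * cos (p $ 2) * h $ 2] :: real^2)"
  have der: "(G has_derivative G' p) (at p within S)" for p
    unfolding G_def G'_def by (rule polar_has_derivative)
  have inj: "inj_on G S"
  proof (rule inj_onI)
    fix x y assume "x \<in> S" "y \<in> S" "G x = G y"
    then have "x $ 1 = y $ 1 \<and> x $ 2 = y $ 2"
      by (intro polar_inj) (auto simp: G_def S_def polar_strip_def)
    then show "x = y" by (simp add: vec_eq_iff forall_2)
  qed
  have det: "\<bar>det (matrix (G' p))\<bar> = exp (- 2 * p $ 1)" for p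
  proof -
    have "det (matrix (G' p)) = - ((exp (- (p $ 1)) * cos (p $ 2))\<^sup>2 + (exp (- (p $ 1)) * sin (p $ 2))\<^sup>2)"
      by (simp add: det_2 matrix_def G'_def axis_def power2_eq_square)
    also have "\<dots> = - ((exp (- (p $ 1)))\<^sup>2 * ((cos (p $ 2))\<^sup>2 + (sin (p $ 2))\<^sup>2))"
      by (simp only: power_mult_distrib distrib_left)
    finally show ?thesis by (simp add: power2_eq_square flip: exp_add)
  qed
  have GS: "G ` S = A \<inter> G ` polar_strip a" unfolding S_def by auto
  have AE: "AE p in lborel. p \<in> A \<inter> ball 0 (exp (- a)) \<longleftrightarrow> p \<in> G ` S"
    unfolding GS using polar_image_AE[of a, folded G_def] by eventually_elim blast
  have L: "A \<inter> ball 0 (exp (- a)) \<in> lmeasurable"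
    by (intro bounded_set_imp_lmeasurable) (auto intro: bounded_subset[OF bounded_ball])
  have neg: "negligible ((A \<inter> ball 0 (exp (- a)) - G ` S) \<union> (G ` S - A \<inter> ball 0 (exp (- a))))"
  proof -
    obtain N where N: "N \<in> null_sets lborel" "{p \<in> space lborel. \<not> (p \<in> A \<inter> ball 0 (exp (- a)) \<longleftrightarrow> p \<in> G ` S)} \<subseteq> N"
      using AE by (auto elim!: AE_E2 simp: eventually_ae_filter)
    then have "negligible N" by (simp add: negligible_iff_null_sets null_sets_completionI)
    then show ?thesis by (rule negligible_subset) (use N(2) in auto)
  qed
  have "G ` S \<in> lmeasurable \<and> measure lebesgue (G ` S) = measure lebesgue (A \<inter> ball 0 (exp (- a)))"
    using lmeasurable_negligible_symdiff[OF L neg] measure_negligible_symdiff[OF _ neg] L by auto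
  then have "((\<lambda>p. \<bar>det (matrix (G' p))\<bar>) has_integral measure lebesgue (A \<inter> ball 0 (exp (- a)))) S"
    using has_measure_differentiable_image[of S G G'] der inj S by auto
  then have "((\<lambda>p. exp (- 2 * p $ 1)) has_integral measure lebesgue (A \<inter> ball 0 (exp (- a)))) S"
    by (simp only: det)
  from nn_integral_has_integral_lebesgue'[OF _ this]
  have "(\<integral>\<^sup>+p. ennreal (exp (- 2 * p $ 1)) * indicator S p \<partial>lborel) = ennreal (measure lebesgue (A \<inter> ball 0 (exp (- a))))"
    by simp
  also have "\<dots> = emeasure lebesgue (A \<inter> ball 0 (exp (- a)))"
    using L by (simp add: emeasure_eq_measure2 fmeasurableD2)
  finally show ?thesis by (simp add: S_def G_def vimage_def)
qed

text \<open>Lebesgue measure on the ball is the push-forward of the density exp (-2t) on the strip,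
  since the two measures agree on Borel sets. Arguing with measures spares any integrability
  assumption on f.\<close>

lemma nn_integral_polar:
  assumes [measurable]: "f \<in> borel_measurable borel"
  shows "(\<integral>\<^sup>+p\<in>ball 0 (exp (- a)). f p \<partial>lborel)
    = (\<integral>\<^sup>+t. \<integral>\<^sup>+\<theta>. f (polar t \<theta>) * ennreal (exp (- 2 * t)) * indicator {0<..<2 * pi} \<theta> * indicator {a<..} t \<partial>lborel \<partial>lborel)"
proof -
  have [measurable, simp]: "(indicator (ball 0 (exp (- a))) :: real^2 \<Rightarrow> ennreal) \<in> borel_measurable borel"
    by (intro borel_measurable_indicator) simp
  define M where "M = distr (density lborel (\<lambda>p::real^2. ennreal (exp (- 2 * p $ 1)) * indicator (polar_strip a) p)) borel 
     (\<lambda>p. polar (p $ 1) (p $ 2))"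
  have vimage[simp]: "(\<lambda>p :: real^2. polar (p $ 1) (p $ 2)) -` A \<in> sets borel" if "A \<in> sets borel" for A
  proof -
    have "(\<lambda>p :: real^2. polar (p $ 1) (p $ 2)) \<in> borel_measurable borel" by measurable
    from measurable_sets[OF this that] show ?thesis by simp
  qed
  have "density lborel (indicator (ball 0 (exp (- a)))) = M"
  proof (rule measure_eqI)
    fix A assume "A \<in> sets (density lborel (indicator (ball 0 (exp (- a)) :: (real^2) set)))"
    then have [measurable]: "A \<in> sets borel" by simp
    have "emeasure (density lborel (indicator (ball 0 (exp (- a))))) A = emeasure lborel (A \<inter> ball 0 (exp (- a)))"
      by (subst emeasure_density) (auto simp: Int_commute simp flip: nn_integral_indicator intro!: nn_integral_cong split: split_indicator)
    also have "\<dots> = emeasure M A"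
      unfolding emeasure_polar[OF \<open>A \<in> sets borel\<close>] M_def
      by (subst emeasure_distr, measurable, subst emeasure_density)
         (auto intro!: nn_integral_cong split: split_indicator)
    finally show "emeasure (density lborel (indicator (ball 0 (exp (- a))))) A = emeasure M A" .
  qed (simp add: M_def)
  then have "(\<integral>\<^sup>+p. f p \<partial>density lborel (indicator (ball 0 (exp (- a))))) = (\<integral>\<^sup>+p. f p \<partial>M)" by simp
  then have "(\<integral>\<^sup>+p\<in>ball 0 (exp (- a)). f p \<partial>lborel) = 
     (\<integral>\<^sup>+p. ennreal (exp (- 2 * p $ 1)) * indicator (polar_strip a) p * f (polar (p $ 1) (p $ 2)) \<partial>lborel)"
    unfolding M_def by (simp add: nn_integral_density nn_integral_distr mult.commute)
  also have "\<dots> = (\<integral>\<^sup>+t. \<integral>\<^sup>+\<theta>. f (polar t \<theta>) * ennreal (exp (- 2 * t)) * indicator {0<..<2 * pi} \<theta> * indicator {a<..} t \<partial>lborel \<partial>lborel)"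
    by (subst nn_integral_vector2) (auto intro!: nn_integral_cong simp: polar_strip_def mult.commute split: split_indicator)
  finally show ?thesis .
qed

section \<open>Subcritical integrability on windows of the cylinder\<close>

lemma measurable_fst_borel [measurable (raw)]:
  fixes f :: "'c \<Rightarrow> 'a::second_countable_topology \<times> 'b::second_countable_topology"
  shows "f \<in> borel_measurable M \<Longrightarrow> (\<lambda>x. fst (f x)) \<in> borel_measurable M"
  by (rule measurable_compose[of f M borel fst]) (auto intro!: borel_measurable_continuous_onI continuous_intros)

lemma measurable_snd_borel [measurable (raw)]:
  fixes f :: "'c \<Rightarrow> 'a::second_countable_topology \<times> 'b::second_countable_topology"
  shows "f \<in> borel_measurable M \<Longrightarrow> (\<lambda>x. snd (f x)) \<in> borel_measurable M"
  by (rule measurable_compose[of f M borel snd]) (auto intro!: borel_measurable_continuous_onI continuous_intros)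

lemma nn_integral_lborel_fst:
  fixes f :: "'a::euclidean_space \<times> 'b::euclidean_space \<Rightarrow> ennreal"
  assumes "f \<in> borel_measurable borel"
  shows "(\<integral>\<^sup>+z. f z \<partial>lborel) = (\<integral>\<^sup>+x. \<integral>\<^sup>+y. f (x, y) \<partial>lborel \<partial>lborel)"
  using assms by (subst lborel.nn_integral_fst) (auto simp: lborel_prod)

lemma nn_integral_lborel_snd:
  fixes f :: "'a::euclidean_space \<times> 'b::euclidean_space \<Rightarrow> ennreal"
  assumes "f \<in> borel_measurable borel"
  shows "(\<integral>\<^sup>+z. f z \<partial>lborel) = (\<integral>\<^sup>+y. \<integral>\<^sup>+x. f (x, y) \<partial>lborel \<partial>lborel)"
  using assms by (subst lborel_pair.nn_integral_snd) (auto simp: lborel_prod)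

lemma nn_integral_shift:
  fixes f :: "real \<Rightarrow> ennreal"
  assumes "f \<in> borel_measurable borel"
  shows "(\<integral>\<^sup>+x. f (x + c) \<partial>lborel) = (\<integral>\<^sup>+x. f x \<partial>lborel)"
  using nn_integral_real_affine[OF assms, of 1 c] by (simp add: add.commute)

lemma nn_integral_Ico_Icc:
  fixes f :: "real \<Rightarrow> ennreal"
  shows "(\<integral>\<^sup>+x\<in>{a..<b}. f x \<partial>lborel) = (\<integral>\<^sup>+x\<in>{a..b}. f x \<partial>lborel)"
  by (rule nn_integral_cong_AE) (use AE_lborel_singleton[of b] in \<open>eventually_elim, auto split: split_indicator\<close>)

text \<open>The window is cut at p or at 0, according to the sign of c, and the protruding piece is
  moved by one period; the bound on c makes a single shift enough.\<close>

lemma nn_integral_period: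
  fixes f :: "real \<Rightarrow> ennreal"
  assumes [measurable]: "f \<in> borel_measurable borel" and per: "\<And>x. f (x + p) = f x"
    and p: "0 < p" "\<bar>c\<bar> \<le> p"
  shows "(\<integral>\<^sup>+x\<in>{c..c + p}. f x \<partial>lborel) = (\<integral>\<^sup>+x\<in>{0..p}. f x \<partial>lborel)"
proof -
  have split: "(\<integral>\<^sup>+x\<in>{a..<d}. f x \<partial>lborel) = (\<integral>\<^sup>+x\<in>{a..<b}. f x \<partial>lborel) + (\<integral>\<^sup>+x\<in>{b..<d}. f x \<partial>lborel)"
    if "a \<le> b" "b \<le> d" for a b d
    using that by (subst nn_integral_add[symmetric]) (auto intro!: nn_integral_cong split: split_indicator)
  have shift: "(\<integral>\<^sup>+x\<in>{a + p..<b + p}. f x \<partial>lborel) = (\<integral>\<^sup>+x\<in>{a..<b}. f x \<partial>lborel)" for a b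
    by (subst nn_integral_shift[of _ p, symmetric])
       (auto intro!: nn_integral_cong simp: per split: split_indicator)
  show ?thesis
  proof (cases "0 \<le> c")
    case True
    then show ?thesis using p split[of 0 c p] split[of c p "c + p"] shift[of 0 c]
      by (simp add: nn_integral_Ico_Icc[symmetric] add.commute)
  next
    case False
    then show ?thesis using p split[of c 0 "c + p"] split[of 0 "c + p" p] shift[of c 0]
      by (simp add: nn_integral_Ico_Icc[symmetric] add.commute)
  qed
qed

section \<open>Polar coordinates around a point of the cylinder\<close>

abbreviation strip :: "(real \<times> real) set" where "strip \<equiv> UNIV \<times> {0..2 * pi}"

abbreviation polar_half :: "(real \<times> real) set" where "polar_half \<equiv> {0<..} \<times> {0<..<2 * pi}"

text \<open>The point at distance exp (- fst z) from x in direction snd z. The radius is logarithmic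
  once more, so \<open>nn_integral_polar\<close> applies in the (t, \<theta>) plane and the Jacobian
  is again exp (-2 fst z); \<open>polar_half\<close> consists of the radii below 1.\<close>

definition add_polar :: "real \<times> real \<Rightarrow> real \<times> real \<Rightarrow> real \<times> real" where
  "add_polar x z = (fst x + exp (- fst z) * cos (snd z), snd x + exp (- fst z) * sin (snd z))"

lemma measurable_add_polar [measurable]:
  assumes [measurable]: "f \<in> borel_measurable M" "g \<in> borel_measurable M"
  shows "(\<lambda>x. add_polar (f x) (g x)) \<in> borel_measurable M"
  unfolding add_polar_def by measurable

lemma strip_borel [measurable, simp]: "strip \<in> sets borel"
  by (intro borel_closed closed_Times) auto

lemma polar_half_borel [measurable, simp]: "polar_half \<in> sets borel"
  by (intro borel_open open_Times) auto

text \<open>Translations preserve the measure of the cylinder: in t on the whole line, in \<theta>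
  by periodicity.\<close>

lemma nn_integral_strip_shift:
  fixes f :: "real \<times> real \<Rightarrow> ennreal"
  assumes [measurable]: "f \<in> borel_measurable borel" and per: "\<And>t \<theta>. f (t, \<theta> + 2 * pi) = f (t, \<theta>)"
    and c: "\<bar>snd c\<bar> \<le> 2 * pi"
  shows "(\<integral>\<^sup>+x\<in>strip. f (fst x + fst c, snd x + snd c) \<partial>lborel) = (\<integral>\<^sup>+x\<in>strip. f x \<partial>lborel)"
proof -
  have "(\<integral>\<^sup>+x\<in>strip. f (fst x + fst c, snd x + snd c) \<partial>lborel) 
    = (\<integral>\<^sup>+t. (\<integral>\<^sup>+\<theta>\<in>{0..2 * pi}. f (t + fst c, \<theta> + snd c) \<partial>lborel) \<partial>lborel)"
    by (subst nn_integral_lborel_fst) (auto intro!: nn_integral_cong split: split_indicator)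
  also have "\<dots> = (\<integral>\<^sup>+t. (\<integral>\<^sup>+\<theta>\<in>{0..2 * pi}. f (t + fst c, \<theta>) \<partial>lborel) \<partial>lborel)"
  proof (rule nn_integral_cong)
    fix t
    have "(\<integral>\<^sup>+\<theta>\<in>{0..2 * pi}. f (t + fst c, \<theta> + snd c) \<partial>lborel) = (\<integral>\<^sup>+\<theta>\<in>{snd c..snd c + 2 * pi}. f (t + fst c, \<theta>) \<partial>lborel)"
      by (subst nn_integral_shift[of "\<lambda>\<theta>. f (t + fst c, \<theta>) * indicator {snd c..snd c + 2 * pi} \<theta>" "snd c", symmetric])
         (auto intro!: nn_integral_cong split: split_indicator)
    also have "\<dots> = (\<integral>\<^sup>+\<theta>\<in>{0..2 * pi}. f (t + fst c, \<theta>) \<partial>lborel)"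
      using c per by (intro nn_integral_period) auto
    finally show "(\<integral>\<^sup>+\<theta>\<in>{0..2 * pi}. f (t + fst c, \<theta> + snd c) \<partial>lborel) = \<dots>" .
  qed
  also have "\<dots> = (\<integral>\<^sup>+t. (\<integral>\<^sup>+\<theta>\<in>{0..2 * pi}. f (t, \<theta>) \<partial>lborel) \<partial>lborel)"
    by (rule nn_integral_shift[of "\<lambda>t. (\<integral>\<^sup>+\<theta>\<in>{0..2 * pi}. f (t, \<theta>) \<partial>lborel)"]) measurable
  also have "\<dots> = (\<integral>\<^sup>+x\<in>strip. f x \<partial>lborel)"
    by (subst nn_integral_lborel_fst) (auto intro!: nn_integral_cong split: split_indicator)
  finally show ?thesis .
qed

text \<open>The unit ball embeds into the cylinder because its diameter is at most \<open>2 * pi\<close>.\<close>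

lemma nn_integral_add_polar_le:
  fixes f :: "real \<times> real \<Rightarrow> ennreal"
  assumes [measurable]: "f \<in> borel_measurable borel" and per: "\<And>t \<theta>. f (t, \<theta> + 2 * pi) = f (t, \<theta>)"
    and x: "0 \<le> snd x" "snd x \<le> 2 * pi"
  shows "(\<integral>\<^sup>+z\<in>polar_half. f (add_polar x z) * ennreal (exp (- 2 * fst z)) \<partial>lborel) \<le> (\<integral>\<^sup>+x\<in>strip. f x \<partial>lborel)"
proof -
  let ?f = "\<lambda>p :: real^2. f (fst x + p $ 1, snd x + p $ 2)"
  have [measurable]: "?f \<in> borel_measurable borel" by measurable
  have "(\<integral>\<^sup>+z\<in>polar_half. f (add_polar x z) * ennreal (exp (- 2 * fst z)) \<partial>lborel)
    = (\<integral>\<^sup>+t. \<integral>\<^sup>+\<theta>. ?f (polar t \<theta>) * ennreal (exp (- 2 * t)) * indicator {0<..<2 * pi} \<theta> * indicator {0<..} t \<partial>lborel \<partial>lborel)"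
    by (subst nn_integral_lborel_fst) 
      (auto intro!: nn_integral_cong simp: add_polar_def polar_def split: split_indicator)
  also have "\<dots> = (\<integral>\<^sup>+p\<in>ball 0 (exp (- 0)). ?f p \<partial>lborel)"
    by (rule nn_integral_polar[symmetric]) measurable
  also have "\<dots> \<le> (\<integral>\<^sup>+p. ?f p * indicator {- pi..pi} (p $ 2) \<partial>lborel)"
  proof (intro nn_integral_mono)
    fix p :: "real^2"
    have "\<bar>p $ 2\<bar> \<le> norm p" by (rule component_le_norm_cart)
    then show "?f p * indicator (ball 0 (exp (- 0))) p \<le> ?f p * indicator {- pi..pi} (p $ 2)"
      using pi_ge_two by (auto split: split_indicator)
  qed
  also have "\<dots> = (\<integral>\<^sup>+t. \<integral>\<^sup>+\<theta>. f (fst x + t, snd x + \<theta>) * indicator {- pi..pi} \<theta> \<partial>lborel \<partial>lborel)"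
    by (subst nn_integral_vector2) auto
  also have "\<dots> = (\<integral>\<^sup>+t. \<integral>\<^sup>+\<theta>. f (fst x + t, snd x - pi + \<theta>) * indicator {0..2 * pi} \<theta> \<partial>lborel \<partial>lborel)"
    by (rule nn_integral_cong, subst nn_integral_shift[of _ "- pi", symmetric])
       (auto intro!: nn_integral_cong simp: algebra_simps split: split_indicator)
  also have "\<dots> = (\<integral>\<^sup>+z\<in>strip. f (fst z + fst (fst x, snd x - pi), snd z + snd (fst x, snd x - pi)) \<partial>lborel)"
    by (subst nn_integral_lborel_fst) 
      (auto intro!: nn_integral_cong simp: add.commute split: split_indicator)
  also have "\<dots> = (\<integral>\<^sup>+x\<in>strip. f x \<partial>lborel)"
    using x by (intro nn_integral_strip_shift per) auto
  finally show ?thesis .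
qed

lemma ennreal_le_sqrt:
  assumes "x\<^sup>2 \<le> ennreal a" "0 \<le> a"
  shows "x \<le> ennreal (sqrt a)"
proof (cases x)
  case (real r)
  then have "r\<^sup>2 \<le> a" using assms by (simp add: ennreal_power)
  then show ?thesis using real by (auto intro!: ennreal_leI real_le_rsqrt)
next
  case top
  then show ?thesis using assms by (simp add: power2_eq_square ennreal_mult_top top_unique)
qed

lemma tendsto_exp_neg_at_top:
  fixes k :: real
  assumes "0 < k"
  shows "((\<lambda>t. exp (- (k * t))) \<longlongrightarrow> 0) at_top"
  by (rule filterlim_compose[OF exp_at_bot])
     (use assms in \<open>auto simp: filterlim_uminus_at_bot intro!: filterlim_tendsto_pos_mult_at_top[OF tendsto_const] filterlim_ident\<close>)

lemma nn_integral_exp_Ici: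
  assumes "0 < k"
  shows "(\<integral>\<^sup>+t\<in>{a<..}. ennreal (exp (- (k * t))) \<partial>lborel) = ennreal (exp (- (k * a)) / k)"
proof -
  have "(\<integral>\<^sup>+t\<in>{a<..}. ennreal (exp (- (k * t))) \<partial>lborel) = (\<integral>\<^sup>+t\<in>{a..}. ennreal (exp (- (k * t))) \<partial>lborel)"
    by (rule nn_integral_cong_AE) (use AE_lborel_singleton[of a] in \<open>eventually_elim, auto split: split_indicator\<close>)
  also have "\<dots> = ennreal (0 - (- exp (- (k * a)) / k))"
  proof (rule nn_integral_FTC_atLeast)
    show "((\<lambda>t. - exp (- (k * t)) / k) \<longlongrightarrow> 0) at_top"
      using tendsto_divide[OF tendsto_minus[OF tendsto_exp_neg_at_top[OF assms]] tendsto_const[of k]] assms by simp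
  qed (use assms in \<open>auto intro!: derivative_eq_intros\<close>)
  finally show ?thesis by simp
qed

lemma nn_integral_Times:
  fixes f g :: "real \<Rightarrow> ennreal"
  assumes [measurable]: "f \<in> borel_measurable borel" "A \<in> sets borel" "B \<in> sets borel"
  shows "(\<integral>\<^sup>+z\<in>A \<times> B. f (fst z) \<partial>(lborel :: (real \<times> real) measure)) = (\<integral>\<^sup>+t\<in>A. f t \<partial>lborel) * emeasure lborel B"
proof -
  have [measurable]: "A \<times> B \<in> sets borel" by (intro borel_Times) auto
  have "(\<integral>\<^sup>+z\<in>A \<times> B. f (fst z) \<partial>(lborel :: (real \<times> real) measure)) = (\<integral>\<^sup>+t. \<integral>\<^sup>+\<theta>. (f t * indicator A t) * indicator B \<theta> \<partial>lborel \<partial>lborel)"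
    by (subst nn_integral_lborel_fst) (auto simp: indicator_times mult.assoc)
  then show ?thesis by (simp add: nn_integral_cmult nn_integral_multc)
qed

lemma nn_integral_Times_iterated:
  fixes f :: "real \<times> real \<Rightarrow> ennreal"
  assumes [measurable]: "f \<in> borel_measurable borel" "A \<in> sets borel" "B \<in> sets borel"
  shows "(\<integral>\<^sup>+z\<in>A \<times> B. f z \<partial>lborel) = (\<integral>\<^sup>+\<omega>\<in>B. (\<integral>\<^sup>+\<sigma>\<in>A. f (\<sigma>, \<omega>) \<partial>lborel) \<partial>lborel)"
proof -
  have [measurable]: "A \<times> B \<in> sets borel" by (intro borel_Times) auto
  have "(\<integral>\<^sup>+z\<in>A \<times> B. f z \<partial>lborel) = (\<integral>\<^sup>+\<omega>. \<integral>\<^sup>+\<sigma>. f (\<sigma>, \<omega>) * indicator A \<sigma> * indicator B \<omega> \<partial>lborel \<partial>lborel)"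
    by (subst nn_integral_lborel_snd) (auto simp: indicator_times mult.assoc)
  also have "\<dots> = (\<integral>\<^sup>+\<omega>\<in>B. (\<integral>\<^sup>+\<sigma>\<in>A. f (\<sigma>, \<omega>) \<partial>lborel) \<partial>lborel)"
    by (intro nn_integral_cong nn_integral_multc) measurable
  finally show ?thesis .
qed

lemma Cauchy_Schwarz_real2:
  fixes a b c d :: real
  shows "(a * c + b * d)\<^sup>2 \<le> (a\<^sup>2 + b\<^sup>2) * (c\<^sup>2 + d\<^sup>2)"
  using zero_le_power2[of "a * d - b * c"] by (simp add: power2_eq_square algebra_simps)

text \<open>A test function read on the cylinder, lifted to a periodic function on the plane. The
  bound b on the support makes the integrals finite and removes boundary terms; it does not enter
  the final constants.\<close>

locale cylinder_fn =
  fixes W Wt Wh :: "real \<times> real \<Rightarrow> real" and b :: real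
  assumes b_ge: "1 \<le> b"
    and W_deriv: "\<And>x. (W has_derivative (\<lambda>h. Wt x * fst h + Wh x * snd h)) (at x)"
    and Wt_cont: "continuous_on UNIV Wt"
    and Wh_cont: "continuous_on UNIV Wh"
    and W_per: "\<And>t \<theta>. W (t, \<theta> + 2 * pi) = W (t, \<theta>)"
    and Wt_per: "\<And>t \<theta>. Wt (t, \<theta> + 2 * pi) = Wt (t, \<theta>)"
    and Wh_per: "\<And>t \<theta>. Wh (t, \<theta> + 2 * pi) = Wh (t, \<theta>)"
    and W_zero: "\<And>t \<theta>. t \<le> 1 \<or> b \<le> t \<Longrightarrow> W (t, \<theta>) = 0"
    and Wt_zero: "\<And>t \<theta>. t \<le> 1 \<or> b \<le> t \<Longrightarrow> Wt (t, \<theta>) = 0"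
    and Wh_zero: "\<And>t \<theta>. t \<le> 1 \<or> b \<le> t \<Longrightarrow> Wh (t, \<theta>) = 0"
begin

lemma W_cont: "continuous_on S W"
  using W_deriv by (meson has_derivative_continuous continuous_at_imp_continuous_on)

definition P :: "real \<times> real \<Rightarrow> real" where "P x = (Wt x)\<^sup>2 + (Wh x)\<^sup>2"

lemma P_cont: "continuous_on S P"
  unfolding P_def by (intro continuous_intros continuous_on_subset[OF Wt_cont] continuous_on_subset[OF Wh_cont]) auto

lemma P_nonneg: "0 \<le> P x"
  by (simp add: P_def)

lemma measurable_W [measurable]: "W \<in> borel_measurable borel" "Wt \<in> borel_measurable borel"
    "Wh \<in> borel_measurable borel" "P \<in> borel_measurable borel"
  by (intro borel_measurable_continuous_onI W_cont Wt_cont Wh_cont P_cont)+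

lemma W_ray_deriv:
  "((\<lambda>\<sigma>. W (add_polar x (\<sigma>, \<omega>))) has_real_derivative
    - exp (- \<sigma>) * (Wt (add_polar x (\<sigma>, \<omega>)) * cos \<omega> + Wh (add_polar x (\<sigma>, \<omega>)) * sin \<omega>)) (at \<sigma>)"
proof -
  have "((\<lambda>\<sigma>. add_polar x (\<sigma>, \<omega>)) has_derivative (\<lambda>h. (- exp (- \<sigma>) * cos \<omega> * h, - exp (- \<sigma>) * sin \<omega> * h))) (at \<sigma>)"
    unfolding add_polar_def by (auto intro!: derivative_eq_intros)
  from has_derivative_compose[OF this W_deriv] show ?thesis
    unfolding has_field_derivative_def
    by (rule has_derivative_eq_rhs) (auto simp: fun_eq_iff algebra_simps)
qed

lemma W_ray_cont: "continuous_on S (\<lambda>\<sigma>. f (add_polar x (\<sigma>, \<omega>)))" if "continuous_on UNIV f" for f :: "real \<times> real \<Rightarrow> real"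
  by (rule continuous_on_compose2[OF that]) (auto simp: add_polar_def intro!: continuous_intros)

text \<open>The ray reaches x as \<sigma> tends to infinity, and the derivative along it carries the
  factor exp (-\<sigma>). The estimate is made up to a finite T, bounded by the full nonnegative
  integral, which may be infinite, and only then is T sent to infinity by continuity of W.\<close>

lemma W_ray_le:
  "ennreal \<bar>W x\<bar> \<le> ennreal \<bar>W (add_polar x (\<tau>, \<omega>))\<bar> + (\<integral>\<^sup>+\<sigma>\<in>{\<tau><..}. ennreal (sqrt (P (add_polar x (\<sigma>, \<omega>))) * exp (- \<sigma>)) \<partial>lborel)"
  (is "_ \<le> _ + ?J")
proof -
  have le: "ennreal \<bar>W (add_polar x (T, \<omega>))\<bar> \<le> ennreal \<bar>W (add_polar x (\<tau>, \<omega>))\<bar> + ?J" if T: "\<tau> \<le> T" for T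
  proof -
    let ?d = "\<lambda>\<sigma>. - exp (- \<sigma>) * (Wt (add_polar x (\<sigma>, \<omega>)) * cos \<omega> + Wh (add_polar x (\<sigma>, \<omega>)) * sin \<omega>)"
    let ?p = "\<lambda>\<sigma>. sqrt (P (add_polar x (\<sigma>, \<omega>))) * exp (- \<sigma>)"
    have int: "(?d has_integral W (add_polar x (T, \<omega>)) - W (add_polar x (\<tau>, \<omega>))) {\<tau>..T}"
      using T W_ray_deriv[of x \<omega>]
      by (intro fundamental_theorem_of_calculus) 
         (auto simp: has_real_derivative_iff_has_vector_derivative[symmetric] intro: DERIV_subset)
    have pint: "?p integrable_on {\<tau>..T}"
      by (intro integrable_continuous_real continuous_intros W_ray_cont P_cont)
    have "\<bar>W (add_polar x (T, \<omega>)) - W (add_polar x (\<tau>, \<omega>))\<bar> \<le> integral {\<tau>..T} ?p"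
    proof -
      have "norm (integral {\<tau>..T} ?d) \<le> integral {\<tau>..T} ?p"
      proof (rule integral_norm_bound_integral)
        fix \<sigma>
        let ?y = "add_polar x (\<sigma>, \<omega>)"
        have "(Wt ?y * cos \<omega> + Wh ?y * sin \<omega>)\<^sup>2 \<le> P ?y" 
          using Cauchy_Schwarz_real2[of "Wt ?y" "cos \<omega>" "Wh ?y" "sin \<omega>"] by (simp add: P_def)
        then have "\<bar>Wt ?y * cos \<omega> + Wh ?y * sin \<omega>\<bar> \<le> sqrt (P ?y)" by (simp add: real_le_rsqrt)
        then show "norm (?d \<sigma>) \<le> ?p \<sigma>" by (simp add: abs_mult mult.commute)
      qed (use int pint in auto)
      then show ?thesis using integral_unique[OF int] by simp
    qed
    then have "\<bar>W (add_polar x (T, \<omega>))\<bar> \<le> \<bar>W (add_polar x (\<tau>, \<omega>))\<bar> + integral {\<tau>..T} ?p" by linarith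
    then have "ennreal \<bar>W (add_polar x (T, \<omega>))\<bar> \<le> ennreal (\<bar>W (add_polar x (\<tau>, \<omega>))\<bar> + integral {\<tau>..T} ?p)"
      by (rule ennreal_leI)
    also have "\<dots> = ennreal \<bar>W (add_polar x (\<tau>, \<omega>))\<bar> + ennreal (integral {\<tau>..T} ?p)"
      using integral_nonneg[OF pint] P_nonneg by (intro ennreal_plus) auto
    also have "ennreal (integral {\<tau>..T} ?p) = (\<integral>\<^sup>+\<sigma>\<in>{\<tau>..T}. ennreal (?p \<sigma>) \<partial>lborel)"
      using nn_integral_has_integral_lebesgue'[OF _ integrable_integral[OF pint]] P_nonneg by simp
    also have "\<dots> \<le> ?J"
      by (rule order_trans[OF nn_integral_mono_AE order_refl])
         (use AE_lborel_singleton[of \<tau>] in \<open>eventually_elim, auto split: split_indicator\<close>)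
    finally show ?thesis by (simp add: add_left_mono)
  qed
  have "((\<lambda>T. W (add_polar x (T, \<omega>))) \<longlongrightarrow> W x) at_top"
  proof (rule isCont_tendsto_compose[of x W])
    show "isCont W x" by (rule has_derivative_continuous[OF W_deriv])
    have "((\<lambda>T. (fst x + exp (- T) * cos \<omega>, snd x + exp (- T) * sin \<omega>)) \<longlongrightarrow> (fst x + 0 * cos \<omega>, snd x + 0 * sin \<omega>)) at_top"
      using tendsto_exp_neg_at_top[of 1] by (intro tendsto_intros) auto
    then show "((\<lambda>T. add_polar x (T, \<omega>)) \<longlongrightarrow> x) at_top" by (simp add: add_polar_def)
  qed
  then have "((\<lambda>T. ennreal \<bar>W (add_polar x (T, \<omega>))\<bar>) \<longlongrightarrow> ennreal \<bar>W x\<bar>) at_top"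
    by (intro tendsto_ennrealI tendsto_rabs)
  then show ?thesis
    by (rule tendsto_upperbound) (auto intro!: eventually_at_top_linorderI[of \<tau>] le)
qed

lemma P_per: "P (t, \<theta> + 2 * pi) = P (t, \<theta>)"
  by (simp add: P_def Wt_per Wh_per)

text \<open>In the planar variable z this is the integral of P(x + z) |z|^(-1-\<gamma>) over the
  unit disc: the Jacobian turns the kernel exp ((1 + \<gamma>) \<sigma>) into the weight exp (-(1 -
  \<gamma>) \<sigma>).\<close>

definition M :: "real \<Rightarrow> real \<times> real \<Rightarrow> ennreal" where
  "M \<gamma> x = (\<integral>\<^sup>+z\<in>polar_half. ennreal (P (add_polar x z)) * ennreal (exp (- ((1 - \<gamma>) * fst z))) \<partial>lborel)"

lemma measurable_M [measurable]: "M \<gamma> \<in> borel_measurable borel"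
proof -
  have [measurable]: "Measurable.pred (borel \<Otimes>\<^sub>M lborel) (\<lambda>x. snd x \<in> polar_half)" 
    by (rule measurable_compose[of snd _ borel]) auto
  show ?thesis unfolding M_def indicator_def by measurable
qed

text \<open>After exchanging the integrals, the inner one over x is, for each fixed z, the Dirichlet
  integral of a translate and hence independent of z; what remains is the mass of the
  weight.\<close>

lemma M_integral:
  assumes "\<gamma> < 1"
  shows "(\<integral>\<^sup>+x\<in>strip. M \<gamma> x \<partial>lborel) \<le> (\<integral>\<^sup>+x\<in>strip. ennreal (P x) \<partial>lborel) * ennreal (2 * pi / (1 - \<gamma>))"
proof -
  let ?D = "\<integral>\<^sup>+x\<in>strip. ennreal (P x) \<partial>lborel"
  have [measurable]: "(\<lambda>x::(real \<times> real) \<times> (real \<times> real). indicator strip (fst x) :: ennreal) \<in> borel_measurable (lborel \<Otimes>\<^sub>M lborel)"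
      "(\<lambda>x::(real \<times> real) \<times> (real \<times> real). indicator polar_half (snd x) :: ennreal) \<in> borel_measurable (lborel \<Otimes>\<^sub>M lborel)"
    by (auto intro!: borel_measurable_indicator' simp: )
  have "(\<integral>\<^sup>+x\<in>strip. M \<gamma> x \<partial>lborel) = (\<integral>\<^sup>+x. \<integral>\<^sup>+z. ennreal (P (add_polar x z)) * ennreal (exp (- ((1 - \<gamma>) * fst z)))
      * indicator polar_half z * indicator strip x \<partial>lborel \<partial>lborel)"
    unfolding M_def by (intro nn_integral_cong nn_integral_multc[symmetric]) measurable
  also have "\<dots> = (\<integral>\<^sup>+z. \<integral>\<^sup>+x. ennreal (P (add_polar x z)) * ennreal (exp (- ((1 - \<gamma>) * fst z)))
      * indicator polar_half z * indicator strip x \<partial>lborel \<partial>lborel)"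
    by (rule lborel_pair.Fubini') (simp add: split_def, measurable)
  also have "\<dots> \<le> (\<integral>\<^sup>+z\<in>polar_half. ennreal (exp (- ((1 - \<gamma>) * fst z))) * ?D \<partial>lborel)"
  proof (rule nn_integral_mono)
    fix z :: "real \<times> real"
    have "(\<integral>\<^sup>+x. ennreal (P (add_polar x z)) * ennreal (exp (- ((1 - \<gamma>) * fst z))) * indicator polar_half z * indicator strip x \<partial>lborel)
      = (ennreal (exp (- ((1 - \<gamma>) * fst z))) * indicator polar_half z) * (\<integral>\<^sup>+x\<in>strip. ennreal (P (add_polar x z)) \<partial>lborel)"
    proof -
      have "(\<integral>\<^sup>+x. ennreal (P (add_polar x z)) * ennreal (exp (- ((1 - \<gamma>) * fst z))) * indicator polar_half z * indicator strip x \<partial>lborel)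
        = (\<integral>\<^sup>+x. (ennreal (exp (- ((1 - \<gamma>) * fst z))) * indicator polar_half z) * (ennreal (P (add_polar x z)) * indicator strip x) \<partial>lborel)"
        by (intro nn_integral_cong) (simp add: mult_ac)
      also have "\<dots> = (ennreal (exp (- ((1 - \<gamma>) * fst z))) * indicator polar_half z) * (\<integral>\<^sup>+x\<in>strip. ennreal (P (add_polar x z)) \<partial>lborel)"
        by (intro nn_integral_cmult) measurable
      finally show ?thesis .
    qed
    also have "\<dots> \<le> (ennreal (exp (- ((1 - \<gamma>) * fst z))) * indicator polar_half z) * ?D"
    proof (cases "z \<in> polar_half")
      case True
      let ?c = "(exp (- fst z) * cos (snd z), exp (- fst z) * sin (snd z))"
      have "\<bar>snd ?c\<bar> \<le> 1" using True by (auto simp: abs_mult intro!: mult_le_one)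
      then have "\<bar>snd ?c\<bar> \<le> 2 * pi" using pi_ge_two by linarith
      then have "(\<integral>\<^sup>+x\<in>strip. ennreal (P (fst x + fst ?c, snd x + snd ?c)) \<partial>lborel) = ?D"
        by (intro nn_integral_strip_shift[of "\<lambda>x. ennreal (P x)"]) (auto simp: P_per)
      then show ?thesis by (simp add: add_polar_def)
    qed simp
    finally show "(\<integral>\<^sup>+x. ennreal (P (add_polar x z)) * ennreal (exp (- ((1 - \<gamma>) * fst z))) * indicator polar_half z * indicator strip x \<partial>lborel)
      \<le> ennreal (exp (- ((1 - \<gamma>) * fst z))) * ?D * indicator polar_half z" by (simp add: mult_ac)
  qed
  also have "\<dots> = ?D * (\<integral>\<^sup>+z\<in>polar_half. ennreal (exp (- ((1 - \<gamma>) * fst z))) \<partial>lborel)"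
  proof -
    have "(\<integral>\<^sup>+z\<in>polar_half. ennreal (exp (- ((1 - \<gamma>) * fst z))) * ?D \<partial>lborel)
      = (\<integral>\<^sup>+z. ?D * (ennreal (exp (- ((1 - \<gamma>) * fst z))) * indicator polar_half z) \<partial>lborel)"
      by (intro nn_integral_cong) (simp only: mult_ac)
    also have "\<dots> = ?D * (\<integral>\<^sup>+z\<in>polar_half. ennreal (exp (- ((1 - \<gamma>) * fst z))) \<partial>lborel)"
      by (intro nn_integral_cmult) measurable
    finally show ?thesis .
  qed
  also have "(\<integral>\<^sup>+z\<in>polar_half. ennreal (exp (- ((1 - \<gamma>) * fst z))) \<partial>lborel) = ennreal (2 * pi / (1 - \<gamma>))"
    using assms nn_integral_exp_Ici[of "1 - \<gamma>" 0] 
    by (subst nn_integral_Times) (auto simp: mult.commute simp flip: ennreal_mult)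
  finally show ?thesis .
qed

end

context cylinder_fn begin

text \<open>
  Average the fundamental theorem of calculus along the rays from \<open>x\<close>, starting at distance
  \<open>exp (-\<tau>)\<close> with \<open>\<tau> \<in> (0,1)\<close>, and split the rays at distance \<open>exp (-L)\<close>. The outer part is
  responsible for the sharp constant; the inner part is bounded through \<open>M\<close>, whose integral is
  finite by Tonelli since the kernel \<open>|z| powr (-1-\<gamma>)\<close> is integrable.
\<close>

lemma W_pointwise:
  assumes x: "0 \<le> snd x" "snd x \<le> 2 * pi" and \<gamma>: "0 < \<gamma>" "\<gamma> < 1" and L: "0 \<le> L"
    and D: "(\<integral>\<^sup>+x\<in>strip. ennreal (P x) \<partial>lborel) \<le> 1"
    and D2: "(\<integral>\<^sup>+x\<in>strip. ennreal ((W x)\<^sup>2) \<partial>lborel) \<le> 2"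
    and M: "M \<gamma> x \<le> ennreal (exp ((1 + \<gamma>) * L))"
  shows "2 * pi * \<bar>W x\<bar> \<le> sqrt (4 * pi * exp 2) + sqrt (2 * pi * L) + sqrt (2 * pi)"
proof -
  let ?Q = "{0<..<1} \<times> {0<..<2 * pi} :: (real \<times> real) set"
  let ?R = "\<lambda>S. S \<times> {0<..<2 * pi} :: (real \<times> real) set"
  let ?p = "\<lambda>z. ennreal (sqrt (P (add_polar x z)) * exp (- fst z))"
  have [measurable]: "?R S \<in> sets borel" if "S \<in> sets borel" for S
    using that by (intro borel_Times) auto
  define J where "J \<omega> = (\<integral>\<^sup>+\<sigma>\<in>{0<..}. ?p (\<sigma>, \<omega>) \<partial>lborel)" for \<omega>
  have [measurable]: "J \<in> borel_measurable borel" unfolding J_def by measurable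
  have le: "ennreal \<bar>W x\<bar> \<le> ennreal \<bar>W (add_polar x z)\<bar> + J (snd z)" if "0 \<le> fst z" for z
  proof -
    have "(\<integral>\<^sup>+\<sigma>\<in>{fst z<..}. ?p (\<sigma>, snd z) \<partial>lborel) \<le> J (snd z)"
      unfolding J_def using that by (intro nn_integral_mono) (auto split: split_indicator)
    then show ?thesis using W_ray_le[of x "fst z" "snd z"] by (auto intro: order_trans add_left_mono)
  qed
  \<comment> \<open>The starting points range over (0,1) x (0, 2 pi), a set of measure 2 pi: this is
    the factor in front of W.\<close>
  have "ennreal (2 * pi * \<bar>W x\<bar>) = (\<integral>\<^sup>+z\<in>?Q. ennreal \<bar>W x\<bar> \<partial>lborel)"
    using nn_integral_Times[of "\<lambda>_. ennreal \<bar>W x\<bar>" "{0<..<1}" "{0<..<2*pi}"] 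
    by (simp add: nn_integral_cmult ennreal_mult mult.commute)
  also have "\<dots> \<le> (\<integral>\<^sup>+z. ennreal \<bar>W (add_polar x z)\<bar> * indicator ?Q z + J (snd z) * indicator ?Q z \<partial>lborel)"
    by (intro nn_integral_mono) (auto split: split_indicator intro!: le)
  also have "\<dots> = (\<integral>\<^sup>+z\<in>?Q. ennreal \<bar>W (add_polar x z)\<bar> \<partial>lborel) + (\<integral>\<^sup>+z\<in>?Q. J (snd z) \<partial>lborel)"
    by (intro nn_integral_add) auto
  also have "(\<integral>\<^sup>+z\<in>?Q. J (snd z) \<partial>lborel) = (\<integral>\<^sup>+\<omega>\<in>{0<..<2*pi}. J \<omega> \<partial>lborel)"
    by (subst nn_integral_Times_iterated) (auto simp: nn_integral_cmult intro!: nn_integral_cong)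
  also have "\<dots> = (\<integral>\<^sup>+z\<in>polar_half. ?p z \<partial>lborel)"
    unfolding J_def by (subst nn_integral_Times_iterated) auto
  also have "\<dots> \<le> (\<integral>\<^sup>+z. ?p z * indicator (?R {0<..L}) z + ?p z * indicator (?R {L<..}) z \<partial>lborel)"
    by (intro nn_integral_mono) (auto split: split_indicator)
  also have "\<dots> = (\<integral>\<^sup>+z\<in>?R {0<..L}. ?p z \<partial>lborel) + (\<integral>\<^sup>+z\<in>?R {L<..}. ?p z \<partial>lborel)"
    by (intro nn_integral_add) auto
  finally have main: "ennreal (2 * pi * \<bar>W x\<bar>) \<le> (\<integral>\<^sup>+z\<in>?Q. ennreal \<bar>W (add_polar x z)\<bar> \<partial>lborel) +
      ((\<integral>\<^sup>+z\<in>?R {0<..L}. ?p z \<partial>lborel) + (\<integral>\<^sup>+z\<in>?R {L<..}. ?p z \<partial>lborel))"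
    by (simp add: add_left_mono)
  have CS: "(\<integral>\<^sup>+z\<in>A. f z * g z \<partial>lborel)\<^sup>2 \<le> (\<integral>\<^sup>+z\<in>A. (f z)\<^sup>2 \<partial>lborel) * (\<integral>\<^sup>+z\<in>A. (g z)\<^sup>2 \<partial>lborel)"
    if [measurable]: "f \<in> borel_measurable borel" "g \<in> borel_measurable borel" "A \<in> sets borel"
    for f g :: "real \<times> real \<Rightarrow> ennreal" and A
  proof -
    have "(\<integral>\<^sup>+z\<in>A. f z * g z \<partial>lborel)\<^sup>2 = (\<integral>\<^sup>+z. (f z * indicator A z) * (g z * indicator A z) \<partial>lborel)\<^sup>2"
      by (intro arg_cong[where f = "\<lambda>x. x\<^sup>2"] nn_integral_cong) (auto split: split_indicator)
    also have "\<dots> \<le> (\<integral>\<^sup>+z. (f z * indicator A z)\<^sup>2 \<partial>lborel) * (\<integral>\<^sup>+z. (g z * indicator A z)\<^sup>2 \<partial>lborel)"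
      by (intro Cauchy_Schwarz_nn_integral) auto
    also have "\<dots> = (\<integral>\<^sup>+z\<in>A. (f z)\<^sup>2 \<partial>lborel) * (\<integral>\<^sup>+z\<in>A. (g z)\<^sup>2 \<partial>lborel)"
      by (intro arg_cong2[where f = times] nn_integral_cong) (auto split: split_indicator)
    finally show ?thesis .
  qed
  have polar_le: "(\<integral>\<^sup>+z\<in>?R S. ennreal (f (add_polar x z)) * ennreal (exp (- 2 * fst z)) \<partial>lborel) \<le> (\<integral>\<^sup>+x\<in>strip. ennreal (f x) \<partial>lborel)"
    if "S \<subseteq> {0<..}" "f \<in> borel_measurable borel" "\<And>t \<theta>. f (t, \<theta> + 2 * pi) = f (t, \<theta>)" for S and f :: "real \<times> real \<Rightarrow> real"
  proof -
    have "(\<integral>\<^sup>+z\<in>?R S. ennreal (f (add_polar x z)) * ennreal (exp (- 2 * fst z)) \<partial>lborel) 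
        \<le> (\<integral>\<^sup>+z\<in>polar_half. ennreal (f (add_polar x z)) * ennreal (exp (- 2 * fst z)) \<partial>lborel)"
      using that(1) by (intro nn_integral_mono) (auto split: split_indicator)
    also have "\<dots> \<le> (\<integral>\<^sup>+x\<in>strip. ennreal (f x) \<partial>lborel)"
      using that x by (intro nn_integral_add_polar_le) auto
    finally show ?thesis .
  qed
  \<comment> \<open>Cauchy-Schwarz with weights exp (-\<sigma>) and exp \<sigma>. The square of the
    first is the Jacobian, which leaves the integral of W^2, at most 2; the second contributes at
    most 2 pi exp 2 because \<sigma> < 1.\<close>
  have A: "(\<integral>\<^sup>+z\<in>?Q. ennreal \<bar>W (add_polar x z)\<bar> \<partial>lborel) \<le> ennreal (sqrt (4 * pi * exp 2))"
  proof (rule ennreal_le_sqrt)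
    have "(\<integral>\<^sup>+z\<in>?Q. ennreal \<bar>W (add_polar x z)\<bar> \<partial>lborel)\<^sup>2 
      = (\<integral>\<^sup>+z\<in>?Q. ennreal (\<bar>W (add_polar x z)\<bar> * exp (- fst z)) * ennreal (exp (fst z)) \<partial>lborel)\<^sup>2"
      by (simp add: mult.assoc flip: ennreal_mult exp_add)
    also have "\<dots> \<le> (\<integral>\<^sup>+z\<in>?Q. (ennreal (\<bar>W (add_polar x z)\<bar> * exp (- fst z)))\<^sup>2 \<partial>lborel) * (\<integral>\<^sup>+z\<in>?Q. (ennreal (exp (fst z)))\<^sup>2 \<partial>lborel)"
      by (rule CS) measurable
    also have "\<dots> \<le> 2 * (ennreal (exp 2) * ennreal (2 * pi))"
    proof (rule mult_mono)
      have "(\<integral>\<^sup>+z\<in>?Q. (ennreal (\<bar>W (add_polar x z)\<bar> * exp (- fst z)))\<^sup>2 \<partial>lborel)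
        = (\<integral>\<^sup>+z\<in>?Q. ennreal ((W (add_polar x z))\<^sup>2) * ennreal (exp (- 2 * fst z)) \<partial>lborel)"
        by (simp add: ennreal_power power_mult_distrib ennreal_mult exp_double[symmetric])
      also have "\<dots> \<le> 2"
        by (rule order_trans[OF polar_le D2]) (auto simp: W_per)
      finally show "(\<integral>\<^sup>+z\<in>?Q. (ennreal (\<bar>W (add_polar x z)\<bar> * exp (- fst z)))\<^sup>2 \<partial>lborel) \<le> 2" .
      have "(\<integral>\<^sup>+z\<in>?Q. (ennreal (exp (fst z)))\<^sup>2 \<partial>lborel) \<le> (\<integral>\<^sup>+z\<in>?Q. ennreal (exp 2) \<partial>lborel)"
        by (intro nn_integral_mono) (auto simp: ennreal_power exp_double[symmetric] split: split_indicator intro!: ennreal_leI)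
      also have "\<dots> = ennreal (exp 2) * ennreal (2 * pi)"
        using nn_integral_Times[of "\<lambda>_. ennreal (exp 2)" "{0<..<1}" "{0<..<2*pi}"] 
        by (simp add: nn_integral_cmult)
      finally show "(\<integral>\<^sup>+z\<in>?Q. (ennreal (exp (fst z)))\<^sup>2 \<partial>lborel) \<le> ennreal (exp 2) * ennreal (2 * pi)" .
    qed auto
    also have "\<dots> = ennreal (4 * pi * exp 2)"
      by (simp add: ennreal_mult[symmetric] ennreal_numeral[symmetric] del: ennreal_numeral)
    finally show "(\<integral>\<^sup>+z\<in>?Q. ennreal \<bar>W (add_polar x z)\<bar> \<partial>lborel)\<^sup>2 \<le> ennreal (4 * pi * exp 2)" .
  qed simp
  \<comment> \<open>Cauchy-Schwarz against the constant 1 on a set of measure 2 pi L. The other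
    factor is a Dirichlet integral, at most 1, so the leading term sqrt (2 pi L) carries the sharp
    constant.\<close>
  have B1: "(\<integral>\<^sup>+z\<in>?R {0<..L}. ?p z \<partial>lborel) \<le> ennreal (sqrt (2 * pi * L))"
  proof (rule ennreal_le_sqrt)
    have "(\<integral>\<^sup>+z\<in>?R {0<..L}. ?p z * 1 \<partial>lborel)\<^sup>2 \<le> (\<integral>\<^sup>+z\<in>?R {0<..L}. (?p z)\<^sup>2 \<partial>lborel) * (\<integral>\<^sup>+z\<in>?R {0<..L}. 1\<^sup>2 \<partial>lborel)"
      by (rule CS) measurable
    also have "\<dots> \<le> 1 * ennreal (2 * pi * L)"
    proof (rule mult_mono)
      have "(\<integral>\<^sup>+z\<in>?R {0<..L}. (?p z)\<^sup>2 \<partial>lborel) = (\<integral>\<^sup>+z\<in>?R {0<..L}. ennreal (P (add_polar x z)) * ennreal (exp (- 2 * fst z)) \<partial>lborel)"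
        by (simp add: ennreal_power power_mult_distrib P_nonneg ennreal_mult exp_double[symmetric])
      also have "\<dots> \<le> 1"
        by (rule order_trans[OF polar_le D]) (auto simp: P_per)
      finally show "(\<integral>\<^sup>+z\<in>?R {0<..L}. (?p z)\<^sup>2 \<partial>lborel) \<le> 1" .
      show "(\<integral>\<^sup>+z\<in>?R {0<..L}. 1\<^sup>2 \<partial>lborel) \<le> ennreal (2 * pi * L)"
        using nn_integral_Times[of "\<lambda>_. 1" "{0<..L}" "{0<..<2*pi}"] L
        by (simp add: ennreal_mult[symmetric] mult.commute)
    qed auto
    finally show "(\<integral>\<^sup>+z\<in>?R {0<..L}. ?p z \<partial>lborel)\<^sup>2 \<le> ennreal (2 * pi * L)" by simp
  qed (use L in simp)
  \<comment> \<open>The weight exp (-\<sigma>) is split into exponents (1 - \<gamma>)/2 and (1 +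
    \<gamma>)/2. The first square integrates to at most M, the second decays like exp (-(1 +
    \<gamma>) L), and the hypothesis on M makes the two powers of exp L cancel.\<close>
  have B2: "(\<integral>\<^sup>+z\<in>?R {L<..}. ?p z \<partial>lborel) \<le> ennreal (sqrt (2 * pi))"
  proof (rule ennreal_le_sqrt)
    have "(\<integral>\<^sup>+z\<in>?R {L<..}. ?p z \<partial>lborel)\<^sup>2 = (\<integral>\<^sup>+z\<in>?R {L<..}. ennreal (sqrt (P (add_polar x z)) * exp (- ((1 - \<gamma>) / 2 * fst z)))
        * ennreal (exp (- ((1 + \<gamma>) / 2 * fst z))) \<partial>lborel)\<^sup>2"
      by (simp add: P_nonneg mult.assoc flip: ennreal_mult exp_add) (simp add: field_simps)
    also have "\<dots> \<le> (\<integral>\<^sup>+z\<in>?R {L<..}. (ennreal (sqrt (P (add_polar x z)) * exp (- ((1 - \<gamma>) / 2 * fst z))))\<^sup>2 \<partial>lborel)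
        * (\<integral>\<^sup>+z\<in>?R {L<..}. (ennreal (exp (- ((1 + \<gamma>) / 2 * fst z))))\<^sup>2 \<partial>lborel)"
      by (rule CS) measurable
    also have "\<dots> \<le> ennreal (exp ((1 + \<gamma>) * L)) * (ennreal (exp (- ((1 + \<gamma>) * L)) / (1 + \<gamma>)) * ennreal (2 * pi))"
    proof (rule mult_mono)
      have "(\<integral>\<^sup>+z\<in>?R {L<..}. (ennreal (sqrt (P (add_polar x z)) * exp (- ((1 - \<gamma>) / 2 * fst z))))\<^sup>2 \<partial>lborel)
        = (\<integral>\<^sup>+z\<in>?R {L<..}. ennreal (P (add_polar x z)) * ennreal (exp (- ((1 - \<gamma>) * fst z))) \<partial>lborel)"
        by (simp add: ennreal_power power_mult_distrib P_nonneg ennreal_mult exp_double[symmetric])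
      also have "\<dots> \<le> M \<gamma> x"
        unfolding M_def using L by (intro nn_integral_mono) (auto split: split_indicator)
      also note M
      finally show "(\<integral>\<^sup>+z\<in>?R {L<..}. (ennreal (sqrt (P (add_polar x z)) * exp (- ((1 - \<gamma>) / 2 * fst z))))\<^sup>2 \<partial>lborel) \<le> ennreal (exp ((1 + \<gamma>) * L))" .
      have "(\<integral>\<^sup>+z\<in>?R {L<..}. (ennreal (exp (- ((1 + \<gamma>) / 2 * fst z))))\<^sup>2 \<partial>lborel)
        = (\<integral>\<^sup>+z\<in>?R {L<..}. ennreal (exp (- ((1 + \<gamma>) * fst z))) \<partial>lborel)"
        by (simp add: ennreal_power exp_double[symmetric])
      also have "\<dots> = ennreal (exp (- ((1 + \<gamma>) * L)) / (1 + \<gamma>)) * ennreal (2 * pi)"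
        using \<gamma> by (subst nn_integral_Times) (auto simp: nn_integral_exp_Ici)
      finally show "(\<integral>\<^sup>+z\<in>?R {L<..}. (ennreal (exp (- ((1 + \<gamma>) / 2 * fst z))))\<^sup>2 \<partial>lborel) \<le> ennreal (exp (- ((1 + \<gamma>) * L)) / (1 + \<gamma>)) * ennreal (2 * pi)"
        by simp
    qed auto
    also have "\<dots> = ennreal (2 * pi / (1 + \<gamma>))"
      using \<gamma> by (simp add: exp_minus flip: ennreal_mult)
    also have "\<dots> \<le> ennreal (2 * pi)"
      using \<gamma> by (intro ennreal_leI) (simp add: field_simps)
    finally show "(\<integral>\<^sup>+z\<in>?R {L<..}. ?p z \<partial>lborel)\<^sup>2 \<le> ennreal (2 * pi)" .
  qed simp
  note main
  also note add_mono[OF A add_mono[OF B1 B2]]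
  also have "ennreal (sqrt (4 * pi * exp 2)) + (ennreal (sqrt (2 * pi * L)) + ennreal (sqrt (2 * pi)))
     = ennreal (sqrt (4 * pi * exp 2) + sqrt (2 * pi * L) + sqrt (2 * pi))"
    using L by (simp add: ennreal_plus[symmetric] del: ennreal_plus)
  finally show ?thesis using L by (subst (asm) ennreal_le_iff) auto
qed

text \<open>
  With \<open>L\<close> chosen such that \<open>exp ((1+\<gamma>) L) = max 1 M\<close> the exponential is bounded by a multiple
  of \<open>1 + M\<close>; the choice of \<open>\<gamma>\<close> and \<open>\<epsilon>\<close> makes \<open>\<beta> (1+\<epsilon>) = 2 pi (1+\<gamma>)\<close>.
\<close>

lemma subcritical_integral:
  assumes \<beta>: "0 < \<beta>" "\<beta> < 4 * pi"
    and D: "(\<integral>\<^sup>+x\<in>strip. ennreal (P x) \<partial>lborel) \<le> 1"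
    and D2: "(\<integral>\<^sup>+x\<in>strip. ennreal ((W x)\<^sup>2) \<partial>lborel) \<le> 2"
    and pq: "p \<le> q"
    and \<gamma>_def: "\<gamma> = \<beta> / (4 * pi)" and \<epsilon>_def: "\<epsilon> = 2 * pi * (1 + \<gamma>) / \<beta> - 1"
    and K_def: "K = (sqrt (4 * pi * exp 2) + sqrt (2 * pi)) / (2 * pi)"
  shows "(\<integral>\<^sup>+x\<in>{p..q} \<times> {0..2 * pi}. ennreal (exp (\<beta> * (W x)\<^sup>2)) \<partial>lborel)
    \<le> ennreal (exp (\<beta> * (1 + 1 / \<epsilon>) * K\<^sup>2) * (2 * pi / (1 - \<gamma>)) * (q - p + 1))"
proof -
  have \<gamma>: "0 < \<gamma>" "\<gamma> < 1" using \<beta> by (auto simp: \<gamma>_def)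
  \<comment> \<open>Since 2 pi (1 + \<gamma>) = 2 pi + \<beta> / 2, positivity of \<epsilon> is
    exactly the subcriticality \<beta> < 4 pi.\<close>
  have "\<epsilon> = (2 * pi - \<beta> / 2) / \<beta>" using \<beta> by (simp add: \<epsilon>_def \<gamma>_def field_simps)
  then have \<epsilon>: "0 < \<epsilon>" using \<beta> by simp
  have \<beta>\<epsilon>: "\<beta> * (1 + \<epsilon>) = 2 * pi * (1 + \<gamma>)" using \<beta> by (simp add: \<epsilon>_def)
  let ?C = "exp (\<beta> * (1 + 1 / \<epsilon>) * K\<^sup>2)"
  have box[measurable]: "{p..q} \<times> {0..2 * pi} \<in> sets borel" by (intro borel_Times) auto
  have pointwise: "ennreal (exp (\<beta> * (W x)\<^sup>2)) \<le> ennreal ?C * (1 + M \<gamma> x)" if x: "snd x \<in> {0..2 * pi}" for x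
  proof (cases "M \<gamma> x")
    case top
    then show ?thesis by (simp add: ennreal_mult_top)
  next
    case (real m)
    define L where "L = ln (max 1 m) / (1 + \<gamma>)"
    have expL: "exp ((1 + \<gamma>) * L) = max 1 m" using \<gamma> by (simp add: L_def)
    have L: "0 \<le> L" using \<gamma> by (simp add: L_def)
    have "2 * pi * \<bar>W x\<bar> \<le> sqrt (4 * pi * exp 2) + sqrt (2 * pi * L) + sqrt (2 * pi)"
      using x \<gamma> L D D2 real expL by (intro W_pointwise[of x \<gamma> L]) (auto intro: ennreal_leI)
    then have W1: "\<bar>W x\<bar> \<le> K + sqrt (2 * pi * L) / (2 * pi)"
      by (simp add: K_def field_simps)
    define l where "l = sqrt (2 * pi * L) / (2 * pi)"
    have l2: "l\<^sup>2 = L / (2 * pi)" using L by (simp add: l_def power_divide power2_eq_square)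
    have "0 \<le> K" "0 \<le> l" using L by (auto simp: K_def l_def)
    have "(W x)\<^sup>2 \<le> (K + l)\<^sup>2"
      using W1 unfolding l_def[symmetric] by (metis abs_ge_zero power2_abs power_mono)
    \<comment> \<open>The bounded part K may be weighted badly, as it only contributes a constant
      factor. The weight 1 + \<epsilon> on l^2 makes the exponent (1 + \<gamma>) L, the logarithm of
      max 1 m.\<close>
    also have "\<dots> \<le> (1 + 1 / \<epsilon>) * K\<^sup>2 + (1 + \<epsilon>) * l\<^sup>2"
    proof -
      have "0 \<le> (K - \<epsilon> * l)\<^sup>2 / \<epsilon>" using \<epsilon> by simp
      also have "\<dots> = K\<^sup>2 / \<epsilon> - 2 * K * l + \<epsilon> * l\<^sup>2" using \<epsilon> by (simp add: power2_eq_square field_simps)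
      finally show ?thesis by (simp add: power2_eq_square algebra_simps)
    qed
    finally have "\<beta> * (W x)\<^sup>2 \<le> \<beta> * ((1 + 1 / \<epsilon>) * K\<^sup>2 + (1 + \<epsilon>) * l\<^sup>2)"
      using \<beta> by (intro mult_left_mono) auto
    also have "\<dots> = \<beta> * (1 + 1 / \<epsilon>) * K\<^sup>2 + \<beta> * (1 + \<epsilon>) * l\<^sup>2"
      by (subst distrib_left) (simp only: mult.assoc)
    also have "\<beta> * (1 + \<epsilon>) * l\<^sup>2 = (1 + \<gamma>) * L" unfolding \<beta>\<epsilon> l2 by simp
    finally have "exp (\<beta> * (W x)\<^sup>2) \<le> ?C * max 1 m"
      by (simp add: expL[symmetric] flip: exp_add)
    also have "\<dots> \<le> ?C * (1 + m)" using real by (intro mult_left_mono) auto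
    finally show ?thesis using real by (simp add: ennreal_mult[symmetric] ennreal_plus[symmetric] del: ennreal_plus flip: ennreal_1)
  qed
  have "(\<integral>\<^sup>+x\<in>{p..q} \<times> {0..2 * pi}. ennreal (exp (\<beta> * (W x)\<^sup>2)) \<partial>lborel)
    \<le> (\<integral>\<^sup>+x. ennreal ?C * (indicator ({p..q} \<times> {0..2 * pi}) x + M \<gamma> x * indicator strip x) \<partial>lborel)"
    using pointwise by (intro nn_integral_mono) (auto simp: distrib_left split: split_indicator)
  also have "\<dots> = ennreal ?C * ((\<integral>\<^sup>+x. indicator ({p..q} \<times> {0..2 * pi}) x \<partial>lborel) + (\<integral>\<^sup>+x\<in>strip. M \<gamma> x \<partial>lborel))"
    by (subst nn_integral_cmult, measurable, subst nn_integral_add) auto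
  also have "\<dots> \<le> ennreal ?C * (ennreal ((q - p) * (2 * pi)) + ennreal (2 * pi / (1 - \<gamma>)))"
  proof (intro mult_left_mono add_mono)
    show "(\<integral>\<^sup>+x. indicator ({p..q} \<times> {0..2 * pi}) x \<partial>lborel) \<le> ennreal ((q - p) * (2 * pi))"
      using nn_integral_Times[of "\<lambda>_. 1" "{p..q}" "{0..2*pi}"] pq by (simp add: ennreal_mult)
    have "(\<integral>\<^sup>+x\<in>strip. M \<gamma> x \<partial>lborel) \<le> (\<integral>\<^sup>+x\<in>strip. ennreal (P x) \<partial>lborel) * ennreal (2 * pi / (1 - \<gamma>))"
      by (rule M_integral) (use \<gamma> in auto)
    also have "\<dots> \<le> 1 * ennreal (2 * pi / (1 - \<gamma>))" using D by (intro mult_right_mono) auto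
    finally show "(\<integral>\<^sup>+x\<in>strip. M \<gamma> x \<partial>lborel) \<le> ennreal (2 * pi / (1 - \<gamma>))" by simp
  qed auto
  also have "\<dots> = ennreal (?C * ((q - p) * (2 * pi) + 2 * pi / (1 - \<gamma>)))"
    using \<gamma> pq by (simp add: ennreal_mult[symmetric] ennreal_plus[symmetric] del: ennreal_plus)
  also have "\<dots> \<le> ennreal (?C * ((2 * pi / (1 - \<gamma>)) * (q - p + 1)))"
  proof (intro ennreal_leI mult_left_mono)
    have "2 * pi \<le> 2 * pi / (1 - \<gamma>)" using \<gamma> by (simp add: field_simps)
    then have "(q - p) * (2 * pi) \<le> (q - p) * (2 * pi / (1 - \<gamma>))" using pq by (intro mult_left_mono) auto
    moreover have "Z * (q - p + 1) = (q - p) * Z + Z" for Z by (simp add: algebra_simps)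
    ultimately show "(q - p) * (2 * pi) + 2 * pi / (1 - \<gamma>) \<le> (2 * pi / (1 - \<gamma>)) * (q - p + 1)"
      by (simp only: add_right_mono)
  qed simp
  finally show ?thesis by (simp add: mult.assoc)
qed

end

section \<open>Wirtinger's inequality and the splitting of the energy\<close>

text \<open>
  Comparison with \<open>cos (c (x - a - pi/2))\<close>, which for \<open>c < 1\<close> is positive up to the end points. This
  avoids boundary limits; the optimal factor 1 in place of 2 is not needed since
  \<open>1 + 2 \<mu> > sqrt (1 + 4 \<mu>)\<close>.
\<close>

lemma dirichlet_half_period:
  fixes k k' :: "real \<Rightarrow> real"
  assumes k: "\<And>x. (k has_real_derivative k' x) (at x)" and k': "continuous_on UNIV k'"
    and zero: "k a = 0" "k (a + pi) = 0"
  shows "integral {a..a + pi} (\<lambda>x. (k x)\<^sup>2) \<le> 2 * integral {a..a + pi} (\<lambda>x. (k' x)\<^sup>2)"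
proof -
  define c :: real where "c = 1 / sqrt 2"
  have c: "0 < c" "c < 1" "c\<^sup>2 = 1 / 2" by (auto simp: c_def power_divide)
  \<comment> \<open>The logarithmic derivative of the comparison cosine; it solves the Riccati
    equation T' = - c^2 - T^2.\<close>
  define T where "T x = - c * tan (c * (x - a - pi / 2))" for x
  have kc: "continuous_on S k" for S
    using k by (meson DERIV_continuous continuous_at_imp_continuous_on)
  have kc': "continuous_on S k'" for S using k' by (rule continuous_on_subset) simp
  have cos: "cos (c * (x - a - pi / 2)) \<noteq> 0" if "x \<in> {a..a + pi}" for x
  proof -
    have "\<bar>x - a - pi / 2\<bar> \<le> pi / 2" using that by (auto simp: abs_if)
    then have "c * \<bar>x - a - pi / 2\<bar> \<le> c * (pi / 2)" using c by (intro mult_left_mono) auto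
    also have "\<dots> < pi / 2" using c by simp
    finally have "\<bar>c * (x - a - pi / 2)\<bar> < pi / 2" using c by (simp add: abs_mult)
    then have "- (pi / 2) < c * (x - a - pi / 2)" "c * (x - a - pi / 2) < pi / 2" by linarith+
    then show ?thesis using cos_gt_zero_pi[of "c * (x - a - pi / 2)"] by auto
  qed
  have T: "(T has_real_derivative - c\<^sup>2 - (T x)\<^sup>2) (at x within S)" if "x \<in> {a..a + pi}" for x S
  proof -
    let ?y = "c * (x - a - pi / 2)"
    have "((\<lambda>x. - c * tan (c * (x - a - pi / 2))) has_real_derivative - c * (c * inverse ((cos ?y)\<^sup>2))) (at x within S)"
      using cos[OF that] by (auto intro!: derivative_eq_intros simp: power_inverse)
    moreover have "inverse ((cos ?y)\<^sup>2) = 1 + (tan ?y)\<^sup>2"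
      using tan_sec[OF cos[OF that]] by (simp add: power_inverse)
    then have "- c * (c * inverse ((cos ?y)\<^sup>2)) = - c\<^sup>2 - (T x)\<^sup>2"
      unfolding T_def by (simp only:) (simp add: power2_eq_square algebra_simps)
    ultimately show ?thesis unfolding T_def by simp
  qed
  have "((\<lambda>x. 2 * k x * k' x * T x + (k x)\<^sup>2 * (- c\<^sup>2 - (T x)\<^sup>2)) has_integral (k (a + pi))\<^sup>2 * T (a + pi) - (k a)\<^sup>2 * T a) {a..a + pi}"
    by (rule fundamental_theorem_of_calculus)
       (auto intro!: derivative_eq_intros T DERIV_subset[OF k] simp: has_real_derivative_iff_has_vector_derivative[symmetric])
  then have T0: "((\<lambda>x. 2 * k x * k' x * T x + (k x)\<^sup>2 * (- c\<^sup>2 - (T x)\<^sup>2)) has_integral 0) {a..a + pi}"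
    by (simp add: zero)
  have i: "((\<lambda>x. (k' x)\<^sup>2) has_integral integral {a..a + pi} (\<lambda>x. (k' x)\<^sup>2)) {a..a + pi}"
    "((\<lambda>x. (k x)\<^sup>2) has_integral integral {a..a + pi} (\<lambda>x. (k x)\<^sup>2)) {a..a + pi}"
    by (intro integrable_integral integrable_continuous_real continuous_intros kc kc')+
  have "0 \<le> integral {a..a + pi} (\<lambda>x. (k' x)\<^sup>2) - c\<^sup>2 * integral {a..a + pi} (\<lambda>x. (k x)\<^sup>2) - 0"
  proof (rule has_integral_nonneg)
    show "((\<lambda>x. (k' x)\<^sup>2 - c\<^sup>2 * (k x)\<^sup>2 - (2 * k x * k' x * T x + (k x)\<^sup>2 * (- c\<^sup>2 - (T x)\<^sup>2))) has_integral
       integral {a..a + pi} (\<lambda>x. (k' x)\<^sup>2) - c\<^sup>2 * integral {a..a + pi} (\<lambda>x. (k x)\<^sup>2) - 0) {a..a + pi}"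
      by (intro has_integral_diff has_integral_mult_right i T0)
    fix x
    \<comment> \<open>Completing the square: subtracting (k^2 T)', which integrates to 0 as k
      vanishes at both ends, leaves (k' - k T)^2. The resulting constant is 1 / c^2 = 2.\<close>
    have "(k' x)\<^sup>2 - c\<^sup>2 * (k x)\<^sup>2 - (2 * k x * k' x * T x + (k x)\<^sup>2 * (- c\<^sup>2 - (T x)\<^sup>2)) = (k' x - k x * T x)\<^sup>2"
      by (simp add: power2_eq_square algebra_simps)
    then show "0 \<le> (k' x)\<^sup>2 - c\<^sup>2 * (k x)\<^sup>2 - (2 * k x * k' x * T x + (k x)\<^sup>2 * (- c\<^sup>2 - (T x)\<^sup>2))" by simp
  qed
  then show ?thesis by (simp add: c)
qed

lemma integral_period:
  fixes f :: "real \<Rightarrow> real"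
  assumes f: "continuous_on UNIV f" and per: "\<And>x. f (x + p) = f x" and p: "0 \<le> a" "a \<le> p"
  shows "integral {a..a + p} f = integral {0..p} f"
proof -
  have i: "f integrable_on {x..y}" for x y
    by (intro integrable_continuous_real continuous_on_subset[OF f]) auto
  have "integral {p..a + p} f = integral {0..a} (f \<circ> (+) p)"
    by (subst integral_shift_Icc_real) simp
  also have "f \<circ> (+) p = f" by (auto simp: fun_eq_iff per add.commute[of p])
  finally have "integral {p..a + p} f = integral {0..a} f" .
  then show ?thesis
    using Henstock_Kurzweil_Integration.integral_combine[of a p "a + p" f] Henstock_Kurzweil_Integration.integral_combine[of 0 a p f] p i by simp
qed

text \<open>
  By the intermediate value theorem \<open>f a = f (a + pi)\<close> for some \<open>a\<close>; subtracting this value makes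
  the previous lemma applicable on both half periods and only increases the left-hand side.
\<close>

lemma Wirtinger:
  fixes f f' :: "real \<Rightarrow> real"
  assumes f: "\<And>x. (f has_real_derivative f' x) (at x)" and f': "continuous_on UNIV f'"
    and per: "\<And>x. f (x + 2 * pi) = f x" "\<And>x. f' (x + 2 * pi) = f' x"
    and mean: "integral {0..2 * pi} f = 0"
  shows "integral {0..2 * pi} (\<lambda>x. (f x)\<^sup>2) \<le> 2 * integral {0..2 * pi} (\<lambda>x. (f' x)\<^sup>2)"
proof -
  have fc: "continuous_on S f" for S
    using f by (meson DERIV_continuous continuous_at_imp_continuous_on)
  have fc': "continuous_on S f'" for S using f' by (rule continuous_on_subset) simp
  obtain a where a: "0 \<le> a" "a \<le> pi" "f a = f (a + pi)"
  proof -
    let ?h = "\<lambda>x. f x - f (x + pi)"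
    have h: "continuous_on {0..pi} ?h"
      by (intro continuous_intros fc continuous_on_compose2[OF fc[of UNIV]]) auto
    have hpi: "?h pi = - ?h 0" using per(1)[of 0] by simp
    have "\<exists>x. 0 \<le> x \<and> x \<le> pi \<and> ?h x = 0"
    proof (cases "?h 0 \<le> 0")
      case True
      then show ?thesis using hpi h by (intro IVT'[of ?h]) auto
    next
      case False
      then show ?thesis using hpi h by (intro IVT2'[of ?h]) auto
    qed
    then show ?thesis using that by auto
  qed
  define \<kappa> where "\<kappa> = f a"
  define k where "k x = f x - \<kappa>" for x
  have k: "(k has_real_derivative f' x) (at x)" for x
    unfolding k_def by (auto intro!: derivative_eq_intros f)
  have kc: "continuous_on S k" for S unfolding k_def by (intro continuous_intros fc)
  have k0: "k a = 0" "k (a + pi) = 0" "k (a + pi + pi) = 0"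
    using a per(1)[of a] by (auto simp: k_def \<kappa>_def add.assoc)
  have comb: "integral {a..a + 2 * pi} h = integral {a..a + pi} h + integral {a + pi..a + pi + pi} h"
    if "continuous_on UNIV h" for h :: "real \<Rightarrow> real"
    using Henstock_Kurzweil_Integration.integral_combine[of a "a + pi" "a + pi + pi" h]
      integrable_continuous_real[OF continuous_on_subset[OF that], of a "a + pi + pi"] by (simp add: add.assoc)
  have shift: "integral {a..a + 2 * pi} h = integral {0..2 * pi} h"
    if "continuous_on UNIV h" "\<And>x. h (x + 2 * pi) = h x" for h :: "real \<Rightarrow> real"
    using a that by (intro integral_period) auto
  have "integral {0..2 * pi} (\<lambda>x. (k x)\<^sup>2) \<le> 2 * integral {0..2 * pi} (\<lambda>x. (f' x)\<^sup>2)"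
  proof -
    have "integral {0..2 * pi} (\<lambda>x. (k x)\<^sup>2) = integral {a..a + pi} (\<lambda>x. (k x)\<^sup>2) + integral {a + pi..a + pi + pi} (\<lambda>x. (k x)\<^sup>2)"
      by (subst shift[symmetric], goal_cases, intro continuous_intros kc, simp add: k_def per, intro comb continuous_intros kc)
    moreover have "integral {0..2 * pi} (\<lambda>x. (f' x)\<^sup>2) = integral {a..a + pi} (\<lambda>x. (f' x)\<^sup>2) + integral {a + pi..a + pi + pi} (\<lambda>x. (f' x)\<^sup>2)"
      by (subst shift[symmetric], goal_cases, intro continuous_intros fc', simp add: per, intro comb continuous_intros fc')
    ultimately show ?thesis
      using dirichlet_half_period[OF k f' k0(1,2)] dirichlet_half_period[OF k f' k0(2,3)] by simp
  qed
  moreover have "integral {0..2 * pi} (\<lambda>x. (k x)\<^sup>2) = integral {0..2 * pi} (\<lambda>x. (f x)\<^sup>2) + 2 * pi * \<kappa>\<^sup>2"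
  proof -
    have "((\<lambda>x. (f x)\<^sup>2 - 2 * \<kappa> * f x + \<kappa>\<^sup>2) has_integral integral {0..2 * pi} (\<lambda>x. (f x)\<^sup>2) - 2 * \<kappa> * 0 + (2 * pi - 0) * \<kappa>\<^sup>2) {0..2 * pi}"
      by (intro has_integral_add has_integral_diff has_integral_mult_right integrable_integral has_integral_const_real[THEN has_integral_eq_rhs]
          integrable_continuous_real continuous_intros fc mean[THEN subst[where P = "\<lambda>I. (f has_integral I) _"]]) auto
    moreover have "(\<lambda>x. (k x)\<^sup>2) = (\<lambda>x. (f x)\<^sup>2 - 2 * \<kappa> * f x + \<kappa>\<^sup>2)"
      by (auto simp: k_def power2_eq_square algebra_simps)
    ultimately show ?thesis by (simp add: integral_unique)
  qed
  ultimately show ?thesis by (smt (verit) mult_nonneg_nonneg pi_ge_zero zero_le_power2)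
qed

text \<open>The link between the measure-theoretic estimates on the strip and the gauge integrals in
  which the energy identities are computed; continuity and the bounded t-range give the
  integrability.\<close>

lemma nn_integral_strip:
  fixes f :: "real \<times> real \<Rightarrow> real"
  assumes f: "continuous_on UNIV f" and nonneg: "\<And>x. 0 \<le> f x"
    and zero: "\<And>t \<theta>. t \<notin> {1..b} \<Longrightarrow> f (t, \<theta>) = 0"
  shows "(\<integral>\<^sup>+x\<in>strip. ennreal (f x) \<partial>lborel) = ennreal (integral {1..b} (\<lambda>t. integral {0..2 * pi} (\<lambda>\<theta>. f (t, \<theta>))))"
proof -
  have [measurable]: "f \<in> borel_measurable borel" by (rule borel_measurable_continuous_onI[OF f])
  have fc: "continuous_on S (\<lambda>\<theta>. f (t, \<theta>))" for S t
    by (rule continuous_on_compose2[OF f]) (auto intro!: continuous_intros)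
  have "(\<integral>\<^sup>+x\<in>strip. ennreal (f x) \<partial>lborel) = (\<integral>\<^sup>+t. (\<integral>\<^sup>+\<theta>\<in>{0..2 * pi}. ennreal (f (t, \<theta>)) \<partial>lborel) \<partial>lborel)"
    by (subst nn_integral_lborel_fst) (auto intro!: nn_integral_cong split: split_indicator)
  also have "\<dots> = (\<integral>\<^sup>+t\<in>{1..b}. ennreal (integral {0..2 * pi} (\<lambda>\<theta>. f (t, \<theta>))) \<partial>lborel)"
  proof (rule nn_integral_cong)
    fix t
    have "(\<integral>\<^sup>+\<theta>\<in>{0..2 * pi}. ennreal (f (t, \<theta>)) \<partial>lborel) = ennreal (integral {0..2 * pi} (\<lambda>\<theta>. f (t, \<theta>)))"
      by (intro nn_integral_has_integral_lebesgue' nonneg integrable_integral integrable_continuous_real fc)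
    then show "(\<integral>\<^sup>+\<theta>\<in>{0..2 * pi}. ennreal (f (t, \<theta>)) \<partial>lborel) = ennreal (integral {0..2 * pi} (\<lambda>\<theta>. f (t, \<theta>))) * indicator {1..b} t"
      using zero by (auto split: split_indicator)
  qed
  also have "\<dots> = ennreal (integral {1..b} (\<lambda>t. integral {0..2 * pi} (\<lambda>\<theta>. f (t, \<theta>))))"
  proof (intro nn_integral_has_integral_lebesgue' integrable_integral integrable_continuous_real)
    show "continuous_on {1..b} (\<lambda>t. integral {0..2 * pi} (\<lambda>\<theta>. f (t, \<theta>)))"
      using integral_continuous_on_param[of "{1..b}" 0 "2 * pi" "\<lambda>t \<theta>. f (t, \<theta>)"]
      by (simp add: case_prod_eta continuous_on_subset[OF f])
    show "0 \<le> integral {0..2 * pi} (\<lambda>\<theta>. f (t, \<theta>))" for t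
      by (intro integral_nonneg integrable_continuous_real fc nonneg)
  qed
  finally show ?thesis .
qed

section \<open>Splitting a function on the cylinder into circular mean and remainder\<close>

context cylinder_fn begin

lemma scale: "cylinder_fn (\<lambda>x. k * W x) (\<lambda>x. k * Wt x) (\<lambda>x. k * Wh x) b"
proof (unfold_locales, goal_cases)
  case (2 x)
  show ?case by (rule has_derivative_eq_rhs[OF has_derivative_mult_right[OF W_deriv]]) (simp add: algebra_simps)
qed (auto simp: b_ge W_per Wt_per Wh_per W_zero Wt_zero Wh_zero intro!: continuous_intros Wt_cont Wh_cont)

definition U :: "real \<Rightarrow> real" where "U t = integral {0..2 * pi} (\<lambda>\<theta>. W (t, \<theta>)) / (2 * pi)"

definition U' :: "real \<Rightarrow> real" where "U' t = integral {0..2 * pi} (\<lambda>\<theta>. Wt (t, \<theta>)) / (2 * pi)"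

lemma slice_cont: "continuous_on UNIV f \<Longrightarrow> continuous_on S (\<lambda>\<theta>. f (t, \<theta>))" for f :: "real \<times> real \<Rightarrow> real"
  by (rule continuous_on_compose2) (auto intro!: continuous_intros)

lemma slice_integral_cont:
  "continuous_on UNIV f \<Longrightarrow> continuous_on S (\<lambda>t. integral {0..2 * pi} (\<lambda>\<theta>. f (t, \<theta>)))" for f :: "real \<times> real \<Rightarrow> real"
  using integral_continuous_on_param[of S 0 "2 * pi" "\<lambda>t \<theta>. f (t, \<theta>)"]
  by (simp add: case_prod_eta continuous_on_subset)

lemma U_deriv: "(U has_real_derivative U' t) (at t)"
proof -
  have "((\<lambda>t. integral (cbox 0 (2 * pi)) (\<lambda>\<theta>. W (t, \<theta>))) has_field_derivative integral (cbox 0 (2 * pi)) (\<lambda>\<theta>. Wt (t, \<theta>))) (at t within UNIV)"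
  proof (rule leibniz_rule_field_derivative)
    show "((\<lambda>x. W (x, \<theta>)) has_real_derivative Wt (x, \<theta>)) (at x within UNIV)" for x \<theta>
    proof -
      have "((\<lambda>x. (x, \<theta>)) has_derivative (\<lambda>h. (h, 0))) (at x)" by (auto intro!: derivative_eq_intros)
      from has_derivative_compose[OF this W_deriv] show ?thesis
        unfolding has_field_derivative_def by (rule has_derivative_eq_rhs) auto
    qed
    show "(\<lambda>\<theta>. W (x, \<theta>)) integrable_on cbox 0 (2 * pi)" for x
      by (intro integrable_continuous slice_cont W_cont)
  qed (auto simp: case_prod_eta intro: continuous_on_subset[OF Wt_cont])
  then show ?thesis unfolding U_def U'_def by (auto intro!: derivative_eq_intros)
qed

lemma U'_cont: "continuous_on S U'"
  unfolding U'_def by (intro continuous_intros slice_integral_cont Wt_cont) auto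

lemma U_cont: "continuous_on S U"
  unfolding U_def by (intro continuous_intros slice_integral_cont W_cont) auto

lemma U_zero: "t \<le> 1 \<or> b \<le> t \<Longrightarrow> U t = 0" "t \<le> 1 \<or> b \<le> t \<Longrightarrow> U' t = 0"
  by (auto simp: U_def U'_def W_zero Wt_zero)

definition g :: "real \<times> real \<Rightarrow> real" where "g x = W x - U (fst x)"

definition gt :: "real \<times> real \<Rightarrow> real" where "gt x = Wt x - U' (fst x)"

lemma g_cylinder: "cylinder_fn g gt Wh b"
proof (unfold_locales, goal_cases)
  case (2 x)
  have "((\<lambda>x. U (fst x)) has_derivative (\<lambda>h. U' (fst x) * fst h)) (at x)"
    using has_derivative_compose[OF has_derivative_fst[OF has_derivative_ident] U_deriv[of "fst x", unfolded has_field_derivative_def]]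
    by simp
  from has_derivative_diff[OF W_deriv this] show ?case
    unfolding g_def gt_def by (rule has_derivative_eq_rhs) (simp add: algebra_simps)
next
  case 3
  show ?case unfolding gt_def
    by (intro continuous_intros Wt_cont continuous_on_compose2[OF U'_cont[of UNIV]]) auto
qed (auto simp: b_ge g_def gt_def W_per Wt_per Wh_per W_zero Wt_zero Wh_zero U_zero intro!: continuous_intros Wt_cont Wh_cont)

lemma slice_means:
  "integral {0..2 * pi} (\<lambda>\<theta>. g (t, \<theta>)) = 0" "integral {0..2 * pi} (\<lambda>\<theta>. gt (t, \<theta>)) = 0"
  unfolding g_def gt_def
  by (subst integral_diff; auto intro!: integrable_continuous_real slice_cont W_cont Wt_cont simp: U_def U'_def)+

text \<open>On a circle, constants are orthogonal to functions of mean zero.\<close>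

lemma slice_split:
  fixes f :: "real \<times> real \<Rightarrow> real"
  assumes f: "continuous_on UNIV f" and mean: "integral {0..2 * pi} (\<lambda>\<theta>. f (t, \<theta>) - k) = 0"
  shows "integral {0..2 * pi} (\<lambda>\<theta>. (f (t, \<theta>))\<^sup>2) = 2 * pi * k\<^sup>2 + integral {0..2 * pi} (\<lambda>\<theta>. (f (t, \<theta>) - k)\<^sup>2)"
proof -
  have "((\<lambda>\<theta>. k\<^sup>2 + 2 * k * (f (t, \<theta>) - k) + (f (t, \<theta>) - k)\<^sup>2) has_integral
      (2 * pi - 0) * k\<^sup>2 + 2 * k * integral {0..2 * pi} (\<lambda>\<theta>. f (t, \<theta>) - k) + integral {0..2 * pi} (\<lambda>\<theta>. (f (t, \<theta>) - k)\<^sup>2)) {0..2 * pi}"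
    by (intro has_integral_add has_integral_mult_right integrable_integral integrable_continuous_real
        continuous_intros slice_cont f has_integral_const_real[THEN has_integral_eq_rhs]) auto
  moreover have "(\<lambda>\<theta>. (f (t, \<theta>))\<^sup>2) = (\<lambda>\<theta>. k\<^sup>2 + 2 * k * (f (t, \<theta>) - k) + (f (t, \<theta>) - k)\<^sup>2)"
    by (auto simp: power2_eq_square algebra_simps)
  ultimately show ?thesis using mean by (simp add: integral_unique)
qed

text \<open>The remainder has mean zero on each circle, and subtracting the mean does not affect the
  \<theta>-derivative, so \<open>Wh\<close> also serves for g.\<close>

lemma slice_Wirtinger:
  "integral {0..2 * pi} (\<lambda>\<theta>. (g (t, \<theta>))\<^sup>2) \<le> 2 * integral {0..2 * pi} (\<lambda>\<theta>. (Wh (t, \<theta>))\<^sup>2)"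
proof (rule Wirtinger)
  interpret G: cylinder_fn g gt Wh b by (rule g_cylinder)
  show "((\<lambda>\<theta>. g (t, \<theta>)) has_real_derivative Wh (t, \<theta>)) (at \<theta>)" for \<theta>
  proof -
    have "((\<lambda>\<theta>. (t, \<theta>)) has_derivative (\<lambda>h. (0, h))) (at \<theta>)" by (auto intro!: derivative_eq_intros)
    from has_derivative_compose[OF this G.W_deriv] show ?thesis
      unfolding has_field_derivative_def by (rule has_derivative_eq_rhs) auto
  qed
  show "g (t, \<theta> + 2 * pi) = g (t, \<theta>)" for \<theta> by (rule G.W_per)
qed (auto simp: slice_means Wh_per intro: slice_cont Wh_cont)

text \<open>The pull-back of the energy on the ball: the Dirichlet integral is conformally
  invariant, and the Jacobian |x|^2 turns V(|x|) into 1 / t^2.\<close>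

definition energy :: "real \<Rightarrow> real" where
  "energy \<mu> = integral {1..b} (\<lambda>t. integral {0..2 * pi} (\<lambda>\<theta>. (Wt (t, \<theta>))\<^sup>2 + (Wh (t, \<theta>))\<^sup>2 + \<mu> * (W (t, \<theta>))\<^sup>2 / t\<^sup>2))"

definition dirichlet :: real where
  "dirichlet = integral {1..b} (\<lambda>t. integral {0..2 * pi} (\<lambda>\<theta>. P (t, \<theta>)))"

lemma slice_energy:
  "integral {0..2 * pi} (\<lambda>\<theta>. (Wt (t, \<theta>))\<^sup>2 + (Wh (t, \<theta>))\<^sup>2 + \<mu> * (W (t, \<theta>))\<^sup>2 / t\<^sup>2) =
    integral {0..2 * pi} (\<lambda>\<theta>. (Wt (t, \<theta>))\<^sup>2) + integral {0..2 * pi} (\<lambda>\<theta>. (Wh (t, \<theta>))\<^sup>2)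
     + \<mu> / t\<^sup>2 * integral {0..2 * pi} (\<lambda>\<theta>. (W (t, \<theta>))\<^sup>2)"
proof -
  have "((\<lambda>\<theta>. (Wt (t, \<theta>))\<^sup>2 + (Wh (t, \<theta>))\<^sup>2 + \<mu> / t\<^sup>2 * (W (t, \<theta>))\<^sup>2) has_integral
    integral {0..2 * pi} (\<lambda>\<theta>. (Wt (t, \<theta>))\<^sup>2) + integral {0..2 * pi} (\<lambda>\<theta>. (Wh (t, \<theta>))\<^sup>2)
     + \<mu> / t\<^sup>2 * integral {0..2 * pi} (\<lambda>\<theta>. (W (t, \<theta>))\<^sup>2)) {0..2 * pi}"
    by (intro has_integral_add has_integral_mult_right integrable_integral integrable_continuous_real
        continuous_intros slice_cont W_cont Wt_cont Wh_cont)
  then show ?thesis by (simp add: integral_unique)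
qed

lemma energy_slices:
  "energy \<mu> = integral {1..b} (\<lambda>t. integral {0..2 * pi} (\<lambda>\<theta>. (Wt (t, \<theta>))\<^sup>2) + integral {0..2 * pi} (\<lambda>\<theta>. (Wh (t, \<theta>))\<^sup>2)
     + \<mu> / t\<^sup>2 * integral {0..2 * pi} (\<lambda>\<theta>. (W (t, \<theta>))\<^sup>2))"
  unfolding energy_def slice_energy ..

lemma square_slice_cont: "continuous_on UNIV f \<Longrightarrow> continuous_on S (\<lambda>t. integral {0..2 * pi} (\<lambda>\<theta>. (f (t, \<theta>))\<^sup>2))"
  for f :: "real \<times> real \<Rightarrow> real"
  by (rule slice_integral_cont) (intro continuous_intros)

text \<open>The two integrands differ by the derivative of \<open>c U\<^sup>2 / t\<close>.\<close>

lemma radial_energy: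
  assumes "\<mu> = c\<^sup>2 - c"
  shows "integral {1..b} (\<lambda>t. (U' t)\<^sup>2 + \<mu> / t\<^sup>2 * (U t)\<^sup>2) = integral {1..b} (\<lambda>t. (U' t - c * U t / t)\<^sup>2)"
proof -
  have "((\<lambda>t. 2 * c * U t * U' t / t - c * (U t)\<^sup>2 / t\<^sup>2) has_integral c * (U b)\<^sup>2 / b - c * (U 1)\<^sup>2 / 1) {1..b}"
  proof (rule fundamental_theorem_of_calculus[OF b_ge])
    fix t assume "t \<in> {1..b}"
    then show "((\<lambda>t. c * (U t)\<^sup>2 / t) has_vector_derivative 2 * c * U t * U' t / t - c * (U t)\<^sup>2 / t\<^sup>2) (at t within {1..b})"
      unfolding has_real_derivative_iff_has_vector_derivative[symmetric]
      by (auto intro!: derivative_eq_intros DERIV_subset[OF U_deriv] simp: field_simps power2_eq_square)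
  qed
  then have "((\<lambda>t. 2 * c * U t * U' t / t - c * (U t)\<^sup>2 / t\<^sup>2) has_integral 0) {1..b}" by (simp add: U_zero)
  moreover have "((\<lambda>t. (U' t - c * U t / t)\<^sup>2) has_integral integral {1..b} (\<lambda>t. (U' t - c * U t / t)\<^sup>2)) {1..b}"
    by (intro integrable_integral integrable_continuous_real continuous_intros U_cont U'_cont) auto
  ultimately have "((\<lambda>t. (U' t - c * U t / t)\<^sup>2 + (2 * c * U t * U' t / t - c * (U t)\<^sup>2 / t\<^sup>2)) has_integral
     integral {1..b} (\<lambda>t. (U' t - c * U t / t)\<^sup>2) + 0) {1..b}" by (intro has_integral_add)
  moreover have "(U' t - c * U t / t)\<^sup>2 + (2 * c * U t * U' t / t - c * (U t)\<^sup>2 / t\<^sup>2) = (U' t)\<^sup>2 + \<mu> / t\<^sup>2 * (U t)\<^sup>2" for t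
    by (cases "t = 0") (auto simp: assms field_simps power2_eq_square)
  ultimately show ?thesis by (simp add: integral_unique)
qed

text \<open>The cross terms vanish on every circle because g and gt have mean zero, and the
  potential depends on t only. The mean part is then rewritten as a perfect square with c, a root of
  c^2 - c = \<mu>.\<close>

lemma energy_split:
  assumes "\<mu> = c\<^sup>2 - c"
  shows "energy \<mu> = 2 * pi * integral {1..b} (\<lambda>t. (U' t - c * U t / t)\<^sup>2) + cylinder_fn.energy g gt Wh b \<mu>"
proof -
  interpret G: cylinder_fn g gt Wh b by (rule g_cylinder)
  note cont = G.square_slice_cont G.W_cont G.Wt_cont G.Wh_cont U_cont U'_cont
  have W2: "integral {0..2 * pi} (\<lambda>\<theta>. (W (t, \<theta>))\<^sup>2) = 2 * pi * (U t)\<^sup>2 + integral {0..2 * pi} (\<lambda>\<theta>. (g (t, \<theta>))\<^sup>2)" for t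
    using slice_split[OF W_cont, of t "U t"] slice_means(1)[of t] by (simp add: g_def)
  have Wt2: "integral {0..2 * pi} (\<lambda>\<theta>. (Wt (t, \<theta>))\<^sup>2) = 2 * pi * (U' t)\<^sup>2 + integral {0..2 * pi} (\<lambda>\<theta>. (gt (t, \<theta>))\<^sup>2)" for t
    using slice_split[OF Wt_cont, of t "U' t"] slice_means(2)[of t] by (simp add: gt_def)
  have "energy \<mu> = integral {1..b} (\<lambda>t. 2 * pi * ((U' t)\<^sup>2 + \<mu> / t\<^sup>2 * (U t)\<^sup>2) + 
     (integral {0..2 * pi} (\<lambda>\<theta>. (gt (t, \<theta>))\<^sup>2) + integral {0..2 * pi} (\<lambda>\<theta>. (Wh (t, \<theta>))\<^sup>2)
     + \<mu> / t\<^sup>2 * integral {0..2 * pi} (\<lambda>\<theta>. (g (t, \<theta>))\<^sup>2)))"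
    unfolding energy_slices W2 Wt2 by (simp add: algebra_simps add_divide_distrib)
  also have "\<dots> = 2 * pi * integral {1..b} (\<lambda>t. (U' t)\<^sup>2 + \<mu> / t\<^sup>2 * (U t)\<^sup>2) + G.energy \<mu>"
    unfolding G.energy_slices
    by (subst integral_add) (auto intro!: integrable_continuous_real continuous_intros cont)
  finally show ?thesis unfolding radial_energy[OF assms] .
qed

text \<open>As t \<ge> 1 and \<mu> < 0, the potential is at least \<mu> g^2, and Wirtinger charges
  it entirely to the angular derivative with factor 2. The t-derivative is weakened by the same
  factor so that a multiple of the whole Dirichlet integral results.\<close>

lemma energy_g_ge:
  assumes "\<mu> < 0"
  shows "(1 + 2 * \<mu>) * cylinder_fn.dirichlet gt Wh b \<le> cylinder_fn.energy g gt Wh b \<mu>"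
proof -
  interpret G: cylinder_fn g gt Wh b by (rule g_cylinder)
  note cont = G.square_slice_cont G.W_cont G.Wt_cont G.Wh_cont
  have D: "integral {0..2 * pi} (\<lambda>\<theta>. G.P (t, \<theta>)) = integral {0..2 * pi} (\<lambda>\<theta>. (gt (t, \<theta>))\<^sup>2) + integral {0..2 * pi} (\<lambda>\<theta>. (Wh (t, \<theta>))\<^sup>2)" for t
    unfolding G.P_def by (intro integral_add integrable_continuous_real continuous_intros slice_cont G.Wt_cont G.Wh_cont)
  have "(1 + 2 * \<mu>) * G.dirichlet = integral {1..b} (\<lambda>t. (1 + 2 * \<mu>) * (integral {0..2 * pi} (\<lambda>\<theta>. (gt (t, \<theta>))\<^sup>2) + integral {0..2 * pi} (\<lambda>\<theta>. (Wh (t, \<theta>))\<^sup>2)))"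
    unfolding G.dirichlet_def D by simp
  also have "\<dots> \<le> G.energy \<mu>"
    unfolding G.energy_slices
  proof (rule integral_le)
    fix t assume "t \<in> {1..b}"
    then have t: "1 \<le> t\<^sup>2" by simp
    let ?a = "integral {0..2 * pi} (\<lambda>\<theta>. (gt (t, \<theta>))\<^sup>2)" and ?h = "integral {0..2 * pi} (\<lambda>\<theta>. (Wh (t, \<theta>))\<^sup>2)"
    have pos: "0 \<le> ?a" "0 \<le> ?h"
      by (intro integral_nonneg integrable_continuous_real continuous_intros slice_cont G.Wt_cont G.Wh_cont; simp)+
    have "\<mu> \<le> \<mu> / t\<^sup>2"
      using mult_left_mono_neg[OF t, of \<mu>] assms order.strict_trans2[OF zero_less_one t] by (simp add: pos_le_divide_eq)
    then have "\<mu> * (2 * ?h) \<le> \<mu> / t\<^sup>2 * (2 * ?h)"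
      using pos by (intro mult_right_mono) auto
    also have "\<dots> \<le> \<mu> / t\<^sup>2 * integral {0..2 * pi} (\<lambda>\<theta>. (g (t, \<theta>))\<^sup>2)"
      using assms slice_Wirtinger[of t] by (intro mult_left_mono_neg) (auto simp: divide_le_0_iff)
    finally have "2 * \<mu> * ?h \<le> \<mu> / t\<^sup>2 * integral {0..2 * pi} (\<lambda>\<theta>. (g (t, \<theta>))\<^sup>2)" by simp
    moreover have "2 * \<mu> * ?a \<le> 0" using assms pos by (simp add: mult_nonpos_nonneg)
    ultimately show "(1 + 2 * \<mu>) * (?a + ?h) \<le> ?a + ?h + \<mu> / t\<^sup>2 * integral {0..2 * pi} (\<lambda>\<theta>. (g (t, \<theta>))\<^sup>2)"
      by (simp add: distrib_left distrib_right)
  qed (auto intro!: integrable_continuous_real continuous_intros cont)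
  finally show ?thesis .
qed

lemma dirichlet_nonneg: "0 \<le> dirichlet"
  unfolding dirichlet_def
  by (intro integral_nonneg integrable_continuous_real slice_integral_cont slice_cont P_cont P_nonneg)

text \<open>The mean contributes the integral of a square, the remainder at least (1 + 2 \<mu>)
  times its Dirichlet integral. This takes the place of the logarithmic Hardy inequality.\<close>

lemma energy_nonneg:
  assumes "-1/4 < \<mu>" "\<mu> < 0"
  shows "0 \<le> energy \<mu>"
proof -
  interpret G: cylinder_fn g gt Wh b by (rule g_cylinder)
  define c where "c = (1 - sqrt (1 + 4 * \<mu>)) / 2"
  have "\<mu> = c\<^sup>2 - c" using assms by (simp add: c_def power2_eq_square field_simps)
  note energy_split[OF this]
  moreover have "0 \<le> integral {1..b} (\<lambda>t. (U' t - c * U t / t)\<^sup>2)"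
    by (intro integral_nonneg integrable_continuous_real continuous_intros U_cont U'_cont) auto
  moreover have "0 \<le> (1 + 2 * \<mu>) * G.dirichlet" using G.dirichlet_nonneg assms by simp
  ultimately show ?thesis using energy_g_ge[OF assms(2)] by simp
qed

lemma dirichlet_scale: "cylinder_fn.dirichlet (\<lambda>x. k * Wt x) (\<lambda>x. k * Wh x) b = k\<^sup>2 * dirichlet"
proof -
  interpret K: cylinder_fn "\<lambda>x. k * W x" "\<lambda>x. k * Wt x" "\<lambda>x. k * Wh x" b by (rule scale)
  show ?thesis by (simp add: K.dirichlet_def dirichlet_def K.P_def P_def power_mult_distrib flip: distrib_left)
qed

lemma nn_integral_P: "(\<integral>\<^sup>+x\<in>strip. ennreal (P x) \<partial>lborel) = ennreal dirichlet"
  unfolding dirichlet_def by (intro nn_integral_strip P_cont P_nonneg) (auto simp: P_def Wt_zero Wh_zero)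

text \<open>Wirtinger once more. The factor 2 is where the bound 2 on the integral of W^2 in
  \<open>W_pointwise\<close> comes from.\<close>

lemma nn_integral_g2: "(\<integral>\<^sup>+x\<in>strip. ennreal ((g x)\<^sup>2) \<partial>lborel) \<le> ennreal (2 * cylinder_fn.dirichlet gt Wh b)"
proof -
  interpret G: cylinder_fn g gt Wh b by (rule g_cylinder)
  have "(\<integral>\<^sup>+x\<in>strip. ennreal ((g x)\<^sup>2) \<partial>lborel) = ennreal (integral {1..b} (\<lambda>t. integral {0..2 * pi} (\<lambda>\<theta>. (g (t, \<theta>))\<^sup>2)))"
    by (intro nn_integral_strip continuous_intros G.W_cont) (auto simp: G.W_zero)
  also have "integral {1..b} (\<lambda>t. integral {0..2 * pi} (\<lambda>\<theta>. (g (t, \<theta>))\<^sup>2)) \<le> integral {1..b} (\<lambda>t. 2 * integral {0..2 * pi} (\<lambda>\<theta>. G.P (t, \<theta>)))"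
  proof (rule integral_le)
    fix t
    have "integral {0..2 * pi} (\<lambda>\<theta>. (Wh (t, \<theta>))\<^sup>2) \<le> integral {0..2 * pi} (\<lambda>\<theta>. G.P (t, \<theta>))"
      by (intro integral_le integrable_continuous_real slice_cont continuous_intros Wh_cont G.P_cont) (simp add: G.P_def)
    then show "integral {0..2 * pi} (\<lambda>\<theta>. (g (t, \<theta>))\<^sup>2) \<le> 2 * integral {0..2 * pi} (\<lambda>\<theta>. G.P (t, \<theta>))"
      using slice_Wirtinger[of t] by simp
  qed (auto intro!: integrable_continuous_real continuous_intros G.slice_integral_cont G.W_cont G.P_cont)
  finally show ?thesis by (simp add: G.dirichlet_def ennreal_leI)
qed

end

section \<open>The Moser-Trudinger inequality on the cylinder\<close>

text \<open>The product of three bounds: the window constant of \<open>subcritical_integral\<close>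
  for \<beta> = 4 pi s / (1 + 2 \<mu>), the length factor of the near-critical set, and the sum of
  (j + 1) exp (-j).\<close>

definition MT_const :: "real \<Rightarrow> real" where
  "MT_const \<mu> = (let s = sqrt (1 + 4 * \<mu>); \<beta> = 4 * pi * s / (1 + 2 * \<mu>); \<gamma> = \<beta> / (4 * pi);
     \<epsilon> = 2 * pi * (1 + \<gamma>) / \<beta> - 1; K = (sqrt (4 * pi * exp 2) + sqrt (2 * pi)) / (2 * pi)
    in exp (\<beta> * (1 + 1 / \<epsilon>) * K\<^sup>2) * (2 * pi / (1 - \<gamma>)) * (2 + 2 * (10 / s * 11 powr ((1 - s) / s))) * (1 / (1 - exp (- 1))\<^sup>2))"

text \<open>With a^2 = 1 / (1 - d) and k^2 = (1 + 2 \<mu>) / d, the mean a U has energy at most 1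
  and the remainder k g has Dirichlet integral at most 1. Written in terms of k g, the exponent 4 pi
  s / d becomes 4 pi s / (1 + 2 \<mu>), which is below 4 pi: the gain from Wirtinger pays for the
  remainder.\<close>

lemma (in cylinder_fn) Moser_Trudinger:
  assumes \<mu>: "-1/4 < \<mu>" "\<mu> < 0" and E: "energy \<mu> < 1"
  shows "(\<integral>\<^sup>+t\<in>{1..}. (\<integral>\<^sup>+\<theta>\<in>{0..2 * pi}. ennreal (exp (4 * pi * sqrt (1 + 4 * \<mu>) * (W (t, \<theta>))\<^sup>2 - 2 * t)) \<partial>lborel) \<partial>lborel)
    \<le> ennreal (MT_const \<mu>)"
proof -
  interpret G: cylinder_fn g gt Wh b by (rule g_cylinder)
  define s where "s = sqrt (1 + 4 * \<mu>)"
  define c where "c = (1 - s) / 2"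
  have s: "0 < s" "s < 1" and s2: "s\<^sup>2 = 1 + 4 * \<mu>" using \<mu> by (auto simp: s_def)
  have c: "\<mu> = c\<^sup>2 - c" using s2 by (simp add: c_def power2_eq_square field_simps)
  define \<kappa> where "\<kappa> = 1 + 2 * \<mu>"
  have \<kappa>: "0 < \<kappa>" "s < \<kappa>"
  proof -
    show "0 < \<kappa>" using \<mu> by (simp add: \<kappa>_def)
    \<comment> \<open>\<kappa> - s = (1 - s)^2 / 2, because \<kappa> = (1 + s^2) / 2.\<close>
    have "0 < (1 - s)\<^sup>2" using s by simp
    then show "s < \<kappa>" using s2 by (simp add: \<kappa>_def power2_eq_square algebra_simps)
  qed
  let ?F2 = "\<lambda>t. (U' t - c * U t / t)\<^sup>2"
  have F2i: "?F2 integrable_on {1..B}" for B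
    by (intro integrable_continuous_real continuous_intros U_cont U'_cont) auto
  define EU where "EU = 2 * pi * integral {1..b} ?F2"
  define Eg where "Eg = G.energy \<mu>"
  have EU: "0 \<le> EU" unfolding EU_def using integral_nonneg[OF F2i, of b] by simp
  have Dg: "\<kappa> * G.dirichlet \<le> Eg" using energy_g_ge[OF \<mu>(2)] by (simp add: \<kappa>_def Eg_def)
  have Eg: "0 \<le> Eg" using G.energy_nonneg[OF \<mu>] by (simp add: Eg_def)
  have sum: "EU + Eg < 1" using E energy_split[OF c] by (simp add: EU_def Eg_def)
  \<comment> \<open>The strict inequality in \<open>sum\<close> leaves room for \<open>0 < d < 1\<close>, so that both parts can be normalised.\<close>
  define d where "d = (Eg + 1 - EU) / 2"
  have d: "0 < d" "d < 1" "Eg \<le> d" "EU \<le> 1 - d"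
  proof -
    have "2 * d = Eg + 1 - EU" by (simp add: d_def)
    then show "0 < d" "d < 1" "Eg \<le> d" "EU \<le> 1 - d" using EU Eg sum by linarith+
  qed

  define a where "a = 1 / sqrt (1 - d)"
  have a2: "a\<^sup>2 = 1 / (1 - d)" using d by (simp add: a_def power_divide)
  interpret R: radial_profile "\<lambda>t. a * U t" "\<lambda>t. a * U' t" s c
  proof
    show "2 * pi * integral {1..B} (\<lambda>t. (a * U' t - c * (a * U t) / t)\<^sup>2) \<le> 1" for B
    proof -
      have eq: "(a * U' t - c * (a * U t) / t)\<^sup>2 = a\<^sup>2 * ?F2 t" for t
        by (simp add: power_mult_distrib[symmetric] right_diff_distrib mult.left_commute)
      \<comment> \<open>The bound is required for every upper limit B; past b the mean vanishes, so
        the energy up to b dominates.\<close>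
      have "integral {1..B} ?F2 \<le> integral {1..max b B} ?F2"
        by (intro integral_subset_le F2i) auto
      also have "\<dots> = integral {1..b} ?F2 + integral {b..max b B} ?F2"
        using b_ge by (intro Henstock_Kurzweil_Integration.integral_combine[symmetric] F2i) auto
      also have "integral {b..max b B} ?F2 = integral {b..max b B} (\<lambda>_. 0)"
        by (intro integral_cong) (auto simp: U_zero)
      finally have "2 * pi * integral {1..B} ?F2 \<le> EU" by (simp add: EU_def)
      then have "a\<^sup>2 * (2 * pi * integral {1..B} ?F2) \<le> a\<^sup>2 * (1 - d)" using d by (intro mult_left_mono) auto
      also have "\<dots> = 1" using d by (simp add: a2)
      finally show ?thesis unfolding eq by (simp add: mult.left_commute)
    qed
    show "((\<lambda>t. a * U t) has_real_derivative a * U' t) (at t)" for t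
      by (intro DERIV_cmult U_deriv)
    show "continuous_on UNIV (\<lambda>t. a * U' t)" by (intro continuous_intros U'_cont)
  qed (auto simp: s c_def U_zero)

  define k where "k = sqrt (\<kappa> / d)"
  have k2: "k\<^sup>2 = \<kappa> / d" using d \<kappa> by (simp add: k_def)
  interpret K: cylinder_fn "\<lambda>x. k * g x" "\<lambda>x. k * gt x" "\<lambda>x. k * Wh x" b by (rule G.scale)
  have KD: "K.dirichlet \<le> 1"
    using Dg d \<kappa> unfolding G.dirichlet_scale k2 by (simp add: field_simps)
  have KP: "(\<integral>\<^sup>+x\<in>strip. ennreal (K.P x) \<partial>lborel) \<le> 1"
    unfolding K.nn_integral_P using KD by (metis ennreal_1 ennreal_leI)
  have KW: "(\<integral>\<^sup>+x\<in>strip. ennreal ((k * g x)\<^sup>2) \<partial>lborel) \<le> 2"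
  proof -
    have "(\<integral>\<^sup>+x\<in>strip. ennreal ((k * g x)\<^sup>2) \<partial>lborel) = ennreal (k\<^sup>2) * (\<integral>\<^sup>+x\<in>strip. ennreal ((g x)\<^sup>2) \<partial>lborel)"
      by (subst nn_integral_cmult[symmetric]) (auto simp: power_mult_distrib ennreal_mult mult.assoc)
    also have "\<dots> \<le> ennreal (k\<^sup>2) * ennreal (2 * G.dirichlet)"
      by (intro mult_left_mono nn_integral_g2) auto
    also have "\<dots> = ennreal (2 * K.dirichlet)"
      unfolding G.dirichlet_scale using G.dirichlet_nonneg by (simp add: ennreal_mult[symmetric])
    also have "\<dots> \<le> ennreal 2" using KD by (intro ennreal_leI) simp
    finally show ?thesis by simp
  qed

  define \<beta> where "\<beta> = 4 * pi * s / \<kappa>"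
  have \<beta>: "0 < \<beta>" "\<beta> < 4 * pi" using s \<kappa> by (auto simp: \<beta>_def field_simps)
  define \<gamma> where "\<gamma> = \<beta> / (4 * pi)"
  define \<epsilon> where "\<epsilon> = 2 * pi * (1 + \<gamma>) / \<beta> - 1"
  define H where "H = (sqrt (4 * pi * exp 2) + sqrt (2 * pi)) / (2 * pi)"
  define A where "A = exp (\<beta> * (1 + 1 / \<epsilon>) * H\<^sup>2) * (2 * pi / (1 - \<gamma>))"
  have A: "0 \<le> A" using \<beta> by (simp add: A_def \<gamma>_def)
  define \<Phi> where "\<Phi> t = (\<integral>\<^sup>+\<theta>\<in>{0..2 * pi}. ennreal (exp (\<beta> * (k * g (t, \<theta>))\<^sup>2)) \<partial>lborel)" for t
  have [measurable]: "\<Phi> \<in> borel_measurable borel" unfolding \<Phi>_def by measurable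
  have \<Phi>: "(\<integral>\<^sup>+t\<in>{p..q}. \<Phi> t \<partial>lborel) \<le> ennreal (A * (q - p + 1))" if "1 \<le> p" "p \<le> q" for p q
  proof -
    have [measurable]: "{p..q} \<times> {0..2 * pi} \<in> sets borel" by (intro borel_Times) auto
    have "(\<integral>\<^sup>+t\<in>{p..q}. \<Phi> t \<partial>lborel) = (\<integral>\<^sup>+x\<in>{p..q} \<times> {0..2 * pi}. ennreal (exp (\<beta> * (k * g x)\<^sup>2)) \<partial>lborel)"
      unfolding \<Phi>_def by (subst nn_integral_lborel_fst) (auto intro!: nn_integral_cong split: split_indicator)
    also have "\<dots> \<le> ennreal (A * (q - p + 1))"
      using K.subcritical_integral[OF \<beta> KP KW that(2) \<gamma>_def \<epsilon>_def H_def] by (simp add: A_def)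
    finally show ?thesis .
  qed
  have pointwise: "4 * pi * s * (W x)\<^sup>2 - 2 * fst x \<le> R.\<psi> (fst x) + \<beta> * (k * g x)\<^sup>2" for x
  proof -
    have "(W x)\<^sup>2 \<le> (U (fst x))\<^sup>2 / (1 - d) + (g x)\<^sup>2 / d"
    proof -
      have "0 \<le> (d * U (fst x) - (1 - d) * g x)\<^sup>2 / (d * (1 - d))" using d by simp
      also have "\<dots> = (U (fst x))\<^sup>2 / (1 - d) + (g x)\<^sup>2 / d - (U (fst x) + g x)\<^sup>2"
      proof -
        have "d \<noteq> 0" "1 - d \<noteq> 0" using d by auto
        then show ?thesis by (simp add: power2_eq_square divide_simps) (simp add: algebra_simps)
      qed
      finally show ?thesis by (simp add: g_def)
    qed
    then have "4 * pi * s * (W x)\<^sup>2 \<le> 4 * pi * s * ((U (fst x))\<^sup>2 / (1 - d) + (g x)\<^sup>2 / d)"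
      using s by (intro mult_left_mono) auto
    also have "\<dots> = 4 * pi * s * (a * U (fst x))\<^sup>2 + \<beta> * (k * g x)\<^sup>2"
      using \<kappa> by (simp add: power_mult_distrib a2 k2 \<beta>_def distrib_left)
    finally show ?thesis unfolding R.\<psi>_def by simp
  qed
  have [measurable]: "R.\<psi> \<in> borel_measurable borel" by (intro borel_measurable_continuous_onI R.psi_cont)
  have "(\<integral>\<^sup>+t\<in>{1..}. (\<integral>\<^sup>+\<theta>\<in>{0..2 * pi}. ennreal (exp (4 * pi * s * (W (t, \<theta>))\<^sup>2 - 2 * t)) \<partial>lborel) \<partial>lborel)
    \<le> (\<integral>\<^sup>+t\<in>{1..}. ennreal (exp (R.\<psi> t)) * \<Phi> t \<partial>lborel)"
  proof (rule nn_integral_mono, rule mult_right_mono)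
    fix t
    have "(\<integral>\<^sup>+\<theta>\<in>{0..2 * pi}. ennreal (exp (4 * pi * s * (W (t, \<theta>))\<^sup>2 - 2 * t)) \<partial>lborel)
      \<le> (\<integral>\<^sup>+\<theta>. ennreal (exp (R.\<psi> t)) * (ennreal (exp (\<beta> * (k * g (t, \<theta>))\<^sup>2)) * indicator {0..2 * pi} \<theta>) \<partial>lborel)"
      using pointwise[of "(t, _)"] by (intro nn_integral_mono) 
        (auto simp: ennreal_mult[symmetric] simp flip: exp_add intro!: ennreal_leI split: split_indicator)
    also have "\<dots> = ennreal (exp (R.\<psi> t)) * \<Phi> t"
      unfolding \<Phi>_def by (intro nn_integral_cmult) measurable
    finally show "(\<integral>\<^sup>+\<theta>\<in>{0..2 * pi}. ennreal (exp (4 * pi * s * (W (t, \<theta>))\<^sup>2 - 2 * t)) \<partial>lborel) \<le> ennreal (exp (R.\<psi> t)) * \<Phi> t" .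
  qed simp
  also have "\<dots> \<le> ennreal (A * (2 + 2 * (10 / s * 11 powr ((1 - s) / s))) * (1 / (1 - exp (- 1))\<^sup>2))"
    by (intro R.exp_psi_integral \<Phi> A) auto
  also have "A * (2 + 2 * (10 / s * 11 powr ((1 - s) / s))) * (1 / (1 - exp (- 1))\<^sup>2) = MT_const \<mu>"
    by (simp add: MT_const_def Let_def A_def H_def \<epsilon>_def \<gamma>_def \<beta>_def \<kappa>_def s_def)
  finally show ?thesis unfolding s_def .
qed

section \<open>Test functions\<close>

definition pd :: "'a::euclidean_space \<Rightarrow> ('a \<Rightarrow> real) \<Rightarrow> 'a \<Rightarrow> real" where
  "pd b f x = frechet_derivative f (at x) b"

lemma has_derivative_pd:
  fixes f :: "'a::euclidean_space \<Rightarrow> real"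
  assumes "f differentiable (at x)"
  shows "(f has_derivative (\<lambda>h. \<Sum>b\<in>Basis. (h \<bullet> b) * pd b f x)) (at x)"
proof -
  have d: "(f has_derivative frechet_derivative f (at x)) (at x)"
    using assms by (simp add: frechet_derivative_works)
  then interpret L: bounded_linear "frechet_derivative f (at x)" by (rule has_derivative_bounded_linear)
  have "frechet_derivative f (at x) h = (\<Sum>b\<in>Basis. (h \<bullet> b) * pd b f x)" for h
  proof -
    have "frechet_derivative f (at x) h = frechet_derivative f (at x) (\<Sum>b\<in>Basis. (h \<bullet> b) *\<^sub>R b)"
      by (simp add: euclidean_representation)
    also have "\<dots> = (\<Sum>b\<in>Basis. (h \<bullet> b) * pd b f x)"
      by (simp add: L.sum L.scaleR pd_def)
    finally show ?thesis .
  qed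
  then have "frechet_derivative f (at x) = (\<lambda>h. \<Sum>b\<in>Basis. (h \<bullet> b) * pd b f x)" by (rule ext)
  with d show ?thesis by simp
qed

lemma pd_eq:
  assumes "(f has_derivative f') (at x)"
  shows "pd b f x = f' b"
  using frechet_derivative_at[OF assms] by (simp add: pd_def)

text \<open>\<open>grad\<close> is a definite description, so a gradient has to be exhibited and
  shown to be unique before anything can be computed.\<close>

lemma grad_eq:
  fixes f :: "'a::euclidean_space \<Rightarrow> real"
  assumes "f differentiable (at x)"
  shows "grad f x = (\<Sum>b\<in>Basis. pd b f x *\<^sub>R b)"
proof -
  have "GDERIV f x :> (\<Sum>b\<in>Basis. pd b f x *\<^sub>R b)"
    unfolding gderiv_def
    using has_derivative_pd[OF assms] by (simp add: inner_sum_right mult.commute)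
  moreover have "D = D'" if "GDERIV f x :> D" "GDERIV f x :> D'" for D D'
    using has_derivative_unique[OF that[unfolded gderiv_def]] by (metis inner_commute vector_eq_ldot)
  ultimately show ?thesis unfolding grad_def by blast
qed

lemma class_C_differentiable: "class_C (Suc k) f \<Longrightarrow> f differentiable (at x)"
  by (simp add: differentiable_on_def)

lemma class_C_pd: "class_C (Suc k) f \<Longrightarrow> b \<in> Basis \<Longrightarrow> class_C k (pd b f)"
  by (simp add: pd_def[abs_def])

lemma class_C_cont: "class_C k f \<Longrightarrow> continuous_on S f"
proof (cases k)
  case (Suc n)
  assume "class_C k f"
  then have "f differentiable_on UNIV" using Suc by simp
  then show ?thesis using differentiable_imp_continuous_on continuous_on_subset by blast
qed (auto intro: continuous_on_subset)

lemma class_C_lincomb: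
  fixes f g :: "'a::euclidean_space \<Rightarrow> real"
  shows "class_C k f \<Longrightarrow> class_C k g \<Longrightarrow> class_C k (\<lambda>x. \<alpha> * f x + \<beta> * g x)"
proof (induction k arbitrary: f g)
  case 0
  then show ?case by (auto intro!: continuous_intros)
next
  case (Suc k)
  have d: "f differentiable (at x)" "g differentiable (at x)" for x
    using Suc.prems by (auto intro: class_C_differentiable)
  have "((\<lambda>x. \<alpha> * f x + \<beta> * g x) has_derivative 
     (\<lambda>h. \<alpha> * frechet_derivative f (at x) h + \<beta> * frechet_derivative g (at x) h)) (at x)" for x
    using d[of x] by (intro derivative_intros) (auto simp: frechet_derivative_works)
  note d' = this
  have "(\<lambda>x. \<alpha> * f x + \<beta> * g x) differentiable_on UNIV"
    using d' by (auto simp: differentiable_on_def differentiable_def)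
  moreover have "frechet_derivative (\<lambda>x. \<alpha> * f x + \<beta> * g x) (at x) = (\<lambda>h. \<alpha> * frechet_derivative f (at x) h + \<beta> * frechet_derivative g (at x) h)" for x
    by (rule frechet_derivative_at[OF d', symmetric])
  ultimately show ?case using Suc by simp
qed

lemma pd_lincomb:
  fixes f g :: "'a::euclidean_space \<Rightarrow> real"
  assumes "f differentiable (at x)" "g differentiable (at x)"
  shows "pd b (\<lambda>x. \<alpha> * f x + \<beta> * g x) x = \<alpha> * pd b f x + \<beta> * pd b g x"
  unfolding pd_def[of b f] pd_def[of b g]
  using assms by (intro pd_eq derivative_intros) (auto simp: frechet_derivative_works)

lemma pd_mult:
  fixes f g :: "'a::euclidean_space \<Rightarrow> real"
  assumes "f differentiable (at x)" "g differentiable (at x)"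
  shows "pd b (\<lambda>x. f x * g x) x = f x * pd b g x + pd b f x * g x"
  unfolding pd_def[of b f] pd_def[of b g]
  using assms by (intro pd_eq derivative_intros) (auto simp: frechet_derivative_works)

definition supp :: "('a::euclidean_space \<Rightarrow> real) \<Rightarrow> 'a set" where
  "supp f = closure {x. f x \<noteq> 0}"

lemma not_supp: "x \<notin> supp f \<Longrightarrow> f x = 0"
  using closure_subset[of "{x. f x \<noteq> 0}"] by (auto simp: supp_def)

lemma pd_not_supp:
  assumes "x \<notin> supp f"
  shows "pd b f x = 0"
proof -
  have "(f has_derivative (\<lambda>h. 0)) (at x)"
  proof (rule has_derivative_transform_within_open[OF has_derivative_const[of 0]])
    show "open (- supp f)" by (simp add: supp_def open_Compl)
    show "x \<in> - supp f" using assms by simp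
    show "0 = f y" if "y \<in> - supp f" for y using that not_supp by simp
  qed
  then show ?thesis by (simp add: pd_eq)
qed

lemma supp_pd: "supp (pd b f) \<subseteq> supp f"
  unfolding supp_def[of "pd b f"] using pd_not_supp
  by (intro closure_minimal) (auto simp: supp_def)

lemma test_functionsD:
  assumes "f \<in> test_functions \<Omega>"
  shows "class_C k f" "compact (supp f)" "supp f \<subseteq> \<Omega>" "f differentiable (at x)" "continuous_on S f"
    "b \<in> Basis \<Longrightarrow> continuous_on S (pd b f)"
proof -
  have C: "class_C k f" for k using assms unfolding test_functions_def by blast
  then show "class_C k f" .
  show "compact (supp f)" "supp f \<subseteq> \<Omega>" using assms unfolding test_functions_def supp_def by blast+
  show "f differentiable (at x)" by (rule class_C_differentiable[OF C[of "Suc 0"]])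
  show "continuous_on S f" by (rule class_C_cont[OF C[of 0]])
  show "continuous_on S (pd b f)" if "b \<in> Basis" by (rule class_C_cont[OF class_C_pd[OF C[of "Suc 0"] that]])
qed

lemma test_functions_lincomb:
  assumes "f \<in> test_functions \<Omega>" "g \<in> test_functions \<Omega>"
  shows "(\<lambda>x. \<alpha> * f x + \<beta> * g x) \<in> test_functions \<Omega>"
proof -
  have sub: "closure {x. \<alpha> * f x + \<beta> * g x \<noteq> 0} \<subseteq> supp f \<union> supp g"
  proof (rule closure_minimal)
    show "{x. \<alpha> * f x + \<beta> * g x \<noteq> 0} \<subseteq> supp f \<union> supp g"
      using not_supp[of _ f] not_supp[of _ g] by fastforce
    show "closed (supp f \<union> supp g)" by (simp add: supp_def closed_Un)
  qed
  have "compact (closure {x. \<alpha> * f x + \<beta> * g x \<noteq> 0})"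
    using compact_Int_closed[of "supp f \<union> supp g" "closure {x. \<alpha> * f x + \<beta> * g x \<noteq> 0}"]
      test_functionsD(2)[OF assms(1)] test_functionsD(2)[OF assms(2)] sub
    by (simp add: compact_Un Int_absorb1)
  then show ?thesis using sub test_functionsD[OF assms(1)] test_functionsD[OF assms(2)]
    unfolding test_functions_def by (auto intro!: class_C_lincomb)
qed

lemma test_functions_pd:
  assumes "f \<in> test_functions \<Omega>" "b \<in> Basis"
  shows "pd b f \<in> test_functions \<Omega>"
proof -
  have "compact (supp (pd b f))"
    using compact_Int_closed[of "supp f" "supp (pd b f)"] test_functionsD(2)[OF assms(1)] supp_pd[of b f]
    by (simp add: Int_absorb1 supp_def)
  then show ?thesis
    using class_C_pd[OF test_functionsD(1)[OF assms(1)] assms(2)] supp_pd[of b f] test_functionsD(3)[OF assms(1)]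
    by (auto simp: test_functions_def supp_def)
qed

lemma compact_support_bounded:
  fixes f :: "'a::euclidean_space \<Rightarrow> real"
  assumes "continuous_on UNIV f" "compact K" "\<And>x. x \<notin> K \<Longrightarrow> f x = 0"
  obtains M where "0 \<le> M" "\<And>x. \<bar>f x\<bar> \<le> M"
proof -
  have "bounded (f ` K)"
    using assms by (intro compact_imp_bounded compact_continuous_image continuous_on_subset[OF assms(1)]) auto
  then obtain M where M: "\<And>x. x \<in> K \<Longrightarrow> \<bar>f x\<bar> \<le> M" by (auto simp: bounded_iff)
  show ?thesis
  proof (rule that[of "max 0 M"])
    fix x show "\<bar>f x\<bar> \<le> max 0 M" using M[of x] assms(3)[of x] by (cases "x \<in> K") auto
  qed simp
qed

text \<open>By translation invariance the difference quotients of \<open>F\<close> have integral 0.\<close>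

lemma integral_pd_zero:
  fixes F :: "'a::euclidean_space \<Rightarrow> real"
  assumes F: "\<And>x. F differentiable (at x)" and cont: "continuous_on UNIV (pd b F)" and b: "b \<in> Basis"
    and K: "compact (supp F)"
  shows "integral\<^sup>L lborel (pd b F) = 0"
proof -
  have Fc: "continuous_on UNIV F"
    using F by (meson differentiable_imp_continuous_within continuous_at_imp_continuous_on)
  obtain M where M: "0 \<le> M" "\<And>x. \<bar>pd b F x\<bar> \<le> M"
    using compact_support_bounded[OF cont K] pd_not_supp by metis
  obtain R where R: "\<And>x. x \<in> supp F \<Longrightarrow> norm x \<le> R"
    using compact_imp_bounded[OF K] by (auto simp: bounded_iff)
  have nb: "norm b = 1" using b by simp
  have [measurable]: "F \<in> borel_measurable borel" "pd b F \<in> borel_measurable borel"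
    by (auto intro: borel_measurable_continuous_onI Fc cont)
  have Fi: "integrable lborel F"
    using borel_integrable_compact[OF K continuous_on_subset[OF Fc]] not_supp[of _ F]
    by (auto elim!: Bochner_Integration.integrable_cong[THEN iffD1, rotated -1] simp: indicator_def)
  have line: "((\<lambda>s. F (x + s *\<^sub>R b)) has_real_derivative pd b F (x + s *\<^sub>R b)) (at s)" for x s
  proof -
    have "((\<lambda>s. x + s *\<^sub>R b) has_derivative (\<lambda>h. h *\<^sub>R b)) (at s)" by (auto intro!: derivative_eq_intros)
    from has_derivative_compose[OF this has_derivative_pd[OF F]] show ?thesis
      unfolding has_field_derivative_def
      by (rule has_derivative_eq_rhs) (use b in \<open>auto simp: fun_eq_iff inner_Basis if_distrib if_distribR sum.delta' mult_ac cong: if_cong\<close>)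
  qed
  define G where "G n x = real (Suc n) * (F (x + (1 / real (Suc n)) *\<^sub>R b) - F x)" for n x
  have G0: "integral\<^sup>L lborel (G n) = 0" for n
  proof -
    have sh: "integrable lborel (\<lambda>x. F (x + c))" "integral\<^sup>L lborel (\<lambda>x. F (x + c)) = integral\<^sup>L lborel F" for c
    proof -
      have "(\<lambda>x. x + c) = (+) c" by (auto simp: add.commute)
      then have d: "distr lborel borel (\<lambda>x. x + c) = lborel" by (simp only: lborel_distr_plus)
      show "integrable lborel (\<lambda>x. F (x + c))" "integral\<^sup>L lborel (\<lambda>x. F (x + c)) = integral\<^sup>L lborel F"
        using Fi integrable_distr_eq[of "\<lambda>x. x + c" lborel borel F] integral_distr[of "\<lambda>x. x + c" lborel borel F]
        by (simp_all add: d)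
    qed
    show ?thesis unfolding G_def using Fi sh by simp
  qed
  have "(\<lambda>n. integral\<^sup>L lborel (G n)) \<longlonglongrightarrow> integral\<^sup>L lborel (pd b F)"
  proof (rule integral_dominated_convergence[where w = "\<lambda>x. M * indicator (cball 0 (R + 1)) x"])
    show "integrable lborel (\<lambda>x. M * indicator (cball (0::'a) (R + 1)) x)"
      by (intro integrable_mult_right integrable_real_indicator) (use emeasure_bounded_finite[OF bounded_cball, of "0::'a" "R + 1"] in \<open>auto\<close>)
    show "AE x in lborel. (\<lambda>n. G n x) \<longlonglongrightarrow> pd b F x"
    proof (rule AE_I2)
      fix x
      have "((\<lambda>h. (F (x + h *\<^sub>R b) - F x) / h) \<longlongrightarrow> pd b F x) (at 0)"
        using line[of x 0] by (simp add: DERIV_def)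
      moreover have "filterlim (\<lambda>n. 1 / real (Suc n)) (at 0) sequentially"
        by (intro filterlim_atI LIMSEQ_Suc lim_1_over_n) auto
      ultimately have "(\<lambda>n. (F (x + (1 / real (Suc n)) *\<^sub>R b) - F x) / (1 / real (Suc n))) \<longlonglongrightarrow> pd b F x"
        by (rule filterlim_compose)
      then show "(\<lambda>n. G n x) \<longlonglongrightarrow> pd b F x" by (simp add: G_def mult.commute)
    qed
    show "AE x in lborel. norm (G n x) \<le> M * indicator (cball 0 (R + 1)) x" for n
    proof (rule AE_I2)
      fix x
      \<comment> \<open>By the mean value theorem a difference quotient is a value of the derivative
        at distance less than 1: it is bounded by M and vanishes outside the ball enlarged by
        1.\<close>
      have "\<exists>s. s > 0 \<and> s < 1 / real (Suc n) \<and> F (x + (1 / real (Suc n)) *\<^sub>R b) - F (x + 0 *\<^sub>R b) = (1 / real (Suc n) - 0) * pd b F (x + s *\<^sub>R b)"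
        by (rule MVT2) (auto intro: line)
      then obtain s where s: "0 < s" "s < 1 / real (Suc n)" "G n x = pd b F (x + s *\<^sub>R b)"
        by (auto simp: G_def)
      have "pd b F (x + s *\<^sub>R b) = 0" if "x \<notin> cball 0 (R + 1)"
      proof (rule pd_not_supp, rule notI)
        assume "x + s *\<^sub>R b \<in> supp F"
        then have "norm (x + s *\<^sub>R b) \<le> R" by (rule R)
        moreover have "norm x \<le> norm (x + s *\<^sub>R b) + norm (s *\<^sub>R b)" by (metis add_diff_cancel norm_triangle_ineq4)
        moreover have "norm (s *\<^sub>R b) \<le> 1" using s nb by (simp add: field_simps) (smt (verit) mult_nonneg_nonneg of_nat_0_le_iff)
        ultimately show False using that by simp
      qed
      then show "norm (G n x) \<le> M * indicator (cball 0 (R + 1)) x"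
        using s(3) M by (auto simp: indicator_def)
    qed
  qed (auto simp: G_def[abs_def])
  then show ?thesis unfolding G0 by (metis LIMSEQ_unique tendsto_const)
qed

lemma axis_Basis [simp]: "(axis 1 1 :: real^2) \<in> Basis" "(axis 2 1 :: real^2) \<in> Basis"
  by (auto simp: axis_in_Basis_iff)

lemma Basis_real2: "(Basis :: (real^2) set) = {axis 1 1, axis 2 1}" "(axis 1 1 :: real^2) \<noteq> axis 2 1"
  by (auto simp: Basis_vec_def UNIV_2 axis_eq_axis)

lemma inner_grad:
  fixes f :: "'a::euclidean_space \<Rightarrow> real"
  assumes "f differentiable (at x)" "g differentiable (at x)"
  shows "grad f x \<bullet> grad g x = (\<Sum>b\<in>Basis. pd b f x * pd b g x)"
  unfolding grad_eq[OF assms(1)] grad_eq[OF assms(2)]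
  by (subst euclidean_inner) (simp add: inner_sum_left_Basis)

lemma norm_grad_sq:
  fixes f :: "'a::euclidean_space \<Rightarrow> real"
  assumes "f differentiable (at x)"
  shows "(norm (grad f x))\<^sup>2 = (\<Sum>b\<in>Basis. (pd b f x)\<^sup>2)"
  unfolding power2_norm_eq_inner inner_grad[OF assms assms] by (simp add: power2_eq_square)

lemma LINT_lebesgue_on:
  fixes f :: "'a::euclidean_space \<Rightarrow> real"
  assumes f: "f \<in> borel_measurable borel" and S: "S \<in> sets borel"
    and zero: "\<And>x. x \<notin> S \<Longrightarrow> f x = 0"
  shows "(LINT x|lebesgue_on S. f x) = integral\<^sup>L lborel f" "integrable (lebesgue_on S) f \<longleftrightarrow> integrable lborel f"
proof -
  have "(\<lambda>x. indicator S x *\<^sub>R f x) = f" using zero by (auto simp: fun_eq_iff indicator_def)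
  moreover have "S \<inter> space lebesgue \<in> sets lebesgue" using S by auto
  ultimately show "(LINT x|lebesgue_on S. f x) = integral\<^sup>L lborel f" "integrable (lebesgue_on S) f \<longleftrightarrow> integrable lborel f"
    using f by (simp_all add: integral_restrict_space integrable_restrict_space set_integrable_def integral_completion integrable_completion)
qed

lemma nn_integral_lebesgue_on:
  assumes "S \<in> sets borel"
  shows "(\<integral>\<^sup>+x. f x \<partial>lebesgue_on S) = (\<integral>\<^sup>+x\<in>S. f x \<partial>lborel)"
  using assms by (simp add: nn_integral_restrict_space nn_integral_completion)

section \<open>From the ball to the half cylinder\<close>

locale log_hardy =
  fixes \<mu> r0 :: real and V :: "real \<Rightarrow> real"
  assumes \<mu>: "-1/4 < \<mu>" "\<mu> < 0" and r0: "r0 = 1 / exp 1"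
    and V: "V = (\<lambda>r. 1 / (r\<^sup>2 * (ln (1 / r))\<^sup>2))"
begin

abbreviation B :: "(real^2) set" where "B \<equiv> ball 0 r0"

abbreviation T :: "(real^2 \<Rightarrow> real) set" where "T \<equiv> test_functions (B - {0})"

lemma B_eq: "B = ball 0 (exp (- 1))"
  by (simp add: r0 exp_minus inverse_eq_divide)

lemma V_measurable [measurable]: "V \<in> borel_measurable borel"
  unfolding V by measurable

lemma V_nonneg: "0 \<le> V r" by (simp add: V)

lemma T_zero: "f \<in> T \<Longrightarrow> x \<notin> B \<or> x = 0 \<Longrightarrow> f x = 0"
  using test_functionsD(3)[of f] not_supp[of x f] by blast

lemma T_pd_zero: "f \<in> T \<Longrightarrow> x \<notin> B \<or> x = 0 \<Longrightarrow> pd b f x = 0"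
  using test_functionsD(3)[of f] pd_not_supp[of x f] by blast

text \<open>The norm attains a positive minimum on the compact support, which avoids the origin; the
  extra 1 in the witness makes the inequality strict. This provides the bound b of
  \<open>cylinder_fn\<close>.\<close>

lemma T_annulus:
  assumes "f \<in> T"
  obtains b where "1 \<le> b" "\<And>x. x \<in> supp f \<Longrightarrow> exp (- b) < norm x"
proof (cases "supp f = {}")
  case False
  obtain y where y: "y \<in> supp f" "\<And>x. x \<in> supp f \<Longrightarrow> norm y \<le> norm x"
    using continuous_attains_inf[OF test_functionsD(2)[OF assms] False continuous_on_norm_id] by auto
  then have "0 < norm y" using test_functionsD(3)[OF assms] by auto
  show ?thesis
  proof (rule that[of "max 1 (1 - ln (norm y))"])
    fix x assume "x \<in> supp f"
    have "exp (- max 1 (1 - ln (norm y))) \<le> exp (ln (norm y) - 1)" by simp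
    also have "\<dots> < exp (ln (norm y))" by simp
    also have "\<dots> = norm y" using \<open>0 < norm y\<close> by simp
    finally show "exp (- max 1 (1 - ln (norm y))) < norm x" using y(2)[OF \<open>x \<in> supp f\<close>] by simp
  qed simp
qed (auto intro: that[of 1])

definition cyl :: "(real^2 \<Rightarrow> real) \<Rightarrow> real \<times> real \<Rightarrow> real" where
  "cyl f x = f (polar (fst x) (snd x))"

text \<open>With r = exp (-t), \<open>cylt f\<close> is -r times the radial derivative of f, and
  \<open>cylh f\<close> below is the derivative in \<theta>.\<close>

definition cylt :: "(real^2 \<Rightarrow> real) \<Rightarrow> real \<times> real \<Rightarrow> real" where
  "cylt f x = - exp (- fst x) * (cos (snd x) * pd (axis 1 1) f (polar (fst x) (snd x)) + sin (snd x) * pd (axis 2 1) f (polar (fst x) (snd x)))"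

definition cylh :: "(real^2 \<Rightarrow> real) \<Rightarrow> real \<times> real \<Rightarrow> real" where
  "cylh f x = exp (- fst x) * (cos (snd x) * pd (axis 2 1) f (polar (fst x) (snd x)) - sin (snd x) * pd (axis 1 1) f (polar (fst x) (snd x)))"

lemma polar_cont: "continuous_on S (\<lambda>x. polar (fst x) (snd x))"
  unfolding polar_def by (intro continuous_intros)

lemma polar_period: "polar t (\<theta> + 2 * pi) = polar t \<theta>"
  by (simp add: polar_def)

lemma polar_deriv:
  "((\<lambda>x. polar (fst x) (snd x)) has_derivative 
    (\<lambda>h. vector [- (exp (- fst x) * cos (snd x)) * fst h - exp (- fst x) * sin (snd x) * snd h,
      - (exp (- fst x) * sin (snd x)) * fst h + exp (- fst x) * cos (snd x) * snd h])) (at x)"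
  unfolding polar_def vector2_eq
  by (auto intro!: derivative_eq_intros simp: algebra_simps)

lemma cyl_cylinder_fn:
  assumes f: "f \<in> T" and b: "1 \<le> b" "\<And>x. x \<in> supp f \<Longrightarrow> exp (- b) < norm x"
  shows "cylinder_fn (cyl f) (cylt f) (cylh f) b"
proof
  have out: "polar t \<theta> \<notin> supp f" if "t \<le> 1 \<or> b \<le> t" for t \<theta>
    using that
  proof
    assume "t \<le> 1"
    then have "polar t \<theta> \<notin> B" by (simp add: B_eq)
    then show ?thesis using test_functionsD(3)[OF f] by blast
  next
    assume "b \<le> t"
    then show ?thesis using b(2)[of "polar t \<theta>"] by auto
  qed
  show "cyl f (t, \<theta>) = 0" "cylt f (t, \<theta>) = 0" "cylh f (t, \<theta>) = 0" if "t \<le> 1 \<or> b \<le> t" for t \<theta>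
    using out[OF that] by (auto simp: cyl_def cylt_def cylh_def not_supp pd_not_supp)
  show "(cyl f has_derivative (\<lambda>h. cylt f x * fst h + cylh f x * snd h)) (at x)" for x
  proof -
    note has_derivative_compose[OF polar_deriv has_derivative_pd[OF test_functionsD(4)[OF f]], of x]
    then show ?thesis
      unfolding cyl_def[abs_def]
      by (rule has_derivative_eq_rhs)
         (use Basis_real2(2) in \<open>auto simp: fun_eq_iff Basis_real2(1) inner_axis cylt_def cylh_def algebra_simps\<close>)
  qed
  have c: "continuous_on UNIV (\<lambda>x. pd b f (polar (fst x) (snd x)))" if "b \<in> Basis" for b
    by (rule continuous_on_compose2[OF test_functionsD(6)[OF f that, of UNIV] polar_cont]) auto
  show "continuous_on UNIV (cylt f)" "continuous_on UNIV (cylh f)"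
    unfolding cylt_def[abs_def] cylh_def[abs_def] by (intro continuous_intros c axis_Basis)+
qed (use b in \<open>auto simp: cyl_def cylt_def cylh_def polar_period\<close>)

lemma nn_integral_ball_polar:
  assumes [measurable]: "F \<in> borel_measurable borel"
  shows "(\<integral>\<^sup>+x. F x \<partial>lebesgue_on B)
    = (\<integral>\<^sup>+t\<in>{1..}. (\<integral>\<^sup>+\<theta>\<in>{0..2 * pi}. F (polar t \<theta>) * ennreal (exp (- 2 * t)) \<partial>lborel) \<partial>lborel)"
proof -
  have "(\<integral>\<^sup>+x. F x \<partial>lebesgue_on B) = (\<integral>\<^sup>+t. \<integral>\<^sup>+\<theta>. F (polar t \<theta>) * ennreal (exp (- 2 * t)) * indicator {0<..<2 * pi} \<theta> * indicator {1<..} t \<partial>lborel \<partial>lborel)"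
    unfolding B_eq by (subst nn_integral_lebesgue_on) (auto simp: nn_integral_polar)
  also have "\<dots> = (\<integral>\<^sup>+t. (\<integral>\<^sup>+\<theta>\<in>{0<..<2 * pi}. F (polar t \<theta>) * ennreal (exp (- 2 * t)) \<partial>lborel) * indicator {1<..} t \<partial>lborel)"
    by (intro nn_integral_cong nn_integral_multc) measurable
  also have "\<dots> = (\<integral>\<^sup>+t\<in>{1..}. (\<integral>\<^sup>+\<theta>\<in>{0<..<2 * pi}. F (polar t \<theta>) * ennreal (exp (- 2 * t)) \<partial>lborel) \<partial>lborel)"
    by (rule nn_integral_cong_AE) (use AE_lborel_singleton[of "1::real"] in \<open>eventually_elim, auto split: split_indicator\<close>)
  also have "(\<lambda>t. \<integral>\<^sup>+\<theta>\<in>{0<..<2 * pi}. F (polar t \<theta>) * ennreal (exp (- 2 * t)) \<partial>lborel) = (\<lambda>t. \<integral>\<^sup>+\<theta>\<in>{0..2 * pi}. F (polar t \<theta>) * ennreal (exp (- 2 * t)) \<partial>lborel)"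
  proof
    fix t
    have ae: "AE \<theta> in lborel. \<theta> \<noteq> 0 \<and> \<theta> \<noteq> 2 * pi"
      using AE_lborel_singleton[of "0::real"] AE_lborel_singleton[of "2 * pi"] by eventually_elim auto
    show "(\<integral>\<^sup>+\<theta>\<in>{0<..<2 * pi}. F (polar t \<theta>) * ennreal (exp (- 2 * t)) \<partial>lborel) = (\<integral>\<^sup>+\<theta>\<in>{0..2 * pi}. F (polar t \<theta>) * ennreal (exp (- 2 * t)) \<partial>lborel)"
      by (rule nn_integral_cong_AE) (use ae in \<open>eventually_elim, auto split: split_indicator\<close>)
  qed
  finally show ?thesis .
qed

text \<open>The pull-back f need only match F for t \<ge> 1, but is continuous on the whole plane.
  Nonnegativity of F lets integrability and value be read off together from one nonnegative
  integral.\<close>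

lemma LINT_ball_polar:
  fixes F :: "real^2 \<Rightarrow> real" and f :: "real \<times> real \<Rightarrow> real"
  assumes F[measurable]: "F \<in> borel_measurable borel" and nonneg: "\<And>x. 0 \<le> F x"
    and f: "continuous_on UNIV f" "\<And>x. 0 \<le> f x" "\<And>t \<theta>. t \<notin> {1..b} \<Longrightarrow> f (t, \<theta>) = 0"
    and eq: "\<And>t \<theta>. 1 \<le> t \<Longrightarrow> F (polar t \<theta>) * exp (- 2 * t) = f (t, \<theta>)"
  shows "integrable (lebesgue_on B) F" 
    "(LINT x|lebesgue_on B. F x) = integral {1..b} (\<lambda>t. integral {0..2 * pi} (\<lambda>\<theta>. f (t, \<theta>)))"
proof -
  have [measurable]: "f \<in> borel_measurable borel" by (rule borel_measurable_continuous_onI[OF f(1)])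
  have m: "F \<in> borel_measurable (lebesgue_on B)"
    by (intro measurable_restrict_space1 measurable_completion) simp
  have "(\<integral>\<^sup>+x. ennreal (F x) \<partial>lebesgue_on B) = (\<integral>\<^sup>+t. (\<integral>\<^sup>+\<theta>\<in>{0..2 * pi}. ennreal (f (t, \<theta>)) \<partial>lborel) \<partial>lborel)"
  proof (subst nn_integral_ball_polar, measurable, rule nn_integral_cong)
    fix t
    show "(\<integral>\<^sup>+\<theta>\<in>{0..2 * pi}. ennreal (F (polar t \<theta>)) * ennreal (exp (- 2 * t)) \<partial>lborel) * indicator {1..} t
      = (\<integral>\<^sup>+\<theta>\<in>{0..2 * pi}. ennreal (f (t, \<theta>)) \<partial>lborel)"
    proof (cases "1 \<le> t")
      case True
      then show ?thesis using eq[OF True] nonneg by (simp flip: ennreal_mult)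
    next
      case False
      then show ?thesis using f(3)[of t] by simp
    qed
  qed
  also have "\<dots> = (\<integral>\<^sup>+x\<in>strip. ennreal (f x) \<partial>lborel)"
    by (subst nn_integral_lborel_fst) (auto intro!: nn_integral_cong split: split_indicator)
  also have "\<dots> = ennreal (integral {1..b} (\<lambda>t. integral {0..2 * pi} (\<lambda>\<theta>. f (t, \<theta>))))"
    by (rule nn_integral_strip[OF f])
  finally have I: "(\<integral>\<^sup>+x. ennreal (F x) \<partial>lebesgue_on B) = ennreal (integral {1..b} (\<lambda>t. integral {0..2 * pi} (\<lambda>\<theta>. f (t, \<theta>))))" .
  show "integrable (lebesgue_on B) F"
    using I m nonneg by (intro integrableI_nonneg) auto
  have "0 \<le> integral {1..b} (\<lambda>t. integral {0..2 * pi} (\<lambda>\<theta>. f (t, \<theta>)))"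
  proof (intro integral_nonneg integrable_continuous_real)
    show "continuous_on {1..b} (\<lambda>t. integral {0..2 * pi} (\<lambda>\<theta>. f (t, \<theta>)))"
      using integral_continuous_on_param[of "{1..b}" 0 "2 * pi" "\<lambda>t \<theta>. f (t, \<theta>)"]
      by (simp add: case_prod_eta continuous_on_subset[OF f(1)])
    show "continuous_on {0..2 * pi} (\<lambda>\<theta>. f (t, \<theta>))" for t
      by (rule continuous_on_compose2[OF f(1)]) (auto intro!: continuous_intros)
  qed (rule f)
  then show "(LINT x|lebesgue_on B. F x) = integral {1..b} (\<lambda>t. integral {0..2 * pi} (\<lambda>\<theta>. f (t, \<theta>)))"
    using I m nonneg by (subst integral_eq_nn_integral) auto
qed

end

context log_hardy begin

section \<open>The energy form and its closability\<close>

definition q :: "(real^2 \<Rightarrow> real) \<Rightarrow> real^2 \<Rightarrow> real" where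
  "q f x = (norm (grad f x))\<^sup>2 + \<mu> * V (norm x) * (f x)\<^sup>2"

definition Q :: "(real^2 \<Rightarrow> real) \<Rightarrow> real" where
  "Q f = (LINT x|lebesgue_on B. q f x)"

lemma pre_norm_Q: "pre_norm V \<mu> r0 f = sqrt (Q f)"
  by (simp add: pre_norm_def Q_def q_def)

lemma grad_sq_measurable:
  assumes "f \<in> T"
  shows "(\<lambda>x. (norm (grad f x))\<^sup>2) \<in> borel_measurable borel"
  unfolding norm_grad_sq[OF test_functionsD(4)[OF assms]]
  by (intro borel_measurable_continuous_onI continuous_intros test_functionsD(6)[OF assms])

lemma T_measurable: "f \<in> T \<Longrightarrow> f \<in> borel_measurable borel"
  by (intro borel_measurable_continuous_onI test_functionsD(5))

lemma V_polar: "1 \<le> t \<Longrightarrow> V (norm (polar t \<theta>)) * (f (polar t \<theta>))\<^sup>2 * exp (- 2 * t) = (f (polar t \<theta>))\<^sup>2 / t\<^sup>2"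
proof -
  assume "1 \<le> t"
  have "exp (- 2 * t) = (exp (- t))\<^sup>2" by (simp add: power2_eq_square flip: exp_add)
  then show ?thesis using \<open>1 \<le> t\<close> by (simp add: V ln_div)
qed

lemma norm_grad_polar:
  assumes "f \<in> T"
  shows "(norm (grad f (polar t \<theta>)))\<^sup>2 * exp (- 2 * t) = (cylt f (t, \<theta>))\<^sup>2 + (cylh f (t, \<theta>))\<^sup>2"
proof -
  have sq: "(- e * (c * u + s * w))\<^sup>2 + (e * (c * w - s * u))\<^sup>2 = (u\<^sup>2 + w\<^sup>2) * (e\<^sup>2 * (s\<^sup>2 + c\<^sup>2))" for e c u s w :: real
    by (simp add: power2_eq_square algebra_simps)
  have "exp (- 2 * t) = (exp (- t))\<^sup>2" by (simp add: power2_eq_square flip: exp_add)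
  then show ?thesis
    unfolding norm_grad_sq[OF test_functionsD(4)[OF assms]] cylt_def cylh_def sq fst_conv snd_conv
    using Basis_real2(2) by (simp add: Basis_real2(1))
qed

text \<open>Since \<mu> < 0 the density has no sign, so gradient and potential are transformed
  separately as nonnegative integrands and recombined afterwards.\<close>

lemma Q_energy:
  assumes f: "f \<in> T" and b: "1 \<le> b" "\<And>x. x \<in> supp f \<Longrightarrow> exp (- b) < norm x"
  shows "integrable (lebesgue_on B) (q f)" "Q f = cylinder_fn.energy (cyl f) (cylt f) (cylh f) b \<mu>"
proof -
  interpret C: cylinder_fn "cyl f" "cylt f" "cylh f" b by (rule cyl_cylinder_fn[OF f b])
  have [measurable]: "f \<in> borel_measurable borel" by (rule T_measurable[OF f])
  have P0: "C.P (t, \<theta>) = 0" if "t \<notin> {1..b}" for t \<theta>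
    using that by (auto simp: C.P_def C.Wt_zero C.Wh_zero)
  note A = LINT_ball_polar[OF grad_sq_measurable[OF f] _ C.P_cont C.P_nonneg P0, of b]
  have A': "integrable (lebesgue_on B) (\<lambda>x. (norm (grad f x))\<^sup>2)" "(LINT x|lebesgue_on B. (norm (grad f x))\<^sup>2) = C.dirichlet"
    unfolding C.dirichlet_def by (intro A; simp add: norm_grad_polar[OF f, simplified] C.P_def)+
  \<comment> \<open>Replacing t by max 1 t makes the quotient continuous on the whole plane and
    changes nothing for t \<ge> 1.\<close>
  let ?v = "\<lambda>x. (cyl f x)\<^sup>2 / (max 1 (fst x))\<^sup>2"
  have vc: "continuous_on S ?v" for S
    by (intro continuous_intros C.W_cont) auto
  have v0: "?v (t, \<theta>) = 0" if "t \<notin> {1..b}" for t \<theta> using that by (auto simp: C.W_zero)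
  have veq: "V (norm (polar t \<theta>)) * (f (polar t \<theta>))\<^sup>2 * exp (- 2 * t) = ?v (t, \<theta>)" if "1 \<le> t" for t \<theta>
    using V_polar[OF that, of \<theta> f] that by (simp add: cyl_def)
  have vm: "(\<lambda>x. V (norm x) * (f x)\<^sup>2) \<in> borel_measurable borel" by measurable
  note v = LINT_ball_polar[OF vm _ vc _ v0 veq, of b]
  have v': "integrable (lebesgue_on B) (\<lambda>x. V (norm x) * (f x)\<^sup>2)" 
    "(LINT x|lebesgue_on B. V (norm x) * (f x)\<^sup>2) = integral {1..b} (\<lambda>t. integral {0..2 * pi} (\<lambda>\<theta>. ?v (t, \<theta>)))"
    by (intro v; simp add: V_nonneg)+
  have q: "q f = (\<lambda>x. (norm (grad f x))\<^sup>2 + \<mu> * (V (norm x) * (f x)\<^sup>2))" by (auto simp: q_def)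
  show "integrable (lebesgue_on B) (q f)" unfolding q using A'(1) v'(1) by simp
  have "Q f = C.dirichlet + \<mu> * integral {1..b} (\<lambda>t. integral {0..2 * pi} (\<lambda>\<theta>. ?v (t, \<theta>)))"
    unfolding Q_def q using A' v' by simp
  also have "\<dots> = integral {1..b} (\<lambda>t. integral {0..2 * pi} (\<lambda>\<theta>. C.P (t, \<theta>)) + \<mu> * integral {0..2 * pi} (\<lambda>\<theta>. ?v (t, \<theta>)))"
  proof -
    have "((\<lambda>t. integral {0..2 * pi} (\<lambda>\<theta>. C.P (t, \<theta>)) + \<mu> * integral {0..2 * pi} (\<lambda>\<theta>. ?v (t, \<theta>))) has_integral
      C.dirichlet + \<mu> * integral {1..b} (\<lambda>t. integral {0..2 * pi} (\<lambda>\<theta>. ?v (t, \<theta>)))) {1..b}"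
      unfolding C.dirichlet_def
      by (intro has_integral_add has_integral_mult_right integrable_integral integrable_continuous_real C.slice_integral_cont C.P_cont vc)
    then show ?thesis by (simp only: integral_unique)
  qed
  also have "\<dots> = C.energy \<mu>"
    unfolding C.energy_def
  proof (rule integral_cong)
    fix t assume "t \<in> {1..b}"
    have "((\<lambda>\<theta>. C.P (t, \<theta>) + \<mu> * ?v (t, \<theta>)) has_integral
      integral {0..2 * pi} (\<lambda>\<theta>. C.P (t, \<theta>)) + \<mu> * integral {0..2 * pi} (\<lambda>\<theta>. ?v (t, \<theta>))) {0..2 * pi}"
      by (intro has_integral_add has_integral_mult_right integrable_integral integrable_continuous_real C.slice_cont C.P_cont vc)
    then have "integral {0..2 * pi} (\<lambda>\<theta>. C.P (t, \<theta>)) + \<mu> * integral {0..2 * pi} (\<lambda>\<theta>. ?v (t, \<theta>)) 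
      = integral {0..2 * pi} (\<lambda>\<theta>. C.P (t, \<theta>) + \<mu> * ?v (t, \<theta>))"
      by (simp only: integral_unique)
    also have "\<dots> = integral {0..2 * pi} (\<lambda>\<theta>. (cylt f (t, \<theta>))\<^sup>2 + (cylh f (t, \<theta>))\<^sup>2 + \<mu> * (cyl f (t, \<theta>))\<^sup>2 / t\<^sup>2)"
      using \<open>t \<in> {1..b}\<close> by (simp add: C.P_def)
    finally show "integral {0..2 * pi} (\<lambda>\<theta>. C.P (t, \<theta>)) + \<mu> * integral {0..2 * pi} (\<lambda>\<theta>. ?v (t, \<theta>)) = \<dots>" .
  qed
  finally show "Q f = C.energy \<mu>" .
qed

lemma q_integrable: "f \<in> T \<Longrightarrow> integrable (lebesgue_on B) (q f)"
  using T_annulus[of f] Q_energy(1)[of f] by metis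

lemma Q_nonneg: assumes "f \<in> T" shows "0 \<le> Q f"
proof -
  obtain b where b: "1 \<le> b" "\<And>x. x \<in> supp f \<Longrightarrow> exp (- b) < norm x" using T_annulus[OF assms] by blast
  then show ?thesis using cylinder_fn.energy_nonneg[OF cyl_cylinder_fn[OF assms b] \<mu>] Q_energy(2)[OF assms b] by simp
qed

lemma Moser_Trudinger_test:
  assumes f: "f \<in> T" and Q: "Q f < 1"
  shows "(\<integral>\<^sup>+x. ennreal (exp (4 * pi * sqrt (1 + 4 * \<mu>) * \<bar>f x\<bar>\<^sup>2)) \<partial>lebesgue_on B) \<le> ennreal (MT_const \<mu>)"
proof -
  obtain b where b: "1 \<le> b" "\<And>x. x \<in> supp f \<Longrightarrow> exp (- b) < norm x" using T_annulus[OF f] by blast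
  interpret C: cylinder_fn "cyl f" "cylt f" "cylh f" b by (rule cyl_cylinder_fn[OF f b])
  have [measurable]: "f \<in> borel_measurable borel" by (rule T_measurable[OF f])
  have "(\<integral>\<^sup>+x. ennreal (exp (4 * pi * sqrt (1 + 4 * \<mu>) * \<bar>f x\<bar>\<^sup>2)) \<partial>lebesgue_on B)
    = (\<integral>\<^sup>+t\<in>{1..}. (\<integral>\<^sup>+\<theta>\<in>{0..2 * pi}. ennreal (exp (4 * pi * sqrt (1 + 4 * \<mu>) * (cyl f (t, \<theta>))\<^sup>2 - 2 * t)) \<partial>lborel) \<partial>lborel)"
    by (subst nn_integral_ball_polar) (simp_all add: cyl_def exp_diff exp_minus divide_inverse flip: ennreal_mult)
  also have "\<dots> \<le> ennreal (MT_const \<mu>)"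
    using Q Q_energy(2)[OF f b] by (intro C.Moser_Trudinger \<mu>) simp
  finally show ?thesis .
qed

lemma grad_lincomb:
  assumes "f \<in> T" "g \<in> T"
  shows "grad (\<lambda>x. \<alpha> * f x + \<beta> * g x) x = \<alpha> *\<^sub>R grad f x + \<beta> *\<^sub>R grad g x"
  using test_functionsD(4)[OF test_functions_lincomb[OF assms, of \<alpha> \<beta>]] test_functionsD(4)[OF assms(1)] test_functionsD(4)[OF assms(2)]
  by (simp add: grad_eq pd_lincomb scaleR_sum_right scaleR_add_left sum.distrib)

definition q2 :: "(real^2 \<Rightarrow> real) \<Rightarrow> (real^2 \<Rightarrow> real) \<Rightarrow> real^2 \<Rightarrow> real" where
  "q2 f g x = grad f x \<bullet> grad g x + \<mu> * V (norm x) * (f x * g x)"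

definition Q2 :: "(real^2 \<Rightarrow> real) \<Rightarrow> (real^2 \<Rightarrow> real) \<Rightarrow> real" where
  "Q2 f g = (LINT x|lebesgue_on B. q2 f g x)"

lemma q_lincomb:
  assumes "f \<in> T" "g \<in> T"
  shows "q (\<lambda>x. \<alpha> * f x + \<beta> * g x) x = \<alpha>\<^sup>2 * q f x + 2 * \<alpha> * \<beta> * q2 f g x + \<beta>\<^sup>2 * q g x"
  unfolding q_def q2_def grad_lincomb[OF assms] power2_norm_eq_inner
  by (simp add: inner_add_left inner_add_right inner_commute power2_eq_square algebra_simps)

lemma q2_integrable:
  assumes "f \<in> T" "g \<in> T"
  shows "integrable (lebesgue_on B) (q2 f g)"
proof -
  have "q2 f g = (\<lambda>x. (q (\<lambda>x. 1 * f x + 1 * g x) x - q f x - q g x) / 2)"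
    unfolding q_lincomb[OF assms] by (auto simp: fun_eq_iff)
  moreover have "integrable (lebesgue_on B) (\<lambda>x. (q (\<lambda>x. 1 * f x + 1 * g x) x - q f x - q g x) / 2)"
    using q_integrable assms test_functions_lincomb[OF assms]
    by (intro integrable_divide_zero Bochner_Integration.integrable_diff) blast+
  ultimately show ?thesis by simp
qed

lemma Q_lincomb:
  assumes "f \<in> T" "g \<in> T"
  shows "Q (\<lambda>x. \<alpha> * f x + \<beta> * g x) = \<alpha>\<^sup>2 * Q f + 2 * \<alpha> * \<beta> * Q2 f g + \<beta>\<^sup>2 * Q g"
  unfolding Q_def q_lincomb[OF assms] Q2_def
  using q_integrable assms q2_integrable[OF assms] by simp

lemma Q2_Cauchy_Schwarz:
  assumes "f \<in> T" "g \<in> T"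
  shows "(Q2 f g)\<^sup>2 \<le> Q f * Q g"
proof -
  have *: "0 \<le> \<alpha>\<^sup>2 * Q f + 2 * \<alpha> * \<beta> * Q2 f g + \<beta>\<^sup>2 * Q g" for \<alpha> \<beta>
    unfolding Q_lincomb[OF assms, symmetric] by (intro Q_nonneg test_functions_lincomb assms)
  show ?thesis
  proof (cases "Q g = 0")
    case True
    have "Q2 f g = 0"
    proof (rule ccontr)
      assume "Q2 f g \<noteq> 0"
      then show False using *[of 1 "- (Q f + 1) / (2 * Q2 f g)"] True Q_nonneg[OF assms(1)] by (simp add: field_simps)
    qed
    then show ?thesis using True by simp
  next
    case False
    have "0 \<le> Q g * (Q f * Q g - (Q2 f g)\<^sup>2)" using *[of "Q g" "- Q2 f g"] by (simp add: power2_eq_square algebra_simps)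
    then have "0 \<le> Q f * Q g - (Q2 f g)\<^sup>2" using False Q_nonneg[OF assms(2)] by (simp add: zero_le_mult_iff)
    then show ?thesis by simp
  qed
qed

lemma T_diff: "f \<in> T \<Longrightarrow> g \<in> T \<Longrightarrow> (\<lambda>x. f x - g x) \<in> T"
  using test_functions_lincomb[of f _ g 1 "-1"] by simp

lemma T_scale: "f \<in> T \<Longrightarrow> (\<lambda>x. \<alpha> * f x) \<in> T"
  using test_functions_lincomb[of f _ f \<alpha> 0] by simp

lemma Q_scale: "f \<in> T \<Longrightarrow> Q (\<lambda>x. \<alpha> * f x) = \<alpha>\<^sup>2 * Q f"
  using Q_lincomb[of f f \<alpha> 0] by simp

lemma Q_diff: "f \<in> T \<Longrightarrow> g \<in> T \<Longrightarrow> Q (\<lambda>x. f x - g x) = Q f - 2 * Q2 f g + Q g"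
  using Q_lincomb[of f g 1 "-1"] by simp

lemma pre_norm_diff_ge:
  assumes "f \<in> T" "g \<in> T"
  shows "\<bar>pre_norm V \<mu> r0 f - pre_norm V \<mu> r0 g\<bar> \<le> pre_norm V \<mu> r0 (\<lambda>x. f x - g x)"
proof -
  have "Q2 f g \<le> sqrt (Q f) * sqrt (Q g)"
    using Q2_Cauchy_Schwarz[OF assms] by (metis abs_le_D1 real_sqrt_abs real_sqrt_le_mono real_sqrt_mult)
  then have "(sqrt (Q f) - sqrt (Q g))\<^sup>2 \<le> Q (\<lambda>x. f x - g x)"
    using Q_nonneg assms by (simp add: Q_diff power2_diff)
  then show ?thesis unfolding pre_norm_Q by (metis real_sqrt_abs real_sqrt_le_mono)
qed

text \<open>The products \<open>f * pd b h\<close> are compactly supported and continuously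
  differentiable, so their derivatives integrate to 0. All derivatives thereby move from f to h, and
  f enters only through an L^2 pairing.\<close>

lemma Q2_eq_Laplace:
  assumes f: "f \<in> T" and h: "h \<in> T"
  shows "Q2 f h = (LINT x|lebesgue_on B. f x * (\<mu> * V (norm x) * h x - (\<Sum>b\<in>Basis. pd b (pd b h) x)))"
    (is "_ = (LINT x|_. ?R x)")
proof -
  note meas = borel_measurable_continuous_onI[OF test_functionsD(5)] borel_measurable_continuous_onI[OF test_functionsD(6)]
  have [measurable]: "f \<in> borel_measurable borel" "h \<in> borel_measurable borel"
    using f h by (auto intro: meas)
  have [measurable]: "pd b f \<in> borel_measurable borel" "pd b h \<in> borel_measurable borel" "pd b (pd b h) \<in> borel_measurable borel" if "b \<in> Basis" for b
    using meas(2)[OF f that] meas(2)[OF h that] meas(2)[OF test_functions_pd[OF h that] that] by auto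
  have z: "integral\<^sup>L lborel (pd b (\<lambda>x. f x * pd b h x)) = 0" and zi: "integrable lborel (pd b (\<lambda>x. f x * pd b h x))" if b: "b \<in> Basis" for b
  proof -
    have d: "f differentiable (at x)" "pd b h differentiable (at x)" for x
      using test_functionsD(4) f test_functions_pd[OF h b] by blast+
    have eq: "pd b (\<lambda>x. f x * pd b h x) = (\<lambda>x. f x * pd b (pd b h) x + pd b f x * pd b h x)"
      by (rule ext) (rule pd_mult[OF d])
    have c: "continuous_on S (pd b (\<lambda>x. f x * pd b h x))" for S
      unfolding eq using b f h test_functions_pd[OF h b]
      by (intro continuous_intros test_functionsD(5,6)) auto
    have sub: "supp (\<lambda>x. f x * pd b h x) \<subseteq> supp f"
      unfolding supp_def[of "\<lambda>x. f x * pd b h x"] 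
    proof (rule closure_minimal)
      show "{x. f x * pd b h x \<noteq> 0} \<subseteq> supp f"
        by (rule subsetI, rule ccontr) (simp add: not_supp)
      show "closed (supp f)" by (simp add: supp_def)
    qed
    then have "supp f \<inter> supp (\<lambda>x. f x * pd b h x) = supp (\<lambda>x. f x * pd b h x)" by blast
    moreover have "compact (supp f \<inter> supp (\<lambda>x. f x * pd b h x))"
      by (intro compact_Int_closed test_functionsD(2)[OF f]) (simp add: supp_def[of "\<lambda>x. f x * pd b h x"])
    ultimately have K: "compact (supp (\<lambda>x. f x * pd b h x))" by simp
    show "integral\<^sup>L lborel (pd b (\<lambda>x. f x * pd b h x)) = 0"
      by (rule integral_pd_zero[OF _ c b K]) (intro derivative_intros d)
    have "integrable lborel (\<lambda>x. indicator (supp (\<lambda>x. f x * pd b h x)) x *\<^sub>R pd b (\<lambda>x. f x * pd b h x) x)"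
      by (rule borel_integrable_compact[OF K c])
    moreover have "(\<lambda>x. indicator (supp (\<lambda>x. f x * pd b h x)) x *\<^sub>R pd b (\<lambda>x. f x * pd b h x) x) = pd b (\<lambda>x. f x * pd b h x)"
      using pd_not_supp[of _ "\<lambda>x. f x * pd b h x" b] by (auto simp: fun_eq_iff indicator_def)
    ultimately show "integrable lborel (pd b (\<lambda>x. f x * pd b h x))" by simp
  qed
  have mult: "pd b (\<lambda>x. f x * pd b h x) x = f x * pd b (pd b h) x + pd b f x * pd b h x" if "b \<in> Basis" for b x
    using test_functionsD(4)[OF f] test_functionsD(4)[OF test_functions_pd[OF h that]] by (rule pd_mult)
  have q2: "q2 f h x = ?R x + (\<Sum>b\<in>Basis. pd b (\<lambda>x. f x * pd b h x) x)" for x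
    unfolding q2_def inner_grad[OF test_functionsD(4)[OF f] test_functionsD(4)[OF h]]
    by (simp add: mult sum.distrib sum_distrib_left algebra_simps)
  have Q2: "Q2 f h = integral\<^sup>L lborel (q2 f h)" and q2i: "integrable lborel (q2 f h)"
  proof -
    have [measurable]: "pd b (\<lambda>x. f x * pd b h x) \<in> borel_measurable borel" if "b \<in> Basis" for b
      using borel_measurable_integrable[OF zi[OF that]] by simp
    have m: "q2 f h \<in> borel_measurable borel"
      unfolding q2 by measurable
    have zero: "q2 f h x = 0" if "x \<notin> B" for x
      using that T_zero[OF f] T_pd_zero[OF f] by (simp add: q2_def inner_grad[OF test_functionsD(4)[OF f] test_functionsD(4)[OF h]])
    show "Q2 f h = integral\<^sup>L lborel (q2 f h)" "integrable lborel (q2 f h)"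
      using LINT_lebesgue_on[OF m, of B] zero q2_integrable[OF f h] unfolding Q2_def by auto
  qed
  have R: "?R x = q2 f h x - (\<Sum>b\<in>Basis. pd b (\<lambda>x. f x * pd b h x) x)" for x using q2[of x] by simp
  have "integral\<^sup>L lborel ?R = integral\<^sup>L lborel (q2 f h) - (\<Sum>b\<in>Basis. integral\<^sup>L lborel (pd b (\<lambda>x. f x * pd b h x)))"
    unfolding R using q2i zi by (simp add: Bochner_Integration.integral_sum)
  then have "Q2 f h = integral\<^sup>L lborel ?R" using Q2 z by simp
  also have "\<dots> = (LINT x|lebesgue_on B. ?R x)"
    by (rule LINT_lebesgue_on(1)[symmetric]) (use T_zero[OF f] in auto)
  finally show ?thesis .
qed

end

context log_hardy begin

text \<open>On the support, |x| > exp (-b) bounds 1 / |x|^2, and |x| < 1/e gives ln (1/|x|) \<ge> 1;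
  hence V is at most exp (2b) there.\<close>

lemma V_bounded_on_supp:
  assumes h: "h \<in> T"
  obtains M where "0 \<le> M" "\<And>x. \<bar>V (norm x) * h x\<bar> \<le> M"
proof -
  obtain b where b: "1 \<le> b" "\<And>x. x \<in> supp h \<Longrightarrow> exp (- b) < norm x" using T_annulus[OF h] by blast
  obtain M where M: "0 \<le> M" "\<And>x. \<bar>h x\<bar> \<le> M"
    using compact_support_bounded[OF test_functionsD(5)[OF h] test_functionsD(2)[OF h] not_supp[of _ h]] by blast
  show ?thesis
  proof (rule that)
    show "0 \<le> exp (2 * b) * M" using M by simp
    show "\<bar>V (norm x) * h x\<bar> \<le> exp (2 * b) * M" for x
    proof (cases "x \<in> supp h")
      case True
      then have "x \<in> ball 0 (exp (- 1))" using test_functionsD(3)[OF h] unfolding B_eq by blast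
      then have n: "exp (- b) < norm x" "norm x < exp (- 1)" using b(2)[OF True] by auto
      have pos: "0 < norm x" using n(1) exp_gt_zero[of "- b"] by linarith
      have "ln (norm x) < - 1" using n(2) pos by (metis exp_less_cancel_iff exp_ln)
      then have "1 \<le> ln (1 / norm x)" using pos by (simp add: ln_div)
      then have "1 \<le> (ln (1 / norm x))\<^sup>2" by (rule one_le_power)
      moreover have "(exp (- b))\<^sup>2 \<le> (norm x)\<^sup>2" using n by (intro power_mono) auto
      ultimately have "(exp (- b))\<^sup>2 * 1 \<le> (norm x)\<^sup>2 * (ln (1 / norm x))\<^sup>2" by (intro mult_mono) auto
      then have "V (norm x) \<le> 1 / (exp (- b))\<^sup>2" unfolding V by (intro divide_left_mono) (auto intro!: mult_pos_pos)
      also have "\<dots> = exp (2 * b)" by (simp add: power2_eq_square exp_minus inverse_eq_divide flip: exp_add)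
      finally show ?thesis using V_nonneg[of "norm x"] M by (auto simp: abs_mult intro!: mult_mono)
    qed (use M in \<open>simp add: not_supp\<close>)
  qed
qed

text \<open>After integration by parts the factor of \<eta> n is a fixed function bounded by K.
  Cauchy-Schwarz on the ball, which has finite measure, bounds the pairing by a multiple of the L^2
  norm of \<eta> n.\<close>

lemma Q2_tendsto_0:
  assumes \<eta>: "\<And>n. \<eta> n \<in> T" and h: "h \<in> T"
    and L2: "(\<lambda>n. \<integral>\<^sup>+x. ennreal ((\<eta> n x)\<^sup>2) \<partial>lebesgue_on B) \<longlonglongrightarrow> 0"
  shows "(\<lambda>n. Q2 (\<eta> n) h) \<longlonglongrightarrow> 0"
proof -
  let ?R = "\<lambda>x. \<mu> * V (norm x) * h x - (\<Sum>b\<in>Basis. pd b (pd b h) x)"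
  obtain M where M: "0 \<le> M" "\<And>x. \<bar>V (norm x) * h x\<bar> \<le> M" using V_bounded_on_supp[OF h] by blast
  have "\<exists>N. 0 \<le> N \<and> (\<forall>x. \<bar>pd b (pd b h) x\<bar> \<le> N)" if "b \<in> Basis" for b
  proof -
    have t: "pd b (pd b h) \<in> T" using test_functions_pd h that by blast
    show ?thesis using compact_support_bounded[OF test_functionsD(5)[OF t] test_functionsD(2)[OF t] not_supp[of _ "pd b (pd b h)"]] by metis
  qed
  then obtain N where N: "\<And>b x. b \<in> Basis \<Longrightarrow> \<bar>pd b (pd b h) x\<bar> \<le> N b" by metis
  define K where "K = \<bar>\<mu>\<bar> * M + (\<Sum>b\<in>Basis. N b)"
  have R: "\<bar>?R x\<bar> \<le> K" for x
  proof -
    have "\<bar>?R x\<bar> \<le> \<bar>\<mu> * V (norm x) * h x\<bar> + \<bar>\<Sum>b\<in>Basis. pd b (pd b h) x\<bar>" by (rule abs_triangle_ineq4)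
    also have "\<bar>\<mu> * V (norm x) * h x\<bar> = \<bar>\<mu>\<bar> * \<bar>V (norm x) * h x\<bar>" by (simp add: abs_mult)
    also have "\<dots> \<le> \<bar>\<mu>\<bar> * M" using M by (intro mult_left_mono) auto
    also have "\<bar>\<Sum>b\<in>Basis. pd b (pd b h) x\<bar> \<le> (\<Sum>b\<in>Basis. N b)"
      by (rule order_trans[OF sum_abs sum_mono]) (rule N)
    finally show ?thesis by (simp add: K_def)
  qed
  then have K: "0 \<le> K" by (meson abs_ge_zero order_trans)
  have le: "ennreal ((Q2 (\<eta> n) h)\<^sup>2) \<le> (ennreal (K\<^sup>2) * emeasure (lebesgue_on B) (space (lebesgue_on B))) * (\<integral>\<^sup>+x. ennreal ((\<eta> n x)\<^sup>2) \<partial>lebesgue_on B)" for n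
  proof -
    have m: "\<eta> n \<in> borel_measurable (lebesgue_on B)"
      using T_measurable[OF \<eta>[of n]] by (intro measurable_restrict_space1 measurable_completion) simp
    have "ennreal \<bar>Q2 (\<eta> n) h\<bar> \<le> (\<integral>\<^sup>+x. ennreal \<bar>\<eta> n x * ?R x\<bar> \<partial>lebesgue_on B)"
    proof (cases "integrable (lebesgue_on B) (\<lambda>x. \<eta> n x * ?R x)")
      case True
      then show ?thesis
        using integral_norm_bound_ennreal[OF True] by (simp add: Q2_eq_Laplace[OF \<eta> h])
    next
      case False
      \<comment> \<open>Without integrability the integral has the default value 0, and the bound is
        trivial.\<close>
      then show ?thesis by (simp add: Q2_eq_Laplace[OF \<eta> h] not_integrable_integral_eq)
    qed
    also have "\<dots> \<le> (\<integral>\<^sup>+x. ennreal \<bar>\<eta> n x\<bar> * ennreal K \<partial>lebesgue_on B)"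
      using R by (intro nn_integral_mono) (auto simp: abs_mult ennreal_mult[symmetric] K intro!: ennreal_leI mult_left_mono)
    finally have "(ennreal \<bar>Q2 (\<eta> n) h\<bar>)\<^sup>2 \<le> (\<integral>\<^sup>+x. ennreal \<bar>\<eta> n x\<bar> * ennreal K \<partial>lebesgue_on B)\<^sup>2"
      by (rule power_mono) simp
    also have "\<dots> \<le> (\<integral>\<^sup>+x. (ennreal \<bar>\<eta> n x\<bar>)\<^sup>2 \<partial>lebesgue_on B) * (\<integral>\<^sup>+x. (ennreal K)\<^sup>2 \<partial>lebesgue_on B)"
      using m by (intro Cauchy_Schwarz_nn_integral) auto
    finally show ?thesis using K by (simp add: ennreal_power mult_ac)
  qed
  have fin: "ennreal (K\<^sup>2) * emeasure (lebesgue_on B) (space (lebesgue_on B)) < \<infinity>"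
    using emeasure_bounded_finite[OF bounded_ball, of "0 :: real^2" r0]
    by (simp add: space_restrict_space emeasure_restrict_space ennreal_mult_less_top)
  have "(\<lambda>n. (ennreal (K\<^sup>2) * emeasure (lebesgue_on B) (space (lebesgue_on B))) * (\<integral>\<^sup>+x. ennreal ((\<eta> n x)\<^sup>2) \<partial>lebesgue_on B)) \<longlonglongrightarrow> 
      (ennreal (K\<^sup>2) * emeasure (lebesgue_on B) (space (lebesgue_on B))) * 0"
    using fin L2 by (intro ennreal_tendsto_cmult) auto
  then have lim: "(\<lambda>n. (ennreal (K\<^sup>2) * emeasure (lebesgue_on B) (space (lebesgue_on B))) * (\<integral>\<^sup>+x. ennreal ((\<eta> n x)\<^sup>2) \<partial>lebesgue_on B)) \<longlonglongrightarrow> 0"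
    by simp
  have "(\<lambda>n. ennreal ((Q2 (\<eta> n) h)\<^sup>2)) \<longlonglongrightarrow> 0"
    by (rule tendsto_sandwich[OF _ always_eventually[OF allI[OF le]] tendsto_const lim]) simp
  then have "(\<lambda>n. ennreal ((Q2 (\<eta> n) h)\<^sup>2)) \<longlonglongrightarrow> ennreal 0" by simp
  then have "(\<lambda>n. (Q2 (\<eta> n) h)\<^sup>2) \<longlonglongrightarrow> 0"
    by (subst (asm) tendsto_ennreal_iff) auto
  then have "(\<lambda>n. sqrt ((Q2 (\<eta> n) h)\<^sup>2)) \<longlonglongrightarrow> sqrt 0" by (rule tendsto_real_sqrt)
  then show ?thesis by (simp add: tendsto_rabs_zero_iff)
qed

text \<open>
  \<open>Q (\<eta> n) \<le> Q (\<eta> n - \<eta> N) + 2 Q2 (\<eta> n) (\<eta> N)\<close>, where the last term tends to 0 for fixed \<open>N\<close>: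
  after integration by parts it is the \<open>L\<^sup>2\<close> product of \<open>\<eta> n\<close> with a fixed bounded function.
\<close>

lemma Q_closable:
  assumes \<eta>: "\<And>n. \<eta> n \<in> T"
    and Cauchy: "\<And>\<epsilon>. 0 < \<epsilon> \<Longrightarrow> \<exists>N. \<forall>m\<ge>N. \<forall>n\<ge>N. pre_norm V \<mu> r0 (\<lambda>x. \<eta> m x - \<eta> n x) < \<epsilon>"
    and L2: "(\<lambda>n. \<integral>\<^sup>+x. ennreal ((\<eta> n x)\<^sup>2) \<partial>lebesgue_on B) \<longlonglongrightarrow> 0"
  shows "(\<lambda>n. pre_norm V \<mu> r0 (\<eta> n)) \<longlonglongrightarrow> 0"
proof -
  have "(\<lambda>n. Q (\<eta> n)) \<longlonglongrightarrow> 0"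
  proof (rule LIMSEQ_I)
    fix r :: real assume r: "0 < r"
    obtain N where N: "\<And>m n. m \<ge> N \<Longrightarrow> n \<ge> N \<Longrightarrow> pre_norm V \<mu> r0 (\<lambda>x. \<eta> m x - \<eta> n x) < sqrt (r / 2)"
      using Cauchy[of "sqrt (r / 2)"] r by auto
    have "(\<lambda>n. Q2 (\<eta> n) (\<eta> N)) \<longlonglongrightarrow> 0" by (rule Q2_tendsto_0[OF \<eta> \<eta> L2])
    then obtain N' where N': "\<And>n. n \<ge> N' \<Longrightarrow> \<bar>Q2 (\<eta> n) (\<eta> N)\<bar> < r / 4"
      using LIMSEQ_D[of _ 0 "r / 4"] r by fastforce
    have "norm (Q (\<eta> n) - 0) < r" if n: "n \<ge> max N N'" for n
    proof -
      have "Q (\<lambda>x. \<eta> n x - \<eta> N x) < r / 2" using N[of n N] n by (simp add: pre_norm_Q)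
      moreover have "Q (\<lambda>x. \<eta> n x - \<eta> N x) = Q (\<eta> n) - 2 * Q2 (\<eta> n) (\<eta> N) + Q (\<eta> N)" by (rule Q_diff[OF \<eta> \<eta>])
      moreover have "\<bar>Q2 (\<eta> n) (\<eta> N)\<bar> < r / 4" using N' n by simp
      ultimately have "Q (\<eta> n) < r" using Q_nonneg[OF \<eta>[of N]] by linarith
      then show ?thesis using Q_nonneg[OF \<eta>[of n]] by simp
    qed
    then show "\<exists>no. \<forall>n\<ge>no. norm (Q (\<eta> n) - 0) < r" by blast
  qed
  then have "(\<lambda>n. sqrt (Q (\<eta> n))) \<longlonglongrightarrow> sqrt 0" by (rule tendsto_real_sqrt)
  then show ?thesis by (simp add: pre_norm_Q)
qed

lemma pre_norm_triangle:
  assumes "f \<in> T" "g \<in> T"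
  shows "pre_norm V \<mu> r0 (\<lambda>x. f x - g x) \<le> pre_norm V \<mu> r0 f + pre_norm V \<mu> r0 g"
proof -
  have "\<bar>pre_norm V \<mu> r0 (\<lambda>x. f x - g x) - pre_norm V \<mu> r0 (\<lambda>x. (-1) * g x)\<bar> \<le> pre_norm V \<mu> r0 (\<lambda>x. (f x - g x) - (-1) * g x)"
    by (intro pre_norm_diff_ge T_diff T_scale assms)
  moreover have "pre_norm V \<mu> r0 (\<lambda>x. (-1) * g x) = pre_norm V \<mu> r0 g"
    unfolding pre_norm_Q Q_scale[OF assms(2)] by simp
  ultimately show ?thesis by simp
qed

section \<open>The completion as a function space and its norm\<close>

lemma representsD:
  assumes "represents V \<mu> r0 \<phi> u"
  shows "\<phi> n \<in> T" "0 < \<epsilon> \<Longrightarrow> \<exists>N. \<forall>m\<ge>N. \<forall>n\<ge>N. pre_norm V \<mu> r0 (\<lambda>x. \<phi> m x - \<phi> n x) < \<epsilon>"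
    "u \<in> borel_measurable (lebesgue_on B)" "(\<lambda>n. \<integral>\<^sup>+x. ennreal ((\<phi> n x - u x)\<^sup>2) \<partial>lebesgue_on B) \<longlonglongrightarrow> 0"
  using assms unfolding represents_def by auto

lemma T_measurable_on: "f \<in> T \<Longrightarrow> f \<in> borel_measurable (lebesgue_on B)"
  using T_measurable[of f] by (intro measurable_restrict_space1 measurable_completion) simp

text \<open>The difference of two representing sequences is Cauchy and tends to 0 in L^2, so
  closability applies to it.\<close>

lemma represents_diff:
  assumes "represents V \<mu> r0 \<phi> u" "represents V \<mu> r0 \<phi>' u"
  shows "(\<lambda>n. pre_norm V \<mu> r0 (\<lambda>x. \<phi> n x - \<phi>' n x)) \<longlonglongrightarrow> 0"
proof (rule Q_closable)
  note D = representsD[OF assms(1)] and D' = representsD[OF assms(2)]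
  show "(\<lambda>x. \<phi> n x - \<phi>' n x) \<in> T" for n by (intro T_diff D D')
  show "\<exists>N. \<forall>m\<ge>N. \<forall>n\<ge>N. pre_norm V \<mu> r0 (\<lambda>x. \<phi> m x - \<phi>' m x - (\<phi> n x - \<phi>' n x)) < \<epsilon>" if \<epsilon>: "0 < \<epsilon>" for \<epsilon>
  proof -
    obtain N where N: "\<And>m n. m \<ge> N \<Longrightarrow> n \<ge> N \<Longrightarrow> pre_norm V \<mu> r0 (\<lambda>x. \<phi> m x - \<phi> n x) < \<epsilon> / 2"
      using D(2)[of "\<epsilon> / 2"] \<epsilon> by auto
    obtain N' where N': "\<And>m n. m \<ge> N' \<Longrightarrow> n \<ge> N' \<Longrightarrow> pre_norm V \<mu> r0 (\<lambda>x. \<phi>' m x - \<phi>' n x) < \<epsilon> / 2"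
      using D'(2)[of "\<epsilon> / 2"] \<epsilon> by auto
    have "pre_norm V \<mu> r0 (\<lambda>x. \<phi> m x - \<phi>' m x - (\<phi> n x - \<phi>' n x)) < \<epsilon>" if "m \<ge> max N N'" "n \<ge> max N N'" for m n
    proof -
      have eq: "(\<lambda>x. \<phi> m x - \<phi>' m x - (\<phi> n x - \<phi>' n x)) = (\<lambda>x. (\<phi> m x - \<phi> n x) - (\<phi>' m x - \<phi>' n x))" by auto
      show ?thesis
        unfolding eq using pre_norm_triangle[OF T_diff[OF D(1)[of m] D(1)[of n]] T_diff[OF D'(1)[of m] D'(1)[of n]]] N[of m n] N'[of m n] that by simp
    qed
    then show ?thesis by blast
  qed
  show "(\<lambda>n. \<integral>\<^sup>+x. ennreal ((\<phi> n x - \<phi>' n x)\<^sup>2) \<partial>lebesgue_on B) \<longlonglongrightarrow> 0"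
  proof (rule tendsto_sandwich[OF _ _ tendsto_const])
    have [measurable]: "\<phi> n \<in> borel_measurable (lebesgue_on B)" "\<phi>' n \<in> borel_measurable (lebesgue_on B)" "u \<in> borel_measurable (lebesgue_on B)" for n
      using D D' by (auto intro: T_measurable_on)
    have "(\<integral>\<^sup>+x. ennreal ((\<phi> n x - \<phi>' n x)\<^sup>2) \<partial>lebesgue_on B)
      \<le> (\<integral>\<^sup>+x. 2 * ennreal ((\<phi> n x - u x)\<^sup>2) + 2 * ennreal ((\<phi>' n x - u x)\<^sup>2) \<partial>lebesgue_on B)" for n
    proof (rule nn_integral_mono)
      fix x
      have "(\<phi> n x - \<phi>' n x)\<^sup>2 \<le> 2 * (\<phi> n x - u x)\<^sup>2 + 2 * (\<phi>' n x - u x)\<^sup>2"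
        using zero_le_power2[of "(\<phi> n x - u x) + (\<phi>' n x - u x)"] by (simp add: power2_eq_square algebra_simps)
      then have "ennreal ((\<phi> n x - \<phi>' n x)\<^sup>2) \<le> ennreal (2 * (\<phi> n x - u x)\<^sup>2 + 2 * (\<phi>' n x - u x)\<^sup>2)" by (rule ennreal_leI)
      also have "\<dots> = 2 * ennreal ((\<phi> n x - u x)\<^sup>2) + 2 * ennreal ((\<phi>' n x - u x)\<^sup>2)"
        by (simp add: ennreal_mult)
      finally show "ennreal ((\<phi> n x - \<phi>' n x)\<^sup>2) \<le> \<dots>" .
    qed
    also have "(\<integral>\<^sup>+x. 2 * ennreal ((\<phi> n x - u x)\<^sup>2) + 2 * ennreal ((\<phi>' n x - u x)\<^sup>2) \<partial>lebesgue_on B)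
      = 2 * (\<integral>\<^sup>+x. ennreal ((\<phi> n x - u x)\<^sup>2) \<partial>lebesgue_on B) + 2 * (\<integral>\<^sup>+x. ennreal ((\<phi>' n x - u x)\<^sup>2) \<partial>lebesgue_on B)" for n
      by (simp add: nn_integral_add nn_integral_cmult)
    finally show "\<forall>\<^sub>F n in sequentially. (\<integral>\<^sup>+x. ennreal ((\<phi> n x - \<phi>' n x)\<^sup>2) \<partial>lebesgue_on B)
      \<le> 2 * (\<integral>\<^sup>+x. ennreal ((\<phi> n x - u x)\<^sup>2) \<partial>lebesgue_on B) + 2 * (\<integral>\<^sup>+x. ennreal ((\<phi>' n x - u x)\<^sup>2) \<partial>lebesgue_on B)"
      by (rule always_eventually[OF allI])
    have "(\<lambda>n. 2 * (\<integral>\<^sup>+x. ennreal ((\<phi> n x - u x)\<^sup>2) \<partial>lebesgue_on B) + 2 * (\<integral>\<^sup>+x. ennreal ((\<phi>' n x - u x)\<^sup>2) \<partial>lebesgue_on B)) \<longlonglongrightarrow> 2 * 0 + 2 * 0"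
      by (intro tendsto_add ennreal_tendsto_cmult D D') auto
    then show "(\<lambda>n. 2 * (\<integral>\<^sup>+x. ennreal ((\<phi> n x - u x)\<^sup>2) \<partial>lebesgue_on B) + 2 * (\<integral>\<^sup>+x. ennreal ((\<phi>' n x - u x)\<^sup>2) \<partial>lebesgue_on B)) \<longlonglongrightarrow> 0"
      by simp
  qed simp
qed

text \<open>The pre-norms converge by the reverse triangle inequality, and
  \<open>represents_diff\<close> gives the same limit for every representing sequence. This resolves
  the definite description in \<open>H1_norm\<close>.\<close>

lemma H1_norm_limit:
  assumes \<phi>: "represents V \<mu> r0 \<phi> u"
  shows "(\<lambda>n. pre_norm V \<mu> r0 (\<phi> n)) \<longlonglongrightarrow> H1_norm V \<mu> r0 u"
proof -
  note D = representsD[OF \<phi>]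
  have "Cauchy (\<lambda>n. pre_norm V \<mu> r0 (\<phi> n))"
  proof (rule metric_CauchyI)
    fix e :: real assume "0 < e"
    then obtain N where N: "\<And>m n. m \<ge> N \<Longrightarrow> n \<ge> N \<Longrightarrow> pre_norm V \<mu> r0 (\<lambda>x. \<phi> m x - \<phi> n x) < e"
      using D(2)[of e] by auto
    have "dist (pre_norm V \<mu> r0 (\<phi> m)) (pre_norm V \<mu> r0 (\<phi> n)) < e" if "m \<ge> N" "n \<ge> N" for m n
      using pre_norm_diff_ge[OF D(1)[of m] D(1)[of n]] N[OF that] by (simp add: dist_real_def)
    then show "\<exists>M. \<forall>m\<ge>M. \<forall>n\<ge>M. dist (pre_norm V \<mu> r0 (\<phi> m)) (pre_norm V \<mu> r0 (\<phi> n)) < e" by blast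
  qed
  then obtain N where N: "(\<lambda>n. pre_norm V \<mu> r0 (\<phi> n)) \<longlonglongrightarrow> N"
    using Cauchy_convergent convergent_def by blast
  have "N' = N" if \<phi>': "represents V \<mu> r0 \<phi>' u" "(\<lambda>n. pre_norm V \<mu> r0 (\<phi>' n)) \<longlonglongrightarrow> N'" for \<phi>' N'
  proof -
    have "(\<lambda>n. pre_norm V \<mu> r0 (\<phi> n) - pre_norm V \<mu> r0 (\<phi>' n)) \<longlonglongrightarrow> 0"
    proof (rule Lim_null_comparison[OF _ represents_diff[OF \<phi> \<phi>'(1)]])
      show "\<forall>\<^sub>F n in sequentially. norm (pre_norm V \<mu> r0 (\<phi> n) - pre_norm V \<mu> r0 (\<phi>' n)) \<le> pre_norm V \<mu> r0 (\<lambda>x. \<phi> n x - \<phi>' n x)"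
        using pre_norm_diff_ge[OF D(1) representsD(1)[OF \<phi>'(1)]] by (intro always_eventually) simp
    qed
    then show ?thesis using LIMSEQ_unique[OF tendsto_diff[OF N \<phi>'(2)]] by fastforce
  qed
  then have "H1_norm V \<mu> r0 u = N" unfolding H1_norm_def using \<phi> N by (intro the_equality) blast+
  then show ?thesis using N by simp
qed

lemma test_function_H1:
  assumes "f \<in> T"
  shows "f \<in> H1_space V \<mu> r0" "H1_norm V \<mu> r0 f = pre_norm V \<mu> r0 f"
proof -
  have zero: "pre_norm V \<mu> r0 (\<lambda>x. f x - f x) = 0"
    unfolding pre_norm_Q using Q_scale[OF assms, of 0] by simp
  have r: "represents V \<mu> r0 (\<lambda>_. f) f"
    unfolding represents_def using assms T_measurable_on[OF assms] by (simp add: zero[simplified])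
  then show "f \<in> H1_space V \<mu> r0" unfolding H1_space_def by blast
  show "H1_norm V \<mu> r0 f = pre_norm V \<mu> r0 f"
    using H1_norm_limit[OF r] by (simp add: LIMSEQ_const_iff)
qed

text \<open>Convergence in L^2 is convergence of the squares in L^1, hence almost everywhere along a
  subsequence. The shift by N discards initial terms whose L^2 distance to u may be
  infinite.\<close>

lemma AE_subsequence:
  assumes \<phi>: "represents V \<mu> r0 \<phi> u"
  obtains r :: "nat \<Rightarrow> nat" where "filterlim r at_top sequentially" "AE x in lebesgue_on B. (\<lambda>n. \<phi> (r n) x) \<longlonglongrightarrow> u x"
proof -
  note D = representsD[OF \<phi>]
  have [measurable]: "\<phi> n \<in> borel_measurable (lebesgue_on B)" "u \<in> borel_measurable (lebesgue_on B)" for n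
    using D by (auto intro: T_measurable_on)
  let ?I = "\<lambda>n. \<integral>\<^sup>+x. ennreal ((\<phi> n x - u x)\<^sup>2) \<partial>lebesgue_on B"
  have "\<forall>\<^sub>F n in sequentially. ?I n < 1" using D(4) by (rule order_tendstoD) simp
  then obtain N where N: "\<And>n. n \<ge> N \<Longrightarrow> ?I n < 1" by (auto simp: eventually_sequentially)
  have int: "integrable (lebesgue_on B) (\<lambda>x. (\<phi> (n + N) x - u x)\<^sup>2)" for n
    using N[of "n + N"] by (intro integrableI_nonneg) (auto intro: order_less_trans)
  have "(\<lambda>n. \<integral>x. norm ((\<phi> (n + N) x - u x)\<^sup>2) \<partial>lebesgue_on B) \<longlonglongrightarrow> 0"
  proof -
    have "(\<lambda>n. ?I (n + N)) \<longlonglongrightarrow> ennreal 0"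
      using LIMSEQ_ignore_initial_segment[OF D(4), of N] by simp
    then have "(\<lambda>n. enn2real (?I (n + N))) \<longlonglongrightarrow> 0" by (rule tendsto_enn2real) simp
    then show ?thesis by (simp add: integral_eq_nn_integral)
  qed
  from tendsto_L1_AE_subseq[OF int this] obtain r :: "nat \<Rightarrow> nat"
    where r: "strict_mono r" "AE x in lebesgue_on B. (\<lambda>n. (\<phi> (r n + N) x - u x)\<^sup>2) \<longlonglongrightarrow> 0" by blast
  show ?thesis
  proof (rule that[of "\<lambda>n. r n + N"])
    show "filterlim (\<lambda>n. r n + N) at_top sequentially"
      by (rule filterlim_compose[OF filterlim_add_const_nat_at_top filterlim_subseq[OF r(1)]])
    show "AE x in lebesgue_on B. (\<lambda>n. \<phi> (r n + N) x) \<longlonglongrightarrow> u x"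
      using r(2)
    proof eventually_elim
      case (elim x)
      then have "(\<lambda>n. sqrt ((\<phi> (r n + N) x - u x)\<^sup>2)) \<longlonglongrightarrow> sqrt 0" by (rule tendsto_real_sqrt)
      then have "(\<lambda>n. \<phi> (r n + N) x - u x) \<longlonglongrightarrow> 0" by (simp add: tendsto_rabs_zero_iff)
      then show ?case by (rule LIM_zero_cancel)
    qed
  qed
qed

text \<open>Fatou's lemma along an almost everywhere convergent subsequence. The approximants are
  rescaled because the inequality for test functions requires energy strictly below 1.\<close>

lemma Moser_Trudinger_H1:
  assumes u: "u \<in> H1_space V \<mu> r0" "H1_norm V \<mu> r0 u \<le> 1"
  shows "(\<integral>\<^sup>+x. ennreal (exp (4 * pi * sqrt (1 + 4 * \<mu>) * \<bar>u x\<bar>\<^sup>2)) \<partial>lebesgue_on B) \<le> ennreal (MT_const \<mu>)"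
proof -
  obtain \<phi> where \<phi>: "represents V \<mu> r0 \<phi> u" using u(1) by (auto simp: H1_space_def)
  note D = representsD[OF \<phi>]
  obtain r where r: "filterlim r at_top sequentially" "AE x in lebesgue_on B. (\<lambda>n. \<phi> (r n) x) \<longlonglongrightarrow> u x"
    using AE_subsequence[OF \<phi>] by blast
  \<comment> \<open>The maximum compensates pre-norms exceeding 1 before the limit and keeps the
    denominator away from 0; the numerator makes the energy bound strict. Both tend to 1.\<close>
  define c where "c n = (1 - 1 / real (n + 2)) / max 1 (pre_norm V \<mu> r0 (\<phi> (r n)))" for n
  have "(\<lambda>n. pre_norm V \<mu> r0 (\<phi> (r n))) \<longlonglongrightarrow> H1_norm V \<mu> r0 u"
    by (rule filterlim_compose[OF H1_norm_limit[OF \<phi>] r(1)])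
  then have "(\<lambda>n. max 1 (pre_norm V \<mu> r0 (\<phi> (r n)))) \<longlonglongrightarrow> max 1 (H1_norm V \<mu> r0 u)"
    by (intro tendsto_max tendsto_const)
  then have mx: "(\<lambda>n. max 1 (pre_norm V \<mu> r0 (\<phi> (r n)))) \<longlonglongrightarrow> 1" using u(2) by (simp add: max_absorb1)
  have "(\<lambda>n. 1 - 1 / real (n + 2)) \<longlonglongrightarrow> 1 - 0"
    by (intro tendsto_diff tendsto_const LIMSEQ_ignore_initial_segment[OF lim_1_over_n])
  then have c1: "c \<longlonglongrightarrow> 1" using tendsto_divide[OF _ mx, of "\<lambda>n. 1 - 1 / real (n + 2)" 1] by (simp add: c_def[abs_def])
  define \<psi> where "\<psi> n x = c n * \<phi> (r n) x" for n x
  have \<psi>T: "\<psi> n \<in> T" for n unfolding \<psi>_def[abs_def] by (rule T_scale[OF D(1)])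
  have \<psi>Q: "Q (\<psi> n) < 1" for n
  proof -
    let ?m = "max 1 (pre_norm V \<mu> r0 (\<phi> (r n)))"
    have "Q (\<phi> (r n)) \<le> ?m\<^sup>2"
      using Q_nonneg[OF D(1)[of "r n"]] by (metis max.cobounded2 pre_norm_Q real_sqrt_ge_0_iff real_sqrt_pow2 power_mono)
    have "Q (\<psi> n) = (c n)\<^sup>2 * Q (\<phi> (r n))" unfolding \<psi>_def[abs_def] by (rule Q_scale[OF D(1)])
    also have "\<dots> \<le> (c n)\<^sup>2 * ?m\<^sup>2" using \<open>Q (\<phi> (r n)) \<le> ?m\<^sup>2\<close> by (intro mult_left_mono) auto
    also have "\<dots> = (1 - 1 / real (n + 2))\<^sup>2" by (simp add: c_def flip: power_mult_distrib)
    also have "\<dots> < 1" unfolding abs_square_less_1 by (simp add: abs_less_iff)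
    finally show ?thesis .
  qed
  let ?m = "4 * pi * sqrt (1 + 4 * \<mu>)"
  have [measurable]: "\<psi> n \<in> borel_measurable (lebesgue_on B)" for n by (rule T_measurable_on[OF \<psi>T])
  have "AE x in lebesgue_on B. ennreal (exp (?m * \<bar>u x\<bar>\<^sup>2)) \<le> liminf (\<lambda>n. ennreal (exp (?m * \<bar>\<psi> n x\<bar>\<^sup>2)))"
    using r(2)
  proof eventually_elim
    case (elim x)
    have "(\<lambda>n. \<psi> n x) \<longlonglongrightarrow> 1 * u x" unfolding \<psi>_def by (intro tendsto_mult c1 elim)
    then have "(\<lambda>n. ennreal (exp (?m * \<bar>\<psi> n x\<bar>\<^sup>2))) \<longlonglongrightarrow> ennreal (exp (?m * \<bar>1 * u x\<bar>\<^sup>2))"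
      by (intro tendsto_ennrealI tendsto_intros)
    from lim_imp_Liminf[OF trivial_limit_sequentially this] show ?case by simp
  qed
  then have "(\<integral>\<^sup>+x. ennreal (exp (?m * \<bar>u x\<bar>\<^sup>2)) \<partial>lebesgue_on B) \<le> (\<integral>\<^sup>+x. liminf (\<lambda>n. ennreal (exp (?m * \<bar>\<psi> n x\<bar>\<^sup>2))) \<partial>lebesgue_on B)"
    by (rule nn_integral_mono_AE)
  also have "\<dots> \<le> liminf (\<lambda>n. \<integral>\<^sup>+x. ennreal (exp (?m * \<bar>\<psi> n x\<bar>\<^sup>2)) \<partial>lebesgue_on B)"
    by (rule nn_integral_liminf) measurable
  also have "\<dots> \<le> liminf (\<lambda>n. ennreal (MT_const \<mu>))"
    by (intro Liminf_mono always_eventually allI Moser_Trudinger_test \<psi>T \<psi>Q)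
  also have "\<dots> = ennreal (MT_const \<mu>)" by (simp add: Liminf_const)
  finally show ?thesis .
qed

end

section \<open>Smooth trial functions\<close>

text \<open>A local version of \<open>class_C\<close>, pointwise on \<open>S\<close>, so that it can be glued over open sets.\<close>

primrec ck :: "nat \<Rightarrow> 'a::euclidean_space set \<Rightarrow> ('a \<Rightarrow> real) \<Rightarrow> bool" where
  "ck 0 S f \<longleftrightarrow> (\<forall>x\<in>S. isCont f x)"
| "ck (Suc k) S f \<longleftrightarrow> (\<forall>x\<in>S. f differentiable (at x)) \<and> (\<forall>b\<in>Basis. ck k S (pd b f))"

lemma ck_UNIV: "ck k UNIV f \<longleftrightarrow> class_C k f"
  by (induction k arbitrary: f) (auto simp: continuous_on_eq_continuous_at differentiable_on_def pd_def[abs_def])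

lemma ck_Un: "ck k S f \<Longrightarrow> ck k T f \<Longrightarrow> ck k (S \<union> T) f"
  by (induction k arbitrary: f) auto

lemma ck_subset: "ck k T f \<Longrightarrow> S \<subseteq> T \<Longrightarrow> ck k S f"
  by (induction k arbitrary: f) auto

lemma ck_cong:
  assumes S: "open S"
  shows "ck k S f \<Longrightarrow> (\<And>x. x \<in> S \<Longrightarrow> f x = g x) \<Longrightarrow> ck k S g"
proof (induction k arbitrary: f g)
  case 0
  have "isCont g x" if "x \<in> S" for x
  proof -
    have "\<forall>\<^sub>F y in nhds x. f y = g y" using eventually_nhds_in_open[OF S that] by eventually_elim (rule 0(2))
    then show ?thesis using 0(1) that isCont_cong[of f g x] by simp
  qed
  then show ?case by simp
next
  case (Suc k)
  have d: "(g has_derivative frechet_derivative f (at x)) (at x)" if "x \<in> S" for x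
    using Suc.prems that S by (intro has_derivative_transform_within_open[OF _ S that Suc.prems(2)]) (auto simp: frechet_derivative_works)
  have "pd b f x = pd b g x" if "x \<in> S" for b x
    using pd_eq[OF d[OF that]] by (simp add: pd_def)
  then have "ck k S (pd b g)" if "b \<in> Basis" for b
    using Suc.prems that by (intro Suc.IH[of "pd b f" "pd b g"]) auto
  moreover have "g differentiable (at x)" if "x \<in> S" for x using d[OF that] by (rule differentiableI)
  ultimately show ?case by simp
qed

text \<open>Smoothness is proved by exhibiting a total derivative and checking the regularity of its
  directional values, without computing \<open>pd\<close>.\<close>

lemma ck_Suc_cong:
  assumes S: "open S" and d: "\<And>x. x \<in> S \<Longrightarrow> (f has_derivative f' x) (at x)"
    and c: "\<And>b. b \<in> Basis \<Longrightarrow> ck k S (\<lambda>x. f' x b)"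
  shows "ck (Suc k) S f"
proof -
  have "ck k S (pd b f)" if "b \<in> Basis" for b
    by (rule ck_cong[OF S c[OF that]]) (simp add: pd_eq[OF d])
  then show ?thesis using d by (auto simp: differentiable_def)
qed

lemma ck_pd: "ck (Suc k) S f \<Longrightarrow> b \<in> Basis \<Longrightarrow> ck k S (pd b f)"
  by simp

lemma ck_deriv: "ck (Suc k) S f \<Longrightarrow> x \<in> S \<Longrightarrow> (f has_derivative (\<lambda>h. \<Sum>b\<in>Basis. (h \<bullet> b) * pd b f x)) (at x)"
  by (rule has_derivative_pd) simp

lemma ck_Suc_D: "ck (Suc k) S f \<Longrightarrow> ck k S f"
  by (induction k arbitrary: f) (auto intro: differentiable_imp_continuous_within)

lemma sum_Basis_inner: "b \<in> Basis \<Longrightarrow> (\<Sum>b'\<in>Basis. (b \<bullet> b') * f b') = f b" for f :: "'a::euclidean_space \<Rightarrow> real"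
  by (simp add: inner_Basis if_distrib if_distribR sum.delta' cong: if_cong)

lemma ck_const [simp]: "open S \<Longrightarrow> ck k S (\<lambda>x. c)"
proof (induction k arbitrary: c)
  case (Suc k)
  show ?case by (rule ck_Suc_cong[OF Suc.prems has_derivative_const Suc.IH[OF Suc.prems]])
qed auto

lemma ck_add: "open S \<Longrightarrow> ck k S f \<Longrightarrow> ck k S g \<Longrightarrow> ck k S (\<lambda>x. f x + g x)"
proof (induction k arbitrary: f g)
  case (Suc k)
  show ?case
    by (rule ck_Suc_cong[OF Suc.prems(1) has_derivative_add[OF ck_deriv[OF Suc.prems(2)] ck_deriv[OF Suc.prems(3)]]])
       (use Suc in \<open>auto simp: sum_Basis_inner\<close>)
qed auto

lemma ck_mult: "open S \<Longrightarrow> ck k S f \<Longrightarrow> ck k S g \<Longrightarrow> ck k S (\<lambda>x. f x * g x)"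
proof (induction k arbitrary: f g)
  case (Suc k)
  show ?case
  proof (rule ck_Suc_cong[OF Suc.prems(1) has_derivative_mult[OF ck_deriv[OF Suc.prems(2)] ck_deriv[OF Suc.prems(3)]]])
    fix b :: 'a assume b: "b \<in> Basis"
    show "ck k S (\<lambda>x. f x * (\<Sum>b'\<in>Basis. (b \<bullet> b') * pd b' g x) + (\<Sum>b'\<in>Basis. (b \<bullet> b') * pd b' f x) * g x)"
      unfolding sum_Basis_inner[OF b]
      using Suc.prems b by (intro ck_add Suc.IH ck_Suc_D[OF Suc.prems(2)] ck_Suc_D[OF Suc.prems(3)]) auto
  qed
qed auto

lemma ck_cmult: "open S \<Longrightarrow> ck k S f \<Longrightarrow> ck k S (\<lambda>x. c * f x)"
  by (intro ck_mult ck_const)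

lemma ck_compose:
  fixes g :: "real \<Rightarrow> real" and f :: "'a::euclidean_space \<Rightarrow> real"
  shows "open S \<Longrightarrow> ck k T g \<Longrightarrow> ck k S f \<Longrightarrow> (\<And>x. x \<in> S \<Longrightarrow> f x \<in> T) \<Longrightarrow> ck k S (\<lambda>x. g (f x))"
proof (induction k arbitrary: g)
  case 0
  then show ?case by (auto intro!: isCont_o2[of _ f g])
next
  case (Suc k)
  have "((\<lambda>x. g (f x)) has_derivative (\<lambda>h. \<Sum>b'\<in>Basis. ((\<Sum>b\<in>Basis. (h \<bullet> b) * pd b f x) \<bullet> b') * pd b' g (f x))) (at x)" if "x \<in> S" for x
    by (rule has_derivative_compose[OF ck_deriv[OF Suc.prems(3) that] ck_deriv[OF Suc.prems(2) Suc.prems(4)[OF that]]])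
  then have d: "((\<lambda>x. g (f x)) has_derivative (\<lambda>h. (\<Sum>b\<in>Basis. (h \<bullet> b) * pd b f x) * pd 1 g (f x))) (at x)" if "x \<in> S" for x
    using that by simp
  show ?case
  proof (rule ck_Suc_cong[OF Suc.prems(1) d])
    fix b :: 'a assume b: "b \<in> Basis"
    have "ck k S (\<lambda>x. pd 1 g (f x))"
      using Suc.prems(2) by (intro Suc.IH[OF Suc.prems(1) _ ck_Suc_D[OF Suc.prems(3)] Suc.prems(4)]) auto
    then show "ck k S (\<lambda>x. (\<Sum>b'\<in>Basis. (b \<bullet> b') * pd b' f x) * pd 1 g (f x))"
      unfolding sum_Basis_inner[OF b] using Suc.prems b by (intro ck_mult) auto
  qed
qed

lemma ck_real_Suc:
  fixes f :: "real \<Rightarrow> real"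
  assumes "open S" "\<And>x. x \<in> S \<Longrightarrow> (f has_real_derivative f' x) (at x)" "ck k S f'"
  shows "ck (Suc k) S f"
  by (rule ck_Suc_cong[OF assms(1) assms(2)[unfolded has_field_derivative_def]]) (use assms(3) in auto)

lemma ck_exp: "ck k UNIV (exp :: real \<Rightarrow> real)"
proof (induction k)
  case (Suc k)
  show ?case by (rule ck_real_Suc[OF _ DERIV_exp Suc]) simp
qed auto

lemma ck_ident: "open S \<Longrightarrow> ck k S (\<lambda>x::real. x)"
  by (cases k) (auto simp del: ck.simps(2) intro!: ck_real_Suc[of S _ "\<lambda>_. 1"] derivative_eq_intros)

lemma ck_inverse: "ck k {0<..} (inverse :: real \<Rightarrow> real)"
proof (induction k)
  case 0
  show ?case by (auto intro!: DERIV_isCont[OF DERIV_inverse])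
next
  case (Suc k)
  show ?case
  proof (rule ck_real_Suc)
    \<comment> \<open>The derivative is again a product of inverses, which closes the
      induction.\<close>
    show "ck k {0<..} (\<lambda>x::real. (-1) * (inverse x * inverse x))"
      by (intro ck_cmult ck_mult Suc) auto
  qed (auto intro!: derivative_eq_intros)
qed

lemma ck_ln: "ck k {0<..} (ln :: real \<Rightarrow> real)"
proof (cases k)
  case 0
  then show ?thesis by (auto intro!: DERIV_isCont[OF DERIV_ln])
next
  case (Suc n)
  show ?thesis unfolding Suc by (rule ck_real_Suc[OF _ _ ck_inverse]) (auto intro!: derivative_eq_intros simp: field_simps)
qed

lemma ck_sqrt: "ck k {0<..} sqrt"
proof (rule ck_cong)
  show "ck k {0<..} (\<lambda>x::real. exp (1 / 2 * ln x))"
    by (rule ck_compose[OF _ ck_exp ck_cmult[OF _ ck_ln]]) auto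
  show "exp (1 / 2 * ln x) = sqrt x" if "x \<in> {0<..}" for x :: real
    using that by (simp add: powr_half_sqrt[symmetric] powr_def)
qed simp

lemma ck_inner_self: "ck k UNIV (\<lambda>x :: 'a::euclidean_space. x \<bullet> x)"
proof -
  have lin: "ck k UNIV (\<lambda>x :: 'a. 2 * (x \<bullet> b))" for k b
  proof (cases k)
    case 0
    then show ?thesis by (auto intro!: continuous_intros)
  next
    case (Suc n)
    show ?thesis unfolding Suc
      by (rule ck_Suc_cong[where f' = "\<lambda>x h. 2 * (h \<bullet> b)"]) (auto intro!: derivative_eq_intros)
  qed
  show ?thesis
  proof (cases k)
    case 0
    then show ?thesis by (auto intro!: continuous_intros)
  next
    case (Suc n)
    have "((\<lambda>x :: 'a. x \<bullet> x) has_derivative (\<lambda>h. 2 * (x \<bullet> h))) (at x)" for x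
      by (auto intro!: derivative_eq_intros simp: inner_commute)
    then show ?thesis unfolding Suc
      by (intro ck_Suc_cong[where f' = "\<lambda>x h. 2 * (x \<bullet> h)"] lin open_UNIV)
  qed
qed

text \<open>This family is closed under differentiation up to linear combinations.\<close>

definition flat :: "nat \<Rightarrow> real \<Rightarrow> real" where
  "flat k y = (if y \<le> 0 then 0 else inverse y ^ k * exp (- inverse y))"

lemma flat_tendsto_0: "(flat k \<longlongrightarrow> 0) (at 0)"
proof (subst filterlim_at_split, intro conjI)
  show "(flat k \<longlongrightarrow> 0) (at_left 0)"
    by (rule tendsto_eventually) (auto simp: flat_def eventually_at_left_field intro!: exI[of _ "-1"])
  have "((\<lambda>y. inverse y ^ k / exp (inverse y)) \<longlongrightarrow> 0) (at_right (0::real))"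
    by (rule filterlim_compose[OF tendsto_power_div_exp_0 filterlim_inverse_at_top_right])
  then show "(flat k \<longlongrightarrow> 0) (at_right 0)"
    by (rule Lim_transform_eventually) (auto simp: flat_def exp_minus divide_inverse eventually_at_right_field intro!: exI[of _ 1])
qed

lemma flat_deriv: "(flat k has_real_derivative flat (k + 2) y + (- real k) * flat (k + 1) y) (at y)"
proof -
  consider "y < 0" | "y = 0" | "0 < y" by linarith
  then show ?thesis
  proof cases
    case 1
    have "((\<lambda>_. 0) has_real_derivative 0) (at y)" by simp
    then have "(flat k has_real_derivative 0) (at y)"
      by (rule has_field_derivative_transform_within_open[of _ _ _ "{..<0}"]) (use 1 in \<open>auto simp: flat_def\<close>)
    then show ?thesis using 1 by (simp add: flat_def)
  next
    case 2
    \<comment> \<open>The difference quotient at 0 is the next member \<open>flat (Suc k)\<close> of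
      the family, which tends to 0.\<close>
    have "((\<lambda>h. (flat k (0 + h) - flat k 0) / h) \<longlongrightarrow> 0) (at 0)"
    proof (rule Lim_transform_eventually[OF flat_tendsto_0[of "Suc k"]])
      show "\<forall>\<^sub>F h in at 0. flat (Suc k) h = (flat k (0 + h) - flat k 0) / h"
        by (rule always_eventually) (auto simp: flat_def divide_inverse)
    qed
    then have "(flat k has_real_derivative 0) (at 0)" by (simp add: DERIV_def)
    then show ?thesis using 2 by (simp add: flat_def)
  next
    case 3
    have "((\<lambda>y. inverse y ^ k * exp (- inverse y)) has_real_derivative flat (k + 2) y + (- real k) * flat (k + 1) y) (at y)"
    proof (rule DERIV_cong)
      have "((\<lambda>y. inverse y ^ k) has_real_derivative real k * (- (inverse y ^ Suc (Suc 0)) * inverse y ^ (k - Suc 0))) (at y)"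
        by (rule DERIV_power[OF DERIV_inverse]) (use 3 in simp)
      moreover have "real k * (- (inverse y ^ Suc (Suc 0)) * inverse y ^ (k - Suc 0)) = - real k * inverse y ^ (k + 1)"
        by (cases k) (simp_all add: algebra_simps)
      ultimately have "((\<lambda>y. inverse y ^ k) has_real_derivative - real k * inverse y ^ (k + 1)) (at y)" by metis
      then show "((\<lambda>y. inverse y ^ k * exp (- inverse y)) has_real_derivative
         (- real k * inverse y ^ (k + 1)) * exp (- inverse y) + (exp (- inverse y) * (inverse y * inverse y)) * inverse y ^ k) (at y)"
        using 3 by (intro DERIV_mult) (auto intro!: derivative_eq_intros)
      show "(- real k * inverse y ^ (k + 1)) * exp (- inverse y) + (exp (- inverse y) * (inverse y * inverse y)) * inverse y ^ k
        = flat (k + 2) y + (- real k) * flat (k + 1) y"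
        using 3 by (simp add: flat_def)
    qed
    then show ?thesis
      by (rule has_field_derivative_transform_within_open[of _ _ _ "{0<..}"]) (use 3 in \<open>auto simp: flat_def\<close>)
  qed
qed

lemma ck_flat: "ck n UNIV (flat k)"
proof (induction n arbitrary: k)
  case 0
  show ?case using DERIV_isCont[OF flat_deriv] by simp
next
  case (Suc n)
  show ?case
    by (rule ck_real_Suc[OF open_UNIV flat_deriv]) (intro ck_add ck_cmult Suc open_UNIV)
qed

text \<open>\<open>exp 1 * flat 0\<close> equals 1 at y = 1, so it is a normalised cut-off.
  \<open>flat 2\<close> is the derivative of \<open>flat 0\<close>; its bound comes from exp x \<ge>
  x^2 / 2 at x = 1 / y.\<close>

lemma flat_bounds: "0 \<le> flat 0 y" "y \<le> 1 \<Longrightarrow> exp 1 * flat 0 y \<le> 1" "0 \<le> flat 2 y" "flat 2 y \<le> 2"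
proof -
  show "0 \<le> flat 0 y" "0 \<le> flat 2 y" by (auto simp: flat_def)
  show "exp 1 * flat 0 y \<le> 1" if "y \<le> 1"
    using that by (auto simp: flat_def exp_minus field_simps one_le_inverse_iff)
  show "flat 2 y \<le> 2"
  proof (cases "0 < y")
    case True
    have "1 + inverse y + (inverse y)\<^sup>2 / 2 \<le> exp (inverse y)"
      using True by (intro exp_lower_Taylor_quadratic) auto
    then have "(inverse y)\<^sup>2 \<le> 2 * exp (inverse y)" using True positive_imp_inverse_positive[OF True] by linarith
    then show ?thesis using True by (simp add: flat_def exp_minus field_simps)
  qed (simp add: flat_def)
qed

text \<open>In the variable z = ln t - ln l this is the integral of exp (-s |z|), whose value over
  the whole line is 2 / s.\<close>

lemma integral_exp_log_le:
  fixes s l b :: real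
  assumes s: "0 < s" and l: "1 \<le> l" "l \<le> b"
  shows "integral {1..b} (\<lambda>t. exp (- s * \<bar>ln t - ln l\<bar>) / t) \<le> 2 / s"
proof -
  let ?f = "\<lambda>t. exp (- s * \<bar>ln t - ln l\<bar>) / t"
  have "(?f has_integral exp (s * (ln l - ln l)) / s - exp (s * (ln 1 - ln l)) / s) {1..l}"
  proof (rule fundamental_theorem_of_calculus[OF l(1)])
    fix t assume t: "t \<in> {1..l}"
    then have "ln t \<le> ln l" by (intro ln_mono) auto
    then have "?f t = exp (s * (ln t - ln l)) / t" by (simp add: algebra_simps)
    then show "((\<lambda>t. exp (s * (ln t - ln l)) / s) has_vector_derivative ?f t) (at t within {1..l})"
      unfolding has_real_derivative_iff_has_vector_derivative[symmetric]
      using t s by (auto intro!: derivative_eq_intros)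
  qed
  moreover have "(?f has_integral - exp (- s * (ln b - ln l)) / s - (- exp (- s * (ln l - ln l)) / s)) {l..b}"
  proof (rule fundamental_theorem_of_calculus[OF l(2)])
    fix t assume t: "t \<in> {l..b}"
    then have "ln l \<le> ln t" using l by (intro ln_mono) auto
    then have "?f t = exp (- s * (ln t - ln l)) / t" by (simp add: algebra_simps)
    then show "((\<lambda>t. - exp (- s * (ln t - ln l)) / s) has_vector_derivative ?f t) (at t within {l..b})"
      unfolding has_real_derivative_iff_has_vector_derivative[symmetric]
      using t s l by (auto intro!: derivative_eq_intros)
  qed
  ultimately have "(?f has_integral (1 / s - exp (s * (ln 1 - ln l)) / s) + (- exp (- s * (ln b - ln l)) / s + 1 / s)) {1..b}"
    using l by (intro has_integral_combine[of 1 l b]) auto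
  then have "integral {1..b} ?f = (1 / s - exp (s * (ln 1 - ln l)) / s) + (- exp (- s * (ln b - ln l)) / s + 1 / s)"
    by (rule integral_unique)
  also have "\<dots> \<le> (1 / s - 0) + (0 + 1 / s)" using s by (intro add_mono diff_mono) auto
  finally show ?thesis by simp
qed

text \<open>
  Substituting \<open>w(t) = sqrt t h(ln (t/l))\<close> turns \<open>\<integral> w'\<^sup>2 + \<mu> w\<^sup>2/t\<^sup>2 dt\<close> into \<open>\<integral> h'\<^sup>2 + s\<^sup>2/4 h\<^sup>2 dz\<close>, for
  which \<open>exp (- s |z| / 2)\<close> is extremal given the value at 0. The parameter \<open>\<eta>\<close> smooths it at 0
  and \<open>R\<close> cuts it off; \<open>prof'\<close> is the derivative.
\<close>

definition prof :: "real \<Rightarrow> real \<Rightarrow> real \<Rightarrow> real \<Rightarrow> real" where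
  "prof s \<eta> R z = exp (- (s / 2) * sqrt (z * z + \<eta>\<^sup>2)) * (exp 1 * flat 0 (1 + (- 1 / R\<^sup>2) * (z * z)))"

definition prof' :: "real \<Rightarrow> real \<Rightarrow> real \<Rightarrow> real \<Rightarrow> real" where
  "prof' s \<eta> R z = exp (- (s / 2) * sqrt (z * z + \<eta>\<^sup>2)) *
     (- (s / 2) * (z / sqrt (z * z + \<eta>\<^sup>2)) * (exp 1 * flat 0 (1 + (- 1 / R\<^sup>2) * (z * z)))
      + exp 1 * (flat 2 (1 + (- 1 / R\<^sup>2) * (z * z)) * (- 2 * z / R\<^sup>2)))"

context
  fixes s \<eta> R :: real
  assumes s: "0 < s" and \<eta>: "0 < \<eta>" and R: "0 < R"
begin

lemma root_pos: "0 < z * z + \<eta>\<^sup>2"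
  using \<eta> by (intro add_nonneg_pos) auto

lemma prof_deriv: "(prof s \<eta> R has_real_derivative prof' s \<eta> R z) (at z)"
proof -
  have "(flat 0 has_real_derivative flat 2 y) (at y)" for y
    using flat_deriv[of 0 y] by (simp add: numeral_2_eq_2)
  then have f: "((\<lambda>z. flat 0 (1 + c * (z * z))) has_real_derivative flat 2 (1 + c * (z * z)) * (c * (1 * z + 1 * z))) (at z)" for c
    by (rule DERIV_chain2) (auto intro!: derivative_eq_intros)
  have r: "((\<lambda>z. sqrt (z * z + \<eta>\<^sup>2)) has_real_derivative z / sqrt (z * z + \<eta>\<^sup>2)) (at z)"
    using root_pos[of z] by (auto intro!: derivative_eq_intros simp: field_simps)
  show ?thesis
    unfolding prof_def[abs_def] prof'_def
    by (rule derivative_eq_intros f r refl)+ (simp add: algebra_simps)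
qed

lemma ck_prof: "ck k UNIV (prof s \<eta> R)"
  unfolding prof_def[abs_def]
  by (intro ck_mult ck_cmult open_UNIV ck_compose[OF open_UNIV ck_exp] ck_compose[OF open_UNIV ck_sqrt]
      ck_compose[OF open_UNIV ck_flat] ck_add ck_const ck_ident) (auto simp: root_pos)

lemma prof_zero: "R \<le> \<bar>z\<bar> \<Longrightarrow> prof s \<eta> R z = 0"
proof -
  assume "R \<le> \<bar>z\<bar>"
  then have "R\<^sup>2 \<le> z * z" using R by (metis abs_le_square_iff abs_of_pos power2_eq_square)
  then show ?thesis using R by (simp add: prof_def flat_def)
qed

lemma exp_root_le: "exp (- (s / 2) * sqrt (z * z + \<eta>\<^sup>2)) \<le> exp (- (s / 2) * \<bar>z\<bar>)"
proof -
  have "\<bar>z\<bar> \<le> sqrt (z * z + \<eta>\<^sup>2)" by (intro real_le_rsqrt) (simp add: power2_eq_square)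
  then show ?thesis using s by simp
qed

lemma flat0_le: "exp 1 * flat 0 (1 + (- 1 / R\<^sup>2) * (z * z)) \<le> 1"
  by (rule flat_bounds) simp

lemma prof_le: "\<bar>prof s \<eta> R z\<bar> \<le> exp (- (s / 2) * \<bar>z\<bar>)"
proof -
  have "\<bar>prof s \<eta> R z\<bar> \<le> exp (- (s / 2) * \<bar>z\<bar>) * 1"
    unfolding prof_def abs_mult using flat_bounds(1) flat0_le exp_root_le
    by (intro mult_mono) (auto simp: abs_mult[symmetric])
  then show ?thesis by simp
qed

text \<open>The first term is the derivative of the smoothed exponential, the second the error of
  the cut-off. That error lives on |z| < R, where the inner derivative is at most 2 / R, so it
  disappears as R grows.\<close>

lemma prof'_le: "\<bar>prof' s \<eta> R z\<bar> \<le> exp (- (s / 2) * \<bar>z\<bar>) * (s / 2 + 4 * exp 1 / R)"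
proof -
  let ?y = "1 + (- 1 / R\<^sup>2) * (z * z)" and ?r = "sqrt (z * z + \<eta>\<^sup>2)"
  have "\<bar>z\<bar> \<le> ?r" by (intro real_le_rsqrt) (simp add: power2_eq_square)
  then have zr: "\<bar>z / ?r\<bar> \<le> 1" using root_pos[of z] by (simp add: abs_divide)
  have 1: "\<bar>- (s / 2) * (z / ?r) * (exp 1 * flat 0 ?y)\<bar> \<le> s / 2 * 1 * 1"
    unfolding abs_mult[of _ "exp 1 * flat 0 ?y"] abs_mult[of "- (s / 2)"]
    using zr s flat0_le[of z] flat_bounds(1)[of ?y] by (intro mult_mono) (auto simp: abs_mult)
  have 2: "\<bar>exp 1 * (flat 2 ?y * (- 2 * z / R\<^sup>2))\<bar> \<le> 4 * exp 1 / R"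
  proof (cases "R \<le> \<bar>z\<bar>")
    case True
    then have "R\<^sup>2 \<le> z * z" using R by (metis abs_le_square_iff abs_of_pos power2_eq_square)
    then show ?thesis using R by (simp add: flat_def)
  next
    case False
    then have "\<bar>- 2 * z / R\<^sup>2\<bar> \<le> 2 / R" using R by (simp add: abs_mult power2_eq_square field_simps)
    then have "exp 1 * (\<bar>flat 2 ?y\<bar> * \<bar>- 2 * z / R\<^sup>2\<bar>) \<le> exp 1 * (2 * (2 / R))"
      using flat_bounds(3,4)[of ?y] by (intro mult_left_mono mult_mono) auto
    then show ?thesis by (simp only: abs_mult abs_exp_cancel) (simp add: mult.commute)
  qed
  show ?thesis
    unfolding prof'_def abs_mult[of "exp _"] using exp_root_le[of z] abs_triangle_ineq[of "- (s / 2) * (z / ?r) * (exp 1 * flat 0 ?y)" "exp 1 * (flat 2 ?y * (- 2 * z / R\<^sup>2))"] 1 2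
    by (intro mult_mono) auto
qed

text \<open>The constant tends to s^2 / 2 as R grows, the value for the exact exponential, and does
  not involve \<eta>.\<close>

lemma prof_energy_le:
  "(prof' s \<eta> R z)\<^sup>2 + s\<^sup>2 / 4 * (prof s \<eta> R z)\<^sup>2 \<le> ((s / 2 + 4 * exp 1 / R)\<^sup>2 + s\<^sup>2 / 4) * exp (- s * \<bar>z\<bar>)"
proof -
  have e: "(exp (- (s / 2) * \<bar>z\<bar>))\<^sup>2 = exp (- s * \<bar>z\<bar>)" by (simp add: power2_eq_square flip: exp_add)
  have "(prof' s \<eta> R z)\<^sup>2 \<le> (exp (- (s / 2) * \<bar>z\<bar>) * (s / 2 + 4 * exp 1 / R))\<^sup>2"
    using power_mono[OF prof'_le abs_ge_zero, of z 2] by simp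
  moreover have "s\<^sup>2 / 4 * (prof s \<eta> R z)\<^sup>2 \<le> s\<^sup>2 / 4 * (exp (- (s / 2) * \<bar>z\<bar>))\<^sup>2"
    using power_mono[OF prof_le abs_ge_zero, of z 2] by (intro mult_left_mono) auto
  ultimately show ?thesis unfolding power_mult_distrib e by (simp add: algebra_simps)
qed

text \<open>The price of smoothing: the exact extremal would have the value 1 here.\<close>

lemma prof_0: "(prof s \<eta> R 0)\<^sup>2 = exp (- s * \<eta>)"
  using \<eta> by (simp add: prof_def flat_def power2_eq_square flip: exp_add)

end

section \<open>Trial functions at scale l\<close>

context log_hardy begin

definition trial :: "(real \<Rightarrow> real) \<Rightarrow> real \<Rightarrow> real^2 \<Rightarrow> real" where
  "trial h l x = (if x \<in> ball 0 1 - {0} then sqrt (- (1 / 2) * ln (x \<bullet> x)) * h (ln (- (1 / 2) * ln (x \<bullet> x)) + (- ln l)) else 0)"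

text \<open>In \<open>trial\<close>, \<open>- ln (x \<bullet> x) / 2\<close> is \<open>ln (1 / |x|)\<close>.\<close>

lemma trial_eq:
  assumes "x \<in> ball 0 1 - {0}"
  shows "trial h l x = sqrt (- ln (norm x)) * h (ln (- ln (norm x)) - ln l)"
proof -
  have "ln (x \<bullet> x) = 2 * ln (norm x)" using assms by (simp add: ln_realpow flip: power2_norm_eq_inner)
  then show ?thesis using assms by (simp add: trial_def)
qed

lemma trial_polar:
  assumes "0 < t"
  shows "trial h l (polar t \<theta>) = sqrt t * h (ln t - ln l)"
proof -
  have "polar t \<theta> \<noteq> 0" using norm_polar[of t \<theta>] by (metis exp_not_eq_zero norm_zero)
  then have "polar t \<theta> \<in> ball 0 1 - {0}" using assms by simp
  then show ?thesis by (simp only: trial_eq norm_polar) simp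
qed

context
  fixes h h' :: "real \<Rightarrow> real" and l R :: real
  assumes ck_h: "\<And>k. ck k UNIV h" and h_deriv: "\<And>z. (h has_real_derivative h' z) (at z)"
    and h_zero: "\<And>z. R \<le> \<bar>z\<bar> \<Longrightarrow> h z = 0"
    and R: "0 < R" and l: "exp R < l"
begin

text \<open>The trial function lives on l exp (-R) \<le> t \<le> l exp R; the assumption on l places
  this interval strictly beyond t = 1, that is, inside the ball.\<close>

lemma l_bounds: "0 < l" "1 < l * exp (- R)" "l \<le> l * exp R" "1 \<le> l"
proof -
  show "0 < l" using l exp_gt_zero[of R] by linarith
  have "exp R * exp (- R) < l * exp (- R)" using l by (intro mult_strict_right_mono) auto
  then show "1 < l * exp (- R)" by (simp flip: exp_add)
  show "l \<le> l * exp R" using \<open>0 < l\<close> R by simp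
  have "1 < exp R" using R by simp
  then show "1 \<le> l" using l by linarith
qed

lemma trial_zero:
  assumes "norm x \<le> exp (- l * exp R) \<or> exp (- l * exp (- R)) \<le> norm x"
  shows "trial h l x = 0"
proof (cases "x \<in> ball 0 1 - {0}")
  case True
  define t where "t = - ln (norm x)"
  have n: "0 < norm x" "norm x < 1" using True by auto
  then have t: "0 < t" by (simp add: t_def)
  have "R \<le> \<bar>ln t - ln l\<bar>"
    using assms
  proof
    assume "norm x \<le> exp (- l * exp R)"
    then have "l * exp R \<le> t" using n ln_le_cancel_iff[of "norm x" "exp (- l * exp R)"] by (simp add: t_def)
    then have "ln (l * exp R) \<le> ln t" using l_bounds by (intro ln_mono) auto
    then show ?thesis using l_bounds by (simp add: ln_mult)
  next
    assume "exp (- l * exp (- R)) \<le> norm x"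
    then have "t \<le> l * exp (- R)" using n ln_le_cancel_iff[of "exp (- l * exp (- R))" "norm x"] by (simp add: t_def)
    then have "ln t \<le> ln (l * exp (- R))" using t l_bounds by (intro ln_mono) auto
    then show ?thesis using l_bounds by (simp add: ln_mult)
  qed
  then show ?thesis unfolding trial_eq[OF True] t_def[symmetric] by (simp add: h_zero)
qed (simp only: trial_def if_False)

text \<open>Two open sets cover the plane: the punctured unit ball, where the defining formula is
  smooth, and a neighbourhood of the origin together with the exterior of a smaller ball, where the
  function vanishes.\<close>

lemma trial_smooth: "class_C k (trial h l)"
proof -
  let ?S = "ball 0 1 - {0} :: (real^2) set"
  have S: "open ?S" by auto
  have lt: "x \<bullet> x < 1" if "x \<in> ?S" for x :: "real^2"
    using that unfolding power2_norm_eq_inner[symmetric] by (intro power_less_one_iff[THEN iffD2]) auto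
  have t: "ck k ?S (\<lambda>x. - (1 / 2) * ln (x \<bullet> x))"
    by (intro ck_cmult S ck_compose[OF S ck_ln] ck_subset[OF ck_inner_self]) auto
  have "ck k ?S (\<lambda>x. sqrt (- (1 / 2) * ln (x \<bullet> x)) * h (ln (- (1 / 2) * ln (x \<bullet> x)) + (- ln l)))"
    by (intro ck_mult S ck_compose[OF S ck_sqrt t] ck_compose[OF S ck_h] ck_add ck_compose[OF S ck_ln t] ck_const) (use lt in \<open>auto\<close>)
  then have 1: "ck k ?S (trial h l)" by (rule ck_cong[OF S]) (simp add: trial_def)
  let ?Z = "ball 0 (exp (- l * exp R)) \<union> - cball 0 (exp (- l * exp (- R))) :: (real^2) set"
  have 2: "ck k ?Z (trial h l)"
    by (rule ck_cong[OF _ ck_const[of _ _ 0]]) (auto simp: trial_zero)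
  have lt1: "exp (- l * exp (- R)) < 1" using l_bounds by simp
  have "x \<in> ?S \<union> ?Z" for x
  proof (cases "exp (- l * exp (- R)) < norm x")
    case False
    then have "norm x < 1" using lt1 by linarith
    then show ?thesis by (cases "x = 0") auto
  qed simp
  then have "?S \<union> ?Z = UNIV" by blast
  then show ?thesis using ck_Un[OF 1 2] by (simp only: ck_UNIV)
qed

lemma trial_supp: "supp (trial h l) \<subseteq> {x. exp (- l * exp R) \<le> norm x \<and> norm x \<le> exp (- l * exp (- R))}"
  unfolding supp_def
proof (rule closure_minimal)
  show "{x. trial h l x \<noteq> 0} \<subseteq> {x. exp (- l * exp R) \<le> norm x \<and> norm x \<le> exp (- l * exp (- R))}"
    using trial_zero by (force simp: not_le)
  show "closed {x :: real^2. exp (- l * exp R) \<le> norm x \<and> norm x \<le> exp (- l * exp (- R))}"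
    by (intro closed_Collect_conj closed_Collect_le continuous_intros)
qed

lemma trial_T: "trial h l \<in> T"
proof -
  have "bounded (supp (trial h l))"
    by (rule bounded_subset[OF bounded_cball[of 0 "exp (- l * exp (- R))"]]) (use trial_supp in auto)
  then have K: "compact (supp (trial h l))" by (simp add: compact_eq_bounded_closed supp_def)
  have "norm x < exp (- 1) \<and> x \<noteq> 0" if "x \<in> supp (trial h l)" for x
  proof -
    have n: "exp (- l * exp R) \<le> norm x" "norm x \<le> exp (- l * exp (- R))" using trial_supp that by auto
    have "exp (- l * exp (- R)) < exp (- 1)" using l_bounds by simp
    then show ?thesis using n(2) order_less_le_trans[OF exp_gt_zero n(1)] by (auto intro: order_le_less_trans)
  qed
  then have "supp (trial h l) \<subseteq> B - {0}" unfolding B_eq by auto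
  then show ?thesis using K trial_smooth unfolding test_functions_def supp_def by auto
qed

text \<open>Expanding w'^2 + \<mu> w^2 / t^2 gives h'^2 + (\<mu> + 1/4) h^2 + h h', divided by t.
  The middle coefficient is s^2 / 4, and the mixed term is the derivative of h^2 / 2 along ln t,
  which integrates to 0.\<close>

lemma trial_Q_le:
  assumes s: "0 < s" "s\<^sup>2 = 1 + 4 * \<mu>"
    and E: "\<And>z. (h' z)\<^sup>2 + s\<^sup>2 / 4 * (h z)\<^sup>2 \<le> K * exp (- s * \<bar>z\<bar>)" and K: "0 \<le> K" and h'_cont: "continuous_on UNIV h'"
  shows "Q (trial h l) \<le> 2 * pi * (K * (2 / s))"
proof -
  define b where "b = l * exp R + 1"
  have lb: "l \<le> b" using l_bounds(3) unfolding b_def by linarith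
  have b1: "1 \<le> b" using lb l_bounds by simp
  have supp: "exp (- b) < norm x" if "x \<in> supp (trial h l)" for x
  proof -
    have "exp (- b) < exp (- l * exp R)" by (simp add: b_def)
    also have "\<dots> \<le> norm x" using trial_supp that by blast
    finally show ?thesis .
  qed
  interpret C: cylinder_fn "cyl (trial h l)" "cylt (trial h l)" "cylh (trial h l)" b
    by (rule cyl_cylinder_fn[OF trial_T b1 supp])
  define w where "w t = sqrt t * h (ln t - ln l)" for t
  define w' where "w' t = (h (ln t - ln l) / 2 + h' (ln t - ln l)) / sqrt t" for t
  have cyl: "cyl (trial h l) (t, \<theta>) = w t" if "0 < t" for t \<theta>
    using that by (simp add: cyl_def w_def trial_polar)
  have w: "(w has_real_derivative w' t) (at t)" if t: "0 < t" for t
  proof -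
    have "((\<lambda>t. h (ln t - ln l)) has_real_derivative h' (ln t - ln l) * (1 / t)) (at t)"
      by (rule DERIV_chain2[OF h_deriv]) (use t in \<open>auto intro!: derivative_eq_intros\<close>)
    from DERIV_mult[OF DERIV_real_sqrt[OF t] this] show ?thesis
      unfolding w_def w'_def
    proof (rule DERIV_cong)
      have q: "1 / t * sqrt t = 1 / sqrt t" using t by (simp add: field_simps)
      show "inverse (sqrt t) / 2 * h (ln t - ln l) + h' (ln t - ln l) * (1 / t) * sqrt t = (h (ln t - ln l) / 2 + h' (ln t - ln l)) / sqrt t"
        unfolding mult.assoc q by (simp add: inverse_eq_divide add_divide_distrib)
    qed
  qed
  have Wt: "cylt (trial h l) (t, \<theta>) = w' t" and Wh: "cylh (trial h l) (t, \<theta>) = 0" if t: "0 < t" for t \<theta>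
  proof -
    have "((\<lambda>x. w (fst x)) has_derivative (\<lambda>h. w' t * fst h)) (at (t, \<theta>))"
    proof -
      have "(w has_derivative (\<lambda>h. w' t * h)) (at (fst (t, \<theta>)))"
        using w[OF t] by (simp add: has_field_derivative_def)
      from has_derivative_compose[OF has_derivative_fst[OF has_derivative_ident] this] show ?thesis by simp
    qed
    moreover have "open ({0<..} \<times> UNIV :: (real \<times> real) set)" by (intro open_Times) auto
    ultimately have "(cyl (trial h l) has_derivative (\<lambda>h. w' t * fst h)) (at (t, \<theta>))"
      by (rule has_derivative_transform_within_open) (use t in \<open>auto simp: cyl\<close>)
    \<comment> \<open>Uniqueness of the derivative identifies \<open>cylt\<close> and
      \<open>cylh\<close> of the trial function without computing its partial derivatives.\<close>
    from has_derivative_unique[OF this C.W_deriv] 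
    have eq: "w' t * fst k = cylt (trial h l) (t, \<theta>) * fst k + cylh (trial h l) (t, \<theta>) * snd k" for k :: "real \<times> real"
      by (metis)
    show "cylt (trial h l) (t, \<theta>) = w' t" using eq[of "(1, 0)"] by simp
    show "cylh (trial h l) (t, \<theta>) = 0" using eq[of "(0, 1)"] by simp
  qed
  have hc: "continuous_on S h" for S
    using h_deriv by (meson DERIV_continuous continuous_at_imp_continuous_on)
  have hlc: "continuous_on {1..b} (\<lambda>t. h (ln t - ln l))" "continuous_on {1..b} (\<lambda>t. h' (ln t - ln l))"
    by (rule continuous_on_compose2[OF hc[of UNIV]] continuous_on_compose2[OF h'_cont]; auto intro!: continuous_intros)+
  let ?e = "\<lambda>t. ((h' (ln t - ln l))\<^sup>2 + s\<^sup>2 / 4 * (h (ln t - ln l))\<^sup>2) / t"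
  let ?d = "\<lambda>t. h (ln t - ln l) * h' (ln t - ln l) / t"
  \<comment> \<open>At t = 1 and t = b the trial function vanishes while sqrt t does not.\<close>
  have w0: "h (ln 1 - ln l) = 0" "h (ln b - ln l) = 0"
    using C.W_zero[of 1 0] C.W_zero[of b 0] cyl[of 1 0] cyl[of b 0] b1 by (auto simp: w_def)
  have "(?d has_integral (h (ln b - ln l))\<^sup>2 / 2 - (h (ln 1 - ln l))\<^sup>2 / 2) {1..b}"
  proof (rule fundamental_theorem_of_calculus[OF b1])
    fix t assume t: "t \<in> {1..b}"
    have "((\<lambda>t. h (ln t - ln l)) has_real_derivative h' (ln t - ln l) * (1 / t)) (at t within {1..b})"
      by (rule DERIV_subset, rule DERIV_chain2[OF h_deriv]) (use t in \<open>auto intro!: derivative_eq_intros\<close>)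
    then show "((\<lambda>t. (h (ln t - ln l))\<^sup>2 / 2) has_vector_derivative ?d t) (at t within {1..b})"
      unfolding has_real_derivative_iff_has_vector_derivative[symmetric]
      by (auto intro!: derivative_eq_intros)
  qed
  then have d0: "(?d has_integral 0) {1..b}" using w0 by simp
  have ei: "?e integrable_on {1..b}"
    by (intro integrable_continuous_real continuous_intros hlc) auto
  have "Q (trial h l) = C.energy \<mu>" by (rule Q_energy(2)[OF trial_T b1 supp])
  also have "\<dots> = integral {1..b} (\<lambda>t. 2 * pi * (?e t + ?d t))"
    unfolding C.energy_def
  proof (rule integral_cong)
    fix t assume t: "t \<in> {1..b}"
    then have t0: "0 < t" by simp
    have "integral {0..2 * pi} (\<lambda>\<theta>. (cylt (trial h l) (t, \<theta>))\<^sup>2 + (cylh (trial h l) (t, \<theta>))\<^sup>2 + \<mu> * (cyl (trial h l) (t, \<theta>))\<^sup>2 / t\<^sup>2)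
      = 2 * pi * ((w' t)\<^sup>2 + \<mu> * (w t)\<^sup>2 / t\<^sup>2)"
      by (simp add: Wt[OF t0] Wh[OF t0] cyl[OF t0])
    also have "(w' t)\<^sup>2 + \<mu> * (w t)\<^sup>2 / t\<^sup>2 = ?e t + ?d t"
    proof -
      have \<mu>s: "\<mu> = s\<^sup>2 / 4 - 1 / 4" unfolding s(2) by (simp add: field_simps)
      show ?thesis unfolding w_def w'_def power_mult_distrib power_divide \<mu>s
        using t0 by (simp add: field_simps power2_eq_square)
    qed
    finally show "integral {0..2 * pi} (\<lambda>\<theta>. (cylt (trial h l) (t, \<theta>))\<^sup>2 + (cylh (trial h l) (t, \<theta>))\<^sup>2 + \<mu> * (cyl (trial h l) (t, \<theta>))\<^sup>2 / t\<^sup>2)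
      = 2 * pi * (?e t + ?d t)" .
  qed
  also have "\<dots> = 2 * pi * integral {1..b} ?e"
    using has_integral_add[OF integrable_integral[OF ei] d0] by (simp add: integral_unique)
  also have "integral {1..b} ?e \<le> integral {1..b} (\<lambda>t. K * (exp (- s * \<bar>ln t - ln l\<bar>) / t))"
  proof (rule integral_le[OF ei])
    show "(\<lambda>t. K * (exp (- s * \<bar>ln t - ln l\<bar>) / t)) integrable_on {1..b}"
      by (intro integrable_continuous_real continuous_intros) auto
    show "?e t \<le> K * (exp (- s * \<bar>ln t - ln l\<bar>) / t)" if "t \<in> {1..b}" for t
      using divide_right_mono[OF E[of "ln t - ln l"], of t] that by simp
  qed
  also have "\<dots> = K * integral {1..b} (\<lambda>t. exp (- s * \<bar>ln t - ln l\<bar>) / t)"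
    by (rule integral_mult_right)
  also have "\<dots> \<le> K * (2 / s)"
    using integral_exp_log_le[OF s(1) l_bounds(4) lb] K by (intro mult_left_mono) auto
  finally show ?thesis by simp
qed

text \<open>For l \<le> t \<le> l exp \<delta> the exponent is at least 2t and cancels the Jacobian
  exp (-2t), so the integrand is at least 1 on a set of measure 2 pi l (exp \<delta> - 1).\<close>

lemma trial_integral_ge:
  assumes \<delta>: "0 < \<delta>" and \<alpha>: "\<And>z. 0 \<le> z \<Longrightarrow> z \<le> \<delta> \<Longrightarrow> 2 \<le> \<alpha> * (k * h z)\<^sup>2"
  shows "ennreal (2 * pi * (l * (exp \<delta> - 1))) \<le> (\<integral>\<^sup>+x. ennreal (exp (\<alpha> * \<bar>k * trial h l x\<bar>\<^sup>2)) \<partial>lebesgue_on B)"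
proof -
  have [measurable]: "trial h l \<in> borel_measurable borel" by (rule T_measurable[OF trial_T])
  have "ennreal (2 * pi * (l * (exp \<delta> - 1))) = (\<integral>\<^sup>+t. ennreal (2 * pi) * indicator {l..l * exp \<delta>} t \<partial>lborel)"
    using l_bounds \<delta> by (simp add: nn_integral_cmult ennreal_mult[symmetric] right_diff_distrib)
  also have "\<dots> \<le> (\<integral>\<^sup>+t\<in>{1..}. (\<integral>\<^sup>+\<theta>\<in>{0..2 * pi}. ennreal (exp (\<alpha> * \<bar>k * trial h l (polar t \<theta>)\<bar>\<^sup>2)) * ennreal (exp (- 2 * t)) \<partial>lborel) \<partial>lborel)"
  proof (rule nn_integral_mono)
    fix t
    show "ennreal (2 * pi) * indicator {l..l * exp \<delta>} t \<le> (\<integral>\<^sup>+\<theta>\<in>{0..2 * pi}. ennreal (exp (\<alpha> * \<bar>k * trial h l (polar t \<theta>)\<bar>\<^sup>2)) * ennreal (exp (- 2 * t)) \<partial>lborel) * indicator {1..} t"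
    proof (cases "t \<in> {l..l * exp \<delta>}")
      case True
      then have t: "1 \<le> t" "0 < t" using l_bounds by auto
      have "ln l \<le> ln t" "ln t \<le> ln (l * exp \<delta>)" using True t l_bounds by (auto intro!: ln_mono)
      then have z: "0 \<le> ln t - ln l" "ln t - ln l \<le> \<delta>" using l_bounds by (auto simp: ln_mult)
      have "1 \<le> exp (\<alpha> * \<bar>k * trial h l (polar t \<theta>)\<bar>\<^sup>2) * exp (- 2 * t)" for \<theta>
      proof -
        have "\<alpha> * \<bar>k * trial h l (polar t \<theta>)\<bar>\<^sup>2 = t * (\<alpha> * (k * h (ln t - ln l))\<^sup>2)"
          using t by (simp add: trial_polar power_mult_distrib)
        moreover have "t * 2 \<le> t * (\<alpha> * (k * h (ln t - ln l))\<^sup>2)" using \<alpha>[OF z] t by (intro mult_left_mono) auto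
        ultimately have "0 \<le> \<alpha> * \<bar>k * trial h l (polar t \<theta>)\<bar>\<^sup>2 + - 2 * t" by linarith
        then show ?thesis unfolding exp_add[symmetric] by simp
      qed
      then have "ennreal 1 \<le> ennreal (exp (\<alpha> * \<bar>k * trial h l (polar t \<theta>)\<bar>\<^sup>2)) * ennreal (exp (- 2 * t))" for \<theta>
        unfolding ennreal_mult'[symmetric, OF exp_ge_zero] by (rule ennreal_leI)
      then have "(\<integral>\<^sup>+\<theta>. ennreal 1 * indicator {0..2 * pi} \<theta> \<partial>lborel) \<le> (\<integral>\<^sup>+\<theta>\<in>{0..2 * pi}. ennreal (exp (\<alpha> * \<bar>k * trial h l (polar t \<theta>)\<bar>\<^sup>2)) * ennreal (exp (- 2 * t)) \<partial>lborel)"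
        by (intro nn_integral_mono mult_right_mono) auto
      then show ?thesis using True t by simp
    qed simp
  qed
  also have "\<dots> = (\<integral>\<^sup>+x. ennreal (exp (\<alpha> * \<bar>k * trial h l x\<bar>\<^sup>2)) \<partial>lebesgue_on B)"
    by (rule nn_integral_ball_polar[symmetric]) measurable
  finally show ?thesis .
qed

end

section \<open>Optimality of the exponent\<close>

lemma prof'_cont:
  assumes "0 < s" "0 < \<eta>" "0 < R"
  shows "continuous_on UNIV (prof' s \<eta> R)"
proof -
  have "prof' s \<eta> R = pd 1 (prof s \<eta> R)"
    using pd_eq[OF prof_deriv[OF assms, unfolded has_field_derivative_def]] by (auto simp: fun_eq_iff)
  moreover have "ck 0 UNIV (pd 1 (prof s \<eta> R))"
    using ck_pd[OF ck_prof[OF assms, of "Suc 0"], of 1] by simp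
  ultimately show ?thesis by (simp add: continuous_on_eq_continuous_at)
qed

text \<open>The excess of \<alpha> over m is spent twice: on the smoothing, through \<eta>, and on
  the cut-off, through R. What is left gives an exponent coefficient above 2 at z = 0, and by
  continuity at least 2 on some [0, \<delta>] independent of l.\<close>

lemma sharpness:
  assumes \<alpha>: "4 * pi * sqrt (1 + 4 * \<mu>) < \<alpha>"
  shows "(SUP u\<in>{u \<in> H1_space V \<mu> r0. H1_norm V \<mu> r0 u \<le> 1}. \<integral>\<^sup>+x. ennreal (exp (\<alpha> * \<bar>u x\<bar>\<^sup>2)) \<partial>lebesgue_on B) = \<infinity>"
proof -
  define s where "s = sqrt (1 + 4 * \<mu>)"
  define m where "m = 4 * pi * s"
  have s: "0 < s" "s\<^sup>2 = 1 + 4 * \<mu>" using \<mu> by (auto simp: s_def)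
  have m: "0 < m" "m < \<alpha>" using s \<alpha> by (auto simp: m_def s_def)
  \<comment> \<open>Half of the value at which exp (s \<eta>) would use up the whole ratio \<alpha>
    / m.\<close>
  define \<eta> where "\<eta> = ln (\<alpha> / m) / (2 * s)"
  have "1 < \<alpha> / m" using m by simp
  then have \<eta>: "0 < \<eta>" using s by (simp add: \<eta>_def)
  have "m < \<alpha> * exp (- s * \<eta>)"
  proof -
    have "s * \<eta> < ln (\<alpha> / m)" using s \<open>1 < \<alpha> / m\<close> by (simp add: \<eta>_def)
    then have "exp (s * \<eta>) < exp (ln (\<alpha> / m))" by simp
    also have "\<dots> = \<alpha> / m" using m by simp
    finally have "m * exp (s * \<eta>) < \<alpha>" using m by (simp add: field_simps)
    then show ?thesis by (simp add: exp_minus field_simps)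
  qed
  define K where "K R = (s / 2 + 4 * exp 1 / R)\<^sup>2 + s\<^sup>2 / 4" for R :: real
  define E where "E R = 2 * pi * (K R * (2 / s))" for R :: real
  \<comment> \<open>The energy bound tends to 2 pi (s^2 / 2) (2 / s) = 2 pi s = m / 2, the energy of
    the exact extremal.\<close>
  have "(E \<longlongrightarrow> 2 * pi * (((s / 2 + 0)\<^sup>2 + s\<^sup>2 / 4) * (2 / s))) at_top"
    unfolding E_def K_def
    by (intro tendsto_intros tendsto_divide_0[OF tendsto_const filterlim_at_top_imp_at_infinity[OF filterlim_ident]])
  moreover have "2 * pi * (((s / 2 + 0)\<^sup>2 + s\<^sup>2 / 4) * (2 / s)) = m / 2"
    using s(1) by (simp add: m_def power2_eq_square field_simps)
  ultimately have "(E \<longlongrightarrow> m / 2) at_top" by (simp only:)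
  moreover have "m / 2 < \<alpha> * exp (- s * \<eta>) / 2" using \<open>m < \<alpha> * exp (- s * \<eta>)\<close> by simp
  ultimately have "\<forall>\<^sub>F R in at_top. E R < \<alpha> * exp (- s * \<eta>) / 2" by (rule order_tendstoD(2))
  from eventually_happens'[OF trivial_limit_at_top_linorder eventually_conj[OF this eventually_gt_at_top[of 0]]]
  obtain R where R: "0 < R" "E R < \<alpha> * exp (- s * \<eta>) / 2" by blast
  have KR: "0 < K R" unfolding K_def using s(1) by (intro add_nonneg_pos) auto
  then have ER: "0 < E R" using s by (simp add: E_def)
  define h where "h = prof s \<eta> R"
  define k where "k = 1 / sqrt (E R)"
  have k2: "k\<^sup>2 = 1 / E R" using ER by (simp add: k_def power_divide)
  note P = s(1) \<eta> R(1)
  have h_cont: "isCont h 0" unfolding h_def using prof_deriv[OF P] DERIV_isCont by blast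
  \<comment> \<open>Normalising by k divides by E R, so the left side is \<alpha> exp (-s \<eta>) /
    E R, which the choice of R makes exceed 2.\<close>
  have "2 < \<alpha> * (k * h 0)\<^sup>2"
    using R(2) ER by (simp add: power_mult_distrib k2 h_def prof_0[OF P] field_simps)
  moreover have "isCont (\<lambda>z. \<alpha> * (k * h z)\<^sup>2) 0" using h_cont by (intro continuous_intros)
  ultimately obtain d where d: "0 < d"
    "\<And>z. dist z 0 < d \<Longrightarrow> dist (\<alpha> * (k * h z)\<^sup>2) (\<alpha> * (k * h 0)\<^sup>2) < \<alpha> * (k * h 0)\<^sup>2 - 2"
    unfolding continuous_at_eps_delta by (metis diff_gt_0_iff_gt)
  define \<delta> where "\<delta> = d / 2"
  have \<delta>: "0 < \<delta>" "\<And>z. 0 \<le> z \<Longrightarrow> z \<le> \<delta> \<Longrightarrow> 2 \<le> \<alpha> * (k * h z)\<^sup>2"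
  proof -
    show "0 < \<delta>" using d(1) by (simp add: \<delta>_def)
    show "2 \<le> \<alpha> * (k * h z)\<^sup>2" if "0 \<le> z" "z \<le> \<delta>" for z
      using d(2)[of z] d(1) that unfolding dist_real_def \<delta>_def by linarith
  qed
  let ?S = "SUP u\<in>{u \<in> H1_space V \<mu> r0. H1_norm V \<mu> r0 u \<le> 1}. \<integral>\<^sup>+x. ennreal (exp (\<alpha> * \<bar>u x\<bar>\<^sup>2)) \<partial>lebesgue_on B"
  have bound: "ennreal (2 * pi * (l * (exp \<delta> - 1))) \<le> ?S" if l: "exp R < l" for l
  proof -
    note A = ck_prof[OF P] prof_deriv[OF P] prof_zero[OF P] R(1) l
    have T: "trial h l \<in> T" unfolding h_def by (rule trial_T[OF A])
    have "Q (trial h l) \<le> E R"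
      unfolding h_def E_def K_def
      by (rule trial_Q_le[OF A s prof_energy_le[OF P] _ prof'_cont[OF P]]) (use KR in \<open>auto simp only: K_def less_imp_le\<close>)
    then have "Q (\<lambda>x. k * trial h l x) \<le> 1"
      unfolding Q_scale[OF T] k2 using ER by (simp add: field_simps)
    then have "H1_norm V \<mu> r0 (\<lambda>x. k * trial h l x) \<le> 1"
      by (simp add: test_function_H1(2)[OF T_scale[OF T]] pre_norm_Q)
    moreover have "(\<lambda>x. k * trial h l x) \<in> H1_space V \<mu> r0" by (rule test_function_H1(1)[OF T_scale[OF T]])
    ultimately have "(\<integral>\<^sup>+x. ennreal (exp (\<alpha> * \<bar>k * trial h l x\<bar>\<^sup>2)) \<partial>lebesgue_on B) \<le> ?S"
      by (intro SUP_upper2[of "\<lambda>x. k * trial h l x"]) auto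
    moreover have "ennreal (2 * pi * (l * (exp \<delta> - 1))) \<le> (\<integral>\<^sup>+x. ennreal (exp (\<alpha> * \<bar>k * trial h l x\<bar>\<^sup>2)) \<partial>lebesgue_on B)"
      using trial_integral_ge[OF A \<delta>(1), of \<alpha> k] \<delta>(2) by (simp add: h_def)
    ultimately show ?thesis by (rule order_trans[rotated])
  qed
  show ?thesis
  proof (rule ccontr)
    assume "?S \<noteq> \<infinity>"
    then obtain r where r: "?S = ennreal r" "0 \<le> r" by (cases ?S) auto
    define c where "c = 2 * pi * (exp \<delta> - 1)"
    have c: "0 < c" using \<delta>(1) by (simp add: c_def)
    \<comment> \<open>The first entry of the maximum makes l admissible, the second pushes the lower
      bound l c to at least r + 1.\<close>
    define l where "l = max (exp R + 1) ((r + 1) / c)"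
    have "ennreal (2 * pi * (l * (exp \<delta> - 1))) \<le> ennreal r" using bound[of l] r by (simp add: l_def)
    then have "2 * pi * (l * (exp \<delta> - 1)) \<le> r" using r by simp
    moreover have "2 * pi * (l * (exp \<delta> - 1)) = l * c" by (simp add: c_def)
    moreover have "(r + 1) / c * c \<le> l * c" using c by (intro mult_right_mono) (auto simp: l_def)
    ultimately show False using c by simp
  qed
qed

end

theorem corollary1p8:
  fixes \<mu> r0 m :: real and V :: "real \<Rightarrow> real"
  assumes "-1/4 < \<mu>" and "\<mu> < 0"
    and "r0 = 1 / exp 1"
    and "V = (\<lambda>r. 1 / (r\<^sup>2 * (ln (1 / r))\<^sup>2))"
    and "m = 4 * pi * sqrt (1 + 4 * \<mu>)"
  shows "(SUP u\<in>{u \<in> H1_space V \<mu> r0. H1_norm V \<mu> r0 u \<le> 1}.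
            \<integral>\<^sup>+x. ennreal (exp (m * \<bar>u x\<bar>\<^sup>2)) \<partial>lebesgue_on (ball 0 r0)) < \<infinity> \<and>
         (\<forall>\<alpha>>m.
            (SUP u\<in>{u \<in> H1_space V \<mu> r0. H1_norm V \<mu> r0 u \<le> 1}.
              \<integral>\<^sup>+x. ennreal (exp (\<alpha> * \<bar>u x\<bar>\<^sup>2)) \<partial>lebesgue_on (ball 0 r0)) = \<infinity>)"
proof -
  interpret log_hardy \<mu> r0 V by unfold_locales (fact assms)+
  have "(SUP u\<in>{u \<in> H1_space V \<mu> r0. H1_norm V \<mu> r0 u \<le> 1}.
      \<integral>\<^sup>+x. ennreal (exp (m * \<bar>u x\<bar>\<^sup>2)) \<partial>lebesgue_on B) \<le> ennreal (MT_const \<mu>)"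
    unfolding assms(5) by (intro SUP_least Moser_Trudinger_H1) auto
  then show ?thesis using sharpness assms(5) by (auto intro: order_le_less_trans)
qed

end
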